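(* Consider the quantum neural network of the context, trained by gradient flow with learning rate $\eta>0$, and assume that $K=K(X,X^T)$ is invertible with minimum eigenvalue $\lambda_{\min}^K$. Let $R(\delta)=\|Y\|_2+\sqrt{2n/\delta}$. Let $0<\delta<1$ be such that $$\lambda_{\min}^K\ge\frac{96n\sqrt{Lm}|\mathcal M|^2|\mathcal N|}{N^2(m)}\sqrt{\log\frac{2n^2}{\delta}}.$$ Then there exists a positive number $\widetilde\lambda_{\min}(\delta)$, given explicitly by $\widetilde\lambda_{\min}(\delta)=\lambda_{\min}^K-g(\delta)-h(\delta)$ with $g,h$ as in the context, satisfying $\widetilde\lambda_{\min}(\delta)\ge\frac13\lambda_{\min}^K$, such that with probability at least $1-\delta$ over the random initialization the following inequalities hold: $$\mathcal L(\Theta_t)\le\frac{R^2(\delta)}2e^{-2\eta\widetilde\lambda_{\min}(\delta)t}\quad\forall t\ge0,$$ $$\|\Theta_t-\Theta_0\|_\infty\le\frac{2\sqrt n\,R(\delta)|\mathcal M|}{N(m)}\frac1{\widetilde\lambda_{\min}(\delta)}\Big(1-e^{-\eta\widetilde\lambda_{\min}(\delta)t}\Big)\quad\forall t\ge0,$$ $$\sup_{x\in\mathcal X,\,t\ge0}\big|f(\Theta_t,x)-f^{\rm lin}(\Theta_t^{\rm lin},x)\big|\le132\,n^2R^2(\delta)\Big(1+\widetilde\lambda_{\min}(\delta)^{-3}\Big)\frac{L^2m^2|\mathcal M|^5|\mathcal N|^2}{N^5(m)}\big(1+\log N(m)\big).$$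
   Context: **Network.** $\mathcal X\subset\mathbb R^d$ is a finite set of inputs. There are $m$ qubits (Hilbert space $(\mathbb C^2)^{\otimes m}$) and $L$ layers. The parameters are $\Theta=(\theta_1,\dots,\theta_{Lm})\in[0,\pi]^{Lm}$; a parameter index is written $[\ell k]=m(\ell-1)+k$ with $1\le\ell\le L$ (layer), $1\le k\le m$ (qubit). Layer $\ell$ is the unitary $U_\ell(\Theta,x)=V_\ell(x)\,\big(W_{[\ell 1]}(\theta_{[\ell1]})\otimes\cdots\otimes W_{[\ell m]}(\theta_{[\ell m]})\big)$, where $W_i(\theta_i)=e^{-\mathrm i\mathcal G_i\theta_i}$ acts on one qubit with $\mathcal G_i=\mathcal G_i^\dagger=\mathcal G_i^{-1}$ a Hermitian $2\times2$ matrix with spectrum in $\{-1,1\}$, and $V_\ell(x)$ is a product of one- and two-qubit gates acting on disjoint qubits, each gate possibly depending on $x$ (the placement of gates is part of the architecture). $U(\Theta,x)=U_L(\Theta,x)\cdots U_1(\Theta,x)$. For each $k$, $\mathcal O_k$ is a traceless Hermitian observable acting on qubit $k$ (identity elsewhere) with spectrum in $[-1,1]$. Put $$f_k(\Theta,x)=\langle 0^m|U^\dagger(\Theta,x)\mathcal O_kU(\Theta,x)|0^m\rangle,\qquad f(\Theta,x)=\frac1{N(m)}\sum_{k=1}^m f_k(\Theta,x).$$ These functions are $\pi$-periodic in each $\theta_i$, hence defined for all $\Theta\in\mathbb R^{Lm}$. **Initialization.** The initial $\theta_i$ are independent and uniform on $[0,\pi]$; the final layer is chosen such that $\mathbb E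 f_k(\Theta,x)=0$ for all $k,x$. Let $\mathcal K_0(x,x')=\mathbb E[f(\Theta,x)f(\Theta,x')]$. It is assumed that $\mathcal K_0(x,x)>0$ for all $x\in\mathcal X$, that the normalization $N(m)>0$ is chosen such that $\max_{x\in\mathcal X}\mathcal K_0(x,x)=1$, and that $N(m)\ge1$. **Light cones.** $\mathcal I_{\ell,k}=\{k':\text{qubits }k,k'\text{ interact (share a two-qubit gate) in layer }\ell\}\cup\{k\}$; $\mathcal J_k^L=\mathcal I_{L,k}$ and $\mathcal J_k^\ell=\bigcup_{k'\in\mathcal J_k^{\ell+1}}\mathcal I_{\ell,k'}$ for $\ell<L$; $\mathcal N_k=\bigcup_{\ell=1}^L\{[\ell k']:k'\in\mathcal J_k^\ell\}$; $\mathcal M_i=\{k:i\in\mathcal N_k\}$; $|\mathcal N|=\max_k|\mathcal N_k|$, $|\mathcal M|=\max_i|\mathcal M_i|$. **Training.** The training set is $\{(x^{(i)},y^{(i)})\}_{i=1}^n\subset\mathcal X\times\mathbb R$, $X=(x^{(1)},\dots,x^{(n)})^T$, $Y=(y^{(1)},\dots,y^{(n)})^T$. The cost is $\mathcal L(\Theta)=\frac12\sum_{i=1}^n(f(\Theta,x^{(i)})-y^{(i)})^2$, and $\Theta_t$ solves $\frac{d}{dt}\Theta_t=-\eta\nabla_\Theta\mathcal L(\Theta_t)$ with $\Theta_0$ the random initialization. The linearized model is $f^{\rm lin}(\Theta,x)=f(\Theta_0,x)+\nabla_\Theta f(\Theta_0,x)^T(\Theta-\Theta_0)$; $\mathcal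 L^{\rm lin}$ is the cost with $f$ replaced by $f^{\rm lin}$, and $\Theta^{\rm lin}_t$ solves $\frac{d}{dt}\Theta_t^{\rm lin}=-\eta\nabla_\Theta\mathcal L^{\rm lin}(\Theta_t^{\rm lin})$, $\Theta_0^{\rm lin}=\Theta_0$. **Kernels.** $\hat K_\Theta(x,x')=\nabla_\Theta f(\Theta,x)^T\nabla_\Theta f(\Theta,x')$ and $K(x,x')=\mathbb E[\hat K_{\Theta_0}(x,x')]$; $K=K(X,X^T)$ is the $n\times n$ matrix with entries $K(x^{(i)},x^{(j)})$. **Explicit quantities.** $$g(\delta)=\frac{16n\sqrt{Lm}|\mathcal M|^2|\mathcal N|}{N^2(m)}\sqrt{\log\frac{2n^2}\delta},\qquad h(\delta)=16n\frac{Lm|\mathcal M|^2|\mathcal N|}{N^2(m)}\rho(m),$$ $$\rho(m)=\frac12\,\frac{N^2(m)}{16nLm|\mathcal M|^2|\mathcal N|}\big(\lambda_{\min}^K-g(\delta)\big)\left(1-\sqrt{1-\frac{128n\sqrt n\,R(\delta)}{(\lambda_{\min}^K-g(\delta))^2}\frac{Lm|\mathcal M|^3|\mathcal N|}{N^3(m)}}\right).$$ $\log$ is natural.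
   Formalization: The formal theorem additionally assumes that the expression under the square root in ρ(m) is nonnegative, so that the explicit λ̃_min(δ) is a real number; without this the claim fails, e.g. for a single training example with very large label, where the loss cannot decay. *)

theory Defs
  imports
    "HOL-Probability.Probability"
    "Jordan_Normal_Form.Spectral_Radius"
begin

hide_const (open) Finite_Cartesian_Product.vec Finite_Cartesian_Product.mat

section \<open>Qubits and gates\<close>

text \<open>Operators on m qubits are complex matrices of dimension \<open>2 ^ m\<close>. The qubits are
  numbered \<open>1, \<dots>, m\<close>, and qubit k carries the k-th most significant bit of a basis
  index, so that basis indices are ordered as in the usual Kronecker product.\<close>

definition qubit_bit :: "nat \<Rightarrow> nat \<Rightarrow> nat \<Rightarrow> nat" where
  "qubit_bit m i k = (i div 2 ^ (m - k)) mod 2"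

text \<open>The basis index, in the space of the qubits listed in ks, of the restriction of the
  basis index i to these qubits; the head of ks is the most significant qubit.\<close>

definition sub_index :: "nat \<Rightarrow> nat list \<Rightarrow> nat \<Rightarrow> nat" where
  "sub_index m ks i = foldl (\<lambda>a k. 2 * a + qubit_bit m i k) 0 ks"

text \<open>The operator A on the qubits listed in ks, tensored with the identity on all the others.\<close>

definition embed_op :: "nat \<Rightarrow> nat list \<Rightarrow> complex mat \<Rightarrow> complex mat" where
  "embed_op m ks A = mat (2 ^ m) (2 ^ m) (\<lambda>(i, j).
     if \<forall>k\<in>{1..m} - set ks. qubit_bit m i k = qubit_bit m j k
     then A $$ (sub_index m ks i, sub_index m ks j) else 0)"

text \<open>The tensor product of the 2x2 matrices \<open>A 1, \<dots>, A m\<close>.\<close>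

definition tensor_ops :: "nat \<Rightarrow> (nat \<Rightarrow> complex mat) \<Rightarrow> complex mat" where
  "tensor_ops m A = mat (2 ^ m) (2 ^ m)
     (\<lambda>(i, j). \<Prod>k = 1..m. A k $$ (qubit_bit m i k, qubit_bit m j k))"

definition mat_exp :: "complex mat \<Rightarrow> complex mat" where
  "mat_exp A = mat (dim_row A) (dim_row A)
     (\<lambda>(i, j). \<Sum>p. (A ^\<^sub>m p) $$ (i, j) / of_nat (fact p))"

definition hermitian_mat :: "complex mat \<Rightarrow> bool" where
  "hermitian_mat A \<longleftrightarrow> square_mat A \<and> mat_adjoint A = A"

definition unitary_mat :: "complex mat \<Rightarrow> bool" where
  "unitary_mat A \<longleftrightarrow> square_mat A \<and> inverts_mat A (mat_adjoint A) \<and> inverts_mat (mat_adjoint A) A"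

section \<open>The network\<close>

text \<open>\<open>placement Q l\<close> lists the gates of \<open>V\<^sub>l\<close>, each gate being given by the list of the one or
  two qubits on which it acts; \<open>gate Q l ks x\<close> is the unitary applied by the gate on ks in
  layer l for the input x.\<close>

record 'x qnn =
  qubits :: nat
  layers :: nat
  generator :: "nat \<Rightarrow> complex mat"
  placement :: "nat \<Rightarrow> nat list list"
  gate :: "nat \<Rightarrow> nat list \<Rightarrow> 'x \<Rightarrow> complex mat"
  observable :: "nat \<Rightarrow> complex mat"
  normalization :: real

type_synonym params = "nat \<Rightarrow> real"

definition param_indices :: "'x qnn \<Rightarrow> nat set" where
  "param_indices Q = {1..layers Q * qubits Q}"

definition param_index :: "'x qnn \<Rightarrow> nat \<Rightarrow> nat \<Rightarrow> nat" where
  "param_index Q l k = qubits Q * (l - 1) + k"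

definition W_op :: "'x qnn \<Rightarrow> nat \<Rightarrow> real \<Rightarrow> complex mat" where
  "W_op Q i t = mat_exp ((- \<i> * complex_of_real t) \<cdot>\<^sub>m generator Q i)"

definition V_op :: "'x qnn \<Rightarrow> nat \<Rightarrow> 'x \<Rightarrow> complex mat" where
  "V_op Q l x = foldr (\<lambda>ks B. embed_op (qubits Q) ks (gate Q l ks x) * B)
     (placement Q l) (1\<^sub>m (2 ^ qubits Q))"

definition layer_op :: "'x qnn \<Rightarrow> nat \<Rightarrow> params \<Rightarrow> 'x \<Rightarrow> complex mat" where
  "layer_op Q l \<Theta> x = V_op Q l x *
     tensor_ops (qubits Q) (\<lambda>k. W_op Q (param_index Q l k) (\<Theta> (param_index Q l k)))"

primrec circuit_upto :: "'x qnn \<Rightarrow> nat \<Rightarrow> params \<Rightarrow> 'x \<Rightarrow> complex mat" where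
  "circuit_upto Q 0 \<Theta> x = 1\<^sub>m (2 ^ qubits Q)"
| "circuit_upto Q (Suc l) \<Theta> x = layer_op Q (Suc l) \<Theta> x * circuit_upto Q l \<Theta> x"

definition circuit :: "'x qnn \<Rightarrow> params \<Rightarrow> 'x \<Rightarrow> complex mat" where
  "circuit Q \<Theta> x = circuit_upto Q (layers Q) \<Theta> x"

text \<open>The expectation value in the state \<open>|0\<^sup>m\<rangle>\<close>, which has basis index 0. It is real because the
  observable is Hermitian; Re only performs the change of type.\<close>

definition f_local :: "'x qnn \<Rightarrow> nat \<Rightarrow> params \<Rightarrow> 'x \<Rightarrow> real" where
  "f_local Q k \<Theta> x = Re ((mat_adjoint (circuit Q \<Theta> x) *
     embed_op (qubits Q) [k] (observable Q k) * circuit Q \<Theta> x) $$ (0, 0))"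

definition f_model :: "'x qnn \<Rightarrow> params \<Rightarrow> 'x \<Rightarrow> real" where
  "f_model Q \<Theta> x = 1 / normalization Q * (\<Sum>k = 1..qubits Q. f_local Q k \<Theta> x)"

section \<open>Initialization\<close>

definition init_dist :: "'x qnn \<Rightarrow> params measure" where
  "init_dist Q = Pi\<^sub>M (param_indices Q) (\<lambda>_. uniform_measure lborel {0..pi})"

definition cov0 :: "'x qnn \<Rightarrow> 'x \<Rightarrow> 'x \<Rightarrow> real" where
  "cov0 Q x x' = (\<integral>\<Theta>. f_model Q \<Theta> x * f_model Q \<Theta> x' \<partial>init_dist Q)"

section \<open>Light cones\<close>

definition interacting :: "'x qnn \<Rightarrow> nat \<Rightarrow> nat \<Rightarrow> nat set" where
  "interacting Q l k =
     {k'. \<exists>ks\<in>set (placement Q l). length ks = 2 \<and> k \<in> set ks \<and> k' \<in> set ks} \<union> {k}"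

text \<open>The recursion over the layers runs downwards from the last one: \<open>light_cone_rec Q k j\<close> is
  \<open>J\<^sub>k\<close> at layer \<open>layers Q - j\<close>.\<close>

primrec light_cone_rec :: "'x qnn \<Rightarrow> nat \<Rightarrow> nat \<Rightarrow> nat set" where
  "light_cone_rec Q k 0 = interacting Q (layers Q) k"
| "light_cone_rec Q k (Suc j) =
     (\<Union>k'\<in>light_cone_rec Q k j. interacting Q (layers Q - Suc j) k')"

definition light_cone :: "'x qnn \<Rightarrow> nat \<Rightarrow> nat \<Rightarrow> nat set" where
  "light_cone Q l k = light_cone_rec Q k (layers Q - l)"

definition past_cone :: "'x qnn \<Rightarrow> nat \<Rightarrow> nat set" where
  "past_cone Q k = (\<Union>l\<in>{1..layers Q}. {param_index Q l k' | k'. k' \<in> light_cone Q l k})"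

definition future_cone :: "'x qnn \<Rightarrow> nat \<Rightarrow> nat set" where
  "future_cone Q i = {k \<in> {1..qubits Q}. i \<in> past_cone Q k}"

definition card_N :: "'x qnn \<Rightarrow> nat" where
  "card_N Q = Max ((\<lambda>k. card (past_cone Q k)) ` {1..qubits Q})"

definition card_M :: "'x qnn \<Rightarrow> nat" where
  "card_M Q = Max ((\<lambda>i. card (future_cone Q i)) ` param_indices Q)"

section \<open>Standing assumptions\<close>

definition valid_circuit :: "'x qnn \<Rightarrow> bool" where
  "valid_circuit Q \<longleftrightarrow>
     1 \<le> qubits Q \<and> 1 \<le> layers Q \<and>
     (\<forall>i\<in>param_indices Q. generator Q i \<in> carrier_mat 2 2 \<and> hermitian_mat (generator Q i) \<and>
        inverts_mat (generator Q i) (generator Q i) \<and> spectrum (generator Q i) \<subseteq> {- 1, 1}) \<and>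
     (\<forall>l\<in>{1..layers Q}. distinct (concat (placement Q l)) \<and>
        (\<forall>ks\<in>set (placement Q l). length ks \<in> {1, 2} \<and> set ks \<subseteq> {1..qubits Q} \<and>
           (\<forall>x. gate Q l ks x \<in> carrier_mat (2 ^ length ks) (2 ^ length ks) \<and>
                unitary_mat (gate Q l ks x)))) \<and>
     (\<forall>k\<in>{1..qubits Q}. observable Q k \<in> carrier_mat 2 2 \<and> hermitian_mat (observable Q k) \<and>
        (\<Sum>i<2. observable Q k $$ (i, i)) = 0 \<and>
        spectrum (observable Q k) \<subseteq> complex_of_real ` {- 1..1})"

definition valid_init :: "'x set \<Rightarrow> 'x qnn \<Rightarrow> bool" where
  "valid_init \<X> Q \<longleftrightarrow>
     (\<forall>k\<in>{1..qubits Q}. \<forall>x\<in>\<X>. (\<integral>\<Theta>. f_local Q k \<Theta> x \<partial>init_dist Q) = 0) \<and>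
     (\<forall>x\<in>\<X>. 0 < cov0 Q x x) \<and>
     Max ((\<lambda>x. cov0 Q x x) ` \<X>) = 1 \<and>
     1 \<le> normalization Q"

section \<open>Training\<close>

definition partial_deriv :: "nat \<Rightarrow> (params \<Rightarrow> real) \<Rightarrow> params \<Rightarrow> real" where
  "partial_deriv i F \<Theta> = deriv (\<lambda>s. F (fun_upd \<Theta> i s)) (\<Theta> i)"

text \<open>Training examples are indexed by \<open>0, \<dots>, n - 1\<close>.\<close>

definition cost ::
  "nat \<Rightarrow> (nat \<Rightarrow> 'x) \<Rightarrow> (nat \<Rightarrow> real) \<Rightarrow> (params \<Rightarrow> 'x \<Rightarrow> real) \<Rightarrow> params \<Rightarrow> real" where
  "cost n xs ys F \<Theta> = 1 / 2 * (\<Sum>i<n. (F \<Theta> (xs i) - ys i)\<^sup>2)"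

definition f_lin :: "'x qnn \<Rightarrow> params \<Rightarrow> params \<Rightarrow> 'x \<Rightarrow> real" where
  "f_lin Q \<Theta>0 \<Theta> x = f_model Q \<Theta>0 x +
     (\<Sum>i\<in>param_indices Q. partial_deriv i (\<lambda>\<Theta>'. f_model Q \<Theta>' x) \<Theta>0 * (\<Theta> i - \<Theta>0 i))"

text \<open>Only the coordinates in \<open>param_indices Q\<close> are constrained; no other coordinate
  influences \<open>f_model\<close> or \<open>f_lin\<close>.\<close>

definition gradient_flow ::
  "'x qnn \<Rightarrow> real \<Rightarrow> (params \<Rightarrow> real) \<Rightarrow> params \<Rightarrow> (real \<Rightarrow> params) \<Rightarrow> bool" where
  "gradient_flow Q \<eta> C \<Theta>0 \<Theta> \<longleftrightarrow>
     (\<forall>i\<in>param_indices Q. \<Theta> 0 i = \<Theta>0 i) \<and>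
     (\<forall>t\<ge>0. \<forall>i\<in>param_indices Q.
        ((\<lambda>s. \<Theta> s i) has_real_derivative - \<eta> * partial_deriv i C (\<Theta> t)) (at t within {0..}))"

definition params_dist_inf :: "'x qnn \<Rightarrow> params \<Rightarrow> params \<Rightarrow> real" where
  "params_dist_inf Q \<Theta> \<Theta>' = Max ((\<lambda>i. \<bar>\<Theta> i - \<Theta>' i\<bar>) ` param_indices Q)"

section \<open>Neural tangent kernel\<close>

definition empirical_ntk :: "'x qnn \<Rightarrow> params \<Rightarrow> 'x \<Rightarrow> 'x \<Rightarrow> real" where
  "empirical_ntk Q \<Theta> x x' = (\<Sum>i\<in>param_indices Q.
     partial_deriv i (\<lambda>\<Theta>'. f_model Q \<Theta>' x) \<Theta> * partial_deriv i (\<lambda>\<Theta>'. f_model Q \<Theta>' x') \<Theta>)"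

definition ntk :: "'x qnn \<Rightarrow> 'x \<Rightarrow> 'x \<Rightarrow> real" where
  "ntk Q x x' = (\<integral>\<Theta>. empirical_ntk Q \<Theta> x x' \<partial>init_dist Q)"

definition ntk_mat :: "'x qnn \<Rightarrow> nat \<Rightarrow> (nat \<Rightarrow> 'x) \<Rightarrow> real mat" where
  "ntk_mat Q n xs = mat n n (\<lambda>(i, j). ntk Q (xs i) (xs j))"

definition lambda_min :: "'x qnn \<Rightarrow> nat \<Rightarrow> (nat \<Rightarrow> 'x) \<Rightarrow> real" where
  "lambda_min Q n xs = Min (spectrum (ntk_mat Q n xs))"

section \<open>The explicit constants\<close>

definition R_const :: "nat \<Rightarrow> (nat \<Rightarrow> real) \<Rightarrow> real \<Rightarrow> real" where
  "R_const n ys \<delta> = L2_set ys {..<n} + sqrt (2 * real n / \<delta>)"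

definition g_const :: "'x qnn \<Rightarrow> nat \<Rightarrow> real \<Rightarrow> real" where
  "g_const Q n \<delta> =
     16 * real n * sqrt (real (layers Q * qubits Q)) * real (card_M Q) ^ 2 * real (card_N Q)
       / normalization Q ^ 2 * sqrt (ln (2 * real n ^ 2 / \<delta>))"

text \<open>The formula for \<open>rho\<close> is a real number only if this radicand is nonnegative (the library's
  sqrt is odd, so on negative numbers it does not signal an error).\<close>

definition rho_radicand ::
  "'x qnn \<Rightarrow> nat \<Rightarrow> (nat \<Rightarrow> 'x) \<Rightarrow> (nat \<Rightarrow> real) \<Rightarrow> real \<Rightarrow> real" where
  "rho_radicand Q n xs ys \<delta> =
     1 - 128 * real n * sqrt (real n) * R_const n ys \<delta> / (lambda_min Q n xs - g_const Q n \<delta>) ^ 2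
       * (real (layers Q * qubits Q) * real (card_M Q) ^ 3 * real (card_N Q)
            / normalization Q ^ 3)"

definition rho ::
  "'x qnn \<Rightarrow> nat \<Rightarrow> (nat \<Rightarrow> 'x) \<Rightarrow> (nat \<Rightarrow> real) \<Rightarrow> real \<Rightarrow> real" where
  "rho Q n xs ys \<delta> =
     1 / 2 * (normalization Q ^ 2
       / (16 * real n * real (layers Q * qubits Q) * real (card_M Q) ^ 2 * real (card_N Q)))
     * (lambda_min Q n xs - g_const Q n \<delta>) * (1 - sqrt (rho_radicand Q n xs ys \<delta>))"

definition h_const ::
  "'x qnn \<Rightarrow> nat \<Rightarrow> (nat \<Rightarrow> 'x) \<Rightarrow> (nat \<Rightarrow> real) \<Rightarrow> real \<Rightarrow> real" where
  "h_const Q n xs ys \<delta> =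
     16 * real n * (real (layers Q * qubits Q) * real (card_M Q) ^ 2 * real (card_N Q)
       / normalization Q ^ 2) * rho Q n xs ys \<delta>"

end

theory Submission
  imports Defs
begin

text \<open>With the other parameters fixed, a single parameter s enters every expectation value as
  \<open>a + b cos 2s + c sin 2s\<close>. Hence a partial derivative is the difference of the values at
  \<open>s \<plusminus> \<pi>/4\<close>, and the bound 1 on the local expectation values passes to all derivatives and to the
  variation of the tangent kernel. In the Heisenberg picture a gate away from the support of the
  evolved observable cancels; so only the parameters in the light cone contribute.

  Initialization: Markov's inequality bounds the initial residual by R, and McDiarmid's
  inequality keeps the empirical kernel within g of its mean. Training: while every parameter is
  within \<open>\<rho>\<close> of its initial value, the kernel matrix stays above \<open>\<Lambda>\<close>, so the residual decays
  like \<open>exp (- \<eta> \<Lambda> t)\<close> and the parameters have not even reached distance \<open>\<rho>\<close>; a continuity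
  argument makes this hold for all times. The choice of \<open>\<rho>\<close> as a root of
  \<open>\<rho> \<Lambda>(\<rho>) = 2 \<surd>n R M / N\<close> closes the loop. The deviation from the linearized model then
  follows by comparing the two flows with explicit primitives; to bring its two terms to a
  common order one needs that the squared normalization is at most \<open>4/3 L m M\<^sup>2\<close>, which is a
  variance bound for functions of independent variables with bounded differences.\<close>

section \<open>Concentration for functions with bounded differences\<close>

text \<open>Two obstacles shape the development. The coefficients a, b, c in one parameter depend on
  the other parameters in an unspecified way, so nothing is known jointly. Interpolation at three
  fixed nodes replaces them by values of the function itself, and the chain rule and measurability
  then follow by induction on the coordinates. The second obstacle is a circularity: the rate
  \<Lambda> is available only in a ball whose radius depends on \<Lambda>. The resulting equation is
  quadratic in \<rho>, \<open>rho_radicand\<close> is its normalized discriminant, and the smaller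
  root loses at most half of the gap between \<open>lambda_min\<close> and \<open>g_const\<close>.
  Since 96 = 6 * 16, at least 5/12 of \<open>lambda_min\<close> remains.

  The failure probability is split evenly between the initial residual and the n^2 kernel entries.
  Entrywise kernel errors become errors of the quadratic form at the price of a factor n. The
  deviation from the linearized model is damped only on the training points; at other inputs it is
  obtained by integrating the bound on the training set.\<close>

lemma bounded_differences_nn_integral_exp:
  fixes M :: "'i \<Rightarrow> 'a measure" and F :: "('i \<Rightarrow> 'a) \<Rightarrow> real"
  assumes prob: "\<And>i. prob_space (M i)" and "finite I"
    and "F \<in> borel_measurable (Pi\<^sub>M I M)"
    and "\<And>x. x \<in> space (Pi\<^sub>M I M) \<Longrightarrow> \<bar>F x\<bar> \<le> B"
    and "\<And>i x z. i \<in> I \<Longrightarrow> x \<in> space (Pi\<^sub>M I M) \<Longrightarrow> z \<in> space (M i) \<Longrightarrow> \<bar>F (x(i := z)) - F x\<bar> \<le> c i"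
    and s: "0 < s"
  shows "(\<integral>\<^sup>+x. ennreal (exp (s * (F x - integral\<^sup>L (Pi\<^sub>M I M) F))) \<partial>Pi\<^sub>M I M)
    \<le> ennreal (exp (s\<^sup>2 * (\<Sum>i\<in>I. (c i)\<^sup>2) / 8))"
  using assms(2-5)
proof (induction I arbitrary: F)
  case empty
  interpret product_sigma_finite M
    using prob by (simp add: product_sigma_finite_def prob_space_imp_sigma_finite)
  show ?case by (simp add: PiM_empty nn_integral_count_space_finite lebesgue_integral_count_space_finite)
next
  case (insert i I)
  interpret product_sigma_finite M
    using prob by (simp add: product_sigma_finite_def prob_space_imp_sigma_finite)
  interpret PI: prob_space "Pi\<^sub>M I M" by (intro prob_space_PiM prob)
  interpret PII: prob_space "Pi\<^sub>M (insert i I) M" by (intro prob_space_PiM prob)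
  interpret Mi: prob_space "M i" by (rule prob)
  note Fm[measurable] = insert.prems(1)
  have upd[measurable]: "(\<lambda>(f, y). f(i := y)) \<in> measurable (Pi\<^sub>M I M \<Otimes>\<^sub>M M i) (Pi\<^sub>M (insert i I) M)"
    by (rule measurable_add_dim)
  have FF[measurable]: "(\<lambda>(f, y). F (f(i := y))) \<in> borel_measurable (Pi\<^sub>M I M \<Otimes>\<^sub>M M i)"
    using measurable_compose[OF upd Fm] by (simp add: case_prod_unfold)
  have upd_space: "x(i := z) \<in> space (Pi\<^sub>M (insert i I) M)" if "x \<in> space (Pi\<^sub>M I M)" "z \<in> space (M i)" for x z
    using measurable_space[OF upd, of "(x, z)"] that by (simp add: space_pair_measure)
  \<comment> \<open>Integrating out coordinate \<open>i\<close> preserves the bound \<open>B\<close>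
    and the differences \<open>c j\<close> of the other coordinates, so the induction hypothesis
    applies to \<open>G\<close>. For fixed other coordinates, Hoeffding's lemma bounds the remaining
    fluctuation of F around G and contributes the factor with \<open>c i\<close>.\<close>
  define G where "G x = (\<integral>z. F (x(i := z)) \<partial>M i)" for x
  have Gm[measurable]: "G \<in> borel_measurable (Pi\<^sub>M I M)"
    unfolding G_def using FF by (rule sigma_finite_measure.borel_measurable_lebesgue_integral[OF sigma_finite_measures])
  have Fint: "integrable (Pi\<^sub>M (insert i I) M) F"
    by (rule PII.integrable_const_bound[where B = B]) (use insert.prems(2) Fm in \<open>auto intro!: AE_I2\<close>)
  have Fxm[measurable]: "(\<lambda>z. F (x(i := z))) \<in> borel_measurable (M i)" if "x \<in> space (Pi\<^sub>M I M)" for x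
    using measurable_compose[OF measurable_Pair1'[OF that] FF] by simp
  have Fxint: "integrable (M i) (\<lambda>z. F (x(i := z)))" if "x \<in> space (Pi\<^sub>M I M)" for x
    by (rule Mi.integrable_const_bound[where B = B]) (use insert.prems(2) upd_space[OF that] Fxm[OF that] in \<open>auto intro!: AE_I2\<close>)
  have EG: "integral\<^sup>L (Pi\<^sub>M (insert i I) M) F = integral\<^sup>L (Pi\<^sub>M I M) G"
    using product_integral_insert[OF insert.hyps Fint] unfolding G_def .
  have Gb: "\<bar>G x\<bar> \<le> B" if x: "x \<in> space (Pi\<^sub>M I M)" for x
  proof -
    have "\<bar>G x\<bar> \<le> (\<integral>z. \<bar>F (x(i := z))\<bar> \<partial>M i)" unfolding G_def by (rule integral_abs_bound)
    also have "\<dots> \<le> (\<integral>z. B \<partial>M i)"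
      by (rule integral_mono) (use Fxint[OF x] insert.prems(2) upd_space[OF x] in auto)
    finally show ?thesis by (simp add: Mi.prob_space)
  qed
  have Gd: "\<bar>G (x(j := w)) - G x\<bar> \<le> c j"
    if j: "j \<in> I" and x: "x \<in> space (Pi\<^sub>M I M)" and w: "w \<in> space (M j)" for j x w
  proof -
    have xj: "x(j := w) \<in> space (Pi\<^sub>M I M)" using x w j by (auto simp: space_PiM PiE_iff extensional_def)
    have ji: "j \<noteq> i" using j insert.hyps by auto
    have "\<bar>G (x(j := w)) - G x\<bar> = \<bar>\<integral>z. F (x(j := w, i := z)) - F (x(i := z)) \<partial>M i\<bar>"
      unfolding G_def using Fxint[OF x] Fxint[OF xj] by simp
    also have "\<dots> \<le> (\<integral>z. \<bar>F (x(j := w, i := z)) - F (x(i := z))\<bar> \<partial>M i)" by (rule integral_abs_bound)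
    also have "\<dots> \<le> (\<integral>z. c j \<partial>M i)"
    proof (rule integral_mono)
      fix z assume z: "z \<in> space (M i)"
      show "\<bar>F (x(j := w, i := z)) - F (x(i := z))\<bar> \<le> c j"
        unfolding fun_upd_twist[OF ji] using insert.prems(3) j upd_space[OF x z] w by blast
    qed (use Fxint[OF x] Fxint[OF xj] in auto)
    finally show ?thesis by (simp add: Mi.prob_space)
  qed
  have inner: "(\<integral>\<^sup>+z. ennreal (exp (s * (F (x(i := z)) - G x))) \<partial>M i) \<le> ennreal (exp (s\<^sup>2 * (c i)\<^sup>2 / 8))"
    if x: "x \<in> space (Pi\<^sub>M I M)" for x
  proof -
    \<comment> \<open>Hoeffding's lemma wants an interval, while bounded differences only give a
      diameter: the infimum of the section serves as left end point.\<close>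
    define a where "a = (INF z\<in>space (M i). F (x(i := z)))"
    have bdd: "bdd_below ((\<lambda>z. F (x(i := z))) ` space (M i))"
      by (intro bdd_belowI[where m = "-B"]) (use insert.prems(2) upd_space[OF x] in \<open>fastforce simp: abs_le_iff\<close>)
    have "F (x(i := z)) \<in> {a..a + c i}" if z: "z \<in> space (M i)" for z
    proof -
      have "F (x(i := z)) - c i \<le> a" unfolding a_def
      proof (rule cINF_greatest)
        show "space (M i) \<noteq> {}" by (rule Mi.not_empty)
        fix w assume w: "w \<in> space (M i)"
        have "\<bar>F (x(i := w, i := z)) - F (x(i := w))\<bar> \<le> c i"
          by (rule insert.prems(3)[OF insertI1 upd_space[OF x w] z])
        then show "F (x(i := z)) - c i \<le> F (x(i := w))" unfolding fun_upd_upd by linarith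
      qed
      moreover have "a \<le> F (x(i := z))" unfolding a_def by (rule cINF_lower[OF bdd z])
      ultimately show ?thesis by simp
    qed
    then interpret interval_bounded_random_variable "M i" "\<lambda>z. F (x(i := z))" a "a + c i"
      using Fxm[OF x] by unfold_locales auto
    show ?thesis using Hoeffdings_lemma_nn_integral[OF s] by (simp add: G_def)
  qed
  have "(\<integral>\<^sup>+x. ennreal (exp (s * (F x - integral\<^sup>L (Pi\<^sub>M (insert i I) M) F))) \<partial>Pi\<^sub>M (insert i I) M)
    = (\<integral>\<^sup>+x. \<integral>\<^sup>+z. ennreal (exp (s * (F (x(i := z)) - integral\<^sup>L (Pi\<^sub>M I M) G))) \<partial>M i \<partial>Pi\<^sub>M I M)"
    unfolding EG by (rule product_nn_integral_insert[OF insert.hyps]) measurable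
  also have "\<dots> = (\<integral>\<^sup>+x. ennreal (exp (s * (G x - integral\<^sup>L (Pi\<^sub>M I M) G)))
        * (\<integral>\<^sup>+z. ennreal (exp (s * (F (x(i := z)) - G x))) \<partial>M i) \<partial>Pi\<^sub>M I M)"
  proof (rule nn_integral_cong)
    fix x assume x: "x \<in> space (Pi\<^sub>M I M)"
    note [measurable] = Fxm[OF x]
    show "(\<integral>\<^sup>+z. ennreal (exp (s * (F (x(i := z)) - integral\<^sup>L (Pi\<^sub>M I M) G))) \<partial>M i)
      = ennreal (exp (s * (G x - integral\<^sup>L (Pi\<^sub>M I M) G))) * (\<integral>\<^sup>+z. ennreal (exp (s * (F (x(i := z)) - G x))) \<partial>M i)"
      by (subst nn_integral_cmult[symmetric])
         (auto simp flip: ennreal_mult exp_add intro!: nn_integral_cong simp: algebra_simps)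
  qed
  also have "\<dots> \<le> (\<integral>\<^sup>+x. ennreal (exp (s * (G x - integral\<^sup>L (Pi\<^sub>M I M) G))) * ennreal (exp (s\<^sup>2 * (c i)\<^sup>2 / 8)) \<partial>Pi\<^sub>M I M)"
    by (intro nn_integral_mono mult_left_mono inner) auto
  also have "\<dots> = (\<integral>\<^sup>+x. ennreal (exp (s * (G x - integral\<^sup>L (Pi\<^sub>M I M) G))) \<partial>Pi\<^sub>M I M) * ennreal (exp (s\<^sup>2 * (c i)\<^sup>2 / 8))"
    by (rule nn_integral_multc) measurable
  also have "\<dots> \<le> ennreal (exp (s\<^sup>2 * (\<Sum>i\<in>I. (c i)\<^sup>2) / 8)) * ennreal (exp (s\<^sup>2 * (c i)\<^sup>2 / 8))"
    by (intro mult_right_mono insert.IH Gm Gb Gd) auto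
  also have "\<dots> = ennreal (exp (s\<^sup>2 * (\<Sum>i\<in>insert i I. (c i)\<^sup>2) / 8))"
    using insert.hyps by (simp flip: ennreal_mult exp_add add: field_simps)
  finally show ?case .
qed

lemma bounded_differences_tail:
  fixes M :: "'i \<Rightarrow> 'a measure" and F :: "('i \<Rightarrow> 'a) \<Rightarrow> real"
  assumes prob: "\<And>i. prob_space (M i)" and "finite I"
    and F[measurable]: "F \<in> borel_measurable (Pi\<^sub>M I M)"
    and "\<And>x. x \<in> space (Pi\<^sub>M I M) \<Longrightarrow> \<bar>F x\<bar> \<le> B"
    and "\<And>i x z. i \<in> I \<Longrightarrow> x \<in> space (Pi\<^sub>M I M) \<Longrightarrow> z \<in> space (M i) \<Longrightarrow> \<bar>F (x(i := z)) - F x\<bar> \<le> c i"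
    and V: "V = (\<Sum>i\<in>I. (c i)\<^sup>2)" "0 < V" and e: "0 < \<epsilon>"
  shows "measure (Pi\<^sub>M I M) {x\<in>space (Pi\<^sub>M I M). F x - integral\<^sup>L (Pi\<^sub>M I M) F \<ge> \<epsilon>} \<le> exp (- 2 * \<epsilon>\<^sup>2 / V)"
proof -
  interpret prob_space "Pi\<^sub>M I M" by (intro prob_space_PiM prob)
  \<comment> \<open>The minimizer of the Chernoff exponent
    \<open>- l * \<epsilon> + l\<^sup>2 * V / 8\<close>.\<close>
  define l where "l = 4 * \<epsilon> / V"
  have l: "l > 0" using V e by (simp add: l_def)
  let ?E = "integral\<^sup>L (Pi\<^sub>M I M) F"
  have "ennreal (prob {x\<in>space (Pi\<^sub>M I M). F x - ?E \<ge> \<epsilon>})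
      = emeasure (Pi\<^sub>M I M) {x\<in>space (Pi\<^sub>M I M). F x - ?E \<ge> \<epsilon>}"
    by (simp add: emeasure_eq_measure)
  also have "\<dots> \<le> ennreal (exp (-l * \<epsilon>)) * (\<integral>\<^sup>+x\<in>space (Pi\<^sub>M I M). exp (l * (F x - ?E)) \<partial>Pi\<^sub>M I M)"
    by (intro Chernoff_ineq_nn_integral_ge l) auto
  also have "(\<integral>\<^sup>+x\<in>space (Pi\<^sub>M I M). exp (l * (F x - ?E)) \<partial>Pi\<^sub>M I M) = (\<integral>\<^sup>+x. exp (l * (F x - ?E)) \<partial>Pi\<^sub>M I M)"
    by (intro nn_integral_cong) auto
  also have "ennreal (exp (-l * \<epsilon>)) * \<dots> \<le> ennreal (exp (-l * \<epsilon>)) * ennreal (exp (l\<^sup>2 * (\<Sum>i\<in>I. (c i)\<^sup>2) / 8))"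
    by (intro mult_left_mono bounded_differences_nn_integral_exp[OF prob assms(2-5) l]) auto
  also have "\<dots> = ennreal (exp (- 2 * \<epsilon>\<^sup>2 / V))"
    using V(2) by (simp flip: ennreal_mult exp_add V(1))
      (simp add: l_def field_simps power2_eq_square)
  finally show ?thesis by (subst (asm) ennreal_le_iff) simp_all
qed

lemma bounded_differences_two_sided:
  fixes M :: "'i \<Rightarrow> 'a measure" and F :: "('i \<Rightarrow> 'a) \<Rightarrow> real"
  assumes prob: "\<And>i. prob_space (M i)" and fin: "finite I"
    and F[measurable]: "F \<in> borel_measurable (Pi\<^sub>M I M)"
    and B: "\<And>x. x \<in> space (Pi\<^sub>M I M) \<Longrightarrow> \<bar>F x\<bar> \<le> B"
    and D: "\<And>i x z. i \<in> I \<Longrightarrow> x \<in> space (Pi\<^sub>M I M) \<Longrightarrow> z \<in> space (M i) \<Longrightarrow> \<bar>F (x(i := z)) - F x\<bar> \<le> c i"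
    and V: "V = (\<Sum>i\<in>I. (c i)\<^sup>2)" "0 < V" and e: "0 < \<epsilon>"
  shows "measure (Pi\<^sub>M I M) {x\<in>space (Pi\<^sub>M I M). \<bar>F x - integral\<^sup>L (Pi\<^sub>M I M) F\<bar> > \<epsilon>} \<le> 2 * exp (- 2 * \<epsilon>\<^sup>2 / V)"
proof -
  interpret prob_space "Pi\<^sub>M I M" by (intro prob_space_PiM prob)
  let ?E = "integral\<^sup>L (Pi\<^sub>M I M) F"
  let ?U = "{x\<in>space (Pi\<^sub>M I M). F x - ?E \<ge> \<epsilon>}"
  let ?L = "{x\<in>space (Pi\<^sub>M I M). - F x - integral\<^sup>L (Pi\<^sub>M I M) (\<lambda>x. - F x) \<ge> \<epsilon>}"
  have "prob {x\<in>space (Pi\<^sub>M I M). \<bar>F x - ?E\<bar> > \<epsilon>} \<le> prob (?U \<union> ?L)"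
    by (rule finite_measure_mono) (auto simp: abs_if split: if_splits)
  also have "\<dots> \<le> prob ?U + prob ?L"
    by (rule measure_Un_le) auto
  also have "prob ?U \<le> exp (- 2 * \<epsilon>\<^sup>2 / V)"
    by (rule bounded_differences_tail[OF prob fin F B D V e])
  also have "prob ?L \<le> exp (- 2 * \<epsilon>\<^sup>2 / V)"
  proof (rule bounded_differences_tail[OF prob fin _ _ _ V e])
    show "\<bar>- F x\<bar> \<le> B" if "x \<in> space (Pi\<^sub>M I M)" for x using B[OF that] by simp
    show "\<bar>- F (x(i := z)) - - F x\<bar> \<le> c i" if "i \<in> I" "x \<in> space (Pi\<^sub>M I M)" "z \<in> space (M i)" for i x z
      using D[OF that] by (simp add: abs_minus_commute)
  qed auto
  finally show ?thesis by simp
qed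

text \<open>The series of cosh has only nonnegative terms, so it may be cut after the quadratic one.
  This bounds a second moment by the moment generating function at two opposite points.\<close>

lemma exp_plus_exp_minus_ge: "2 + x\<^sup>2 \<le> exp x + exp (- x)" for x :: real
proof -
  have s: "(\<lambda>n. if even n then x ^ n /\<^sub>R fact n else 0) sums cosh x" by (rule cosh_converges)
  have "(\<Sum>n<3. if even n then x ^ n /\<^sub>R fact n else 0) \<le> (\<Sum>n. if even n then x ^ n /\<^sub>R fact n else 0)"
    by (rule sum_le_suminf[OF sums_summable[OF s]]) (auto simp: zero_le_even_power)
  then have "1 + x\<^sup>2 / 2 \<le> cosh x"
    unfolding sums_unique[OF s, symmetric] by (simp add: eval_nat_numeral)
  then show ?thesis by (simp add: cosh_def)
qed

text \<open>The optimal constant is 1/4; evaluating the moment generating function at a single point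
  is enough for 1/3.\<close>

lemma bounded_differences_second_moment:
  fixes M :: "'i \<Rightarrow> 'a measure" and F :: "('i \<Rightarrow> 'a) \<Rightarrow> real"
  assumes prob: "\<And>i. prob_space (M i)" and fin: "finite I"
    and F[measurable]: "F \<in> borel_measurable (Pi\<^sub>M I M)"
    and B: "\<And>x. x \<in> space (Pi\<^sub>M I M) \<Longrightarrow> \<bar>F x\<bar> \<le> B"
    and D: "\<And>i x z. i \<in> I \<Longrightarrow> x \<in> space (Pi\<^sub>M I M) \<Longrightarrow> z \<in> space (M i) \<Longrightarrow> \<bar>F (x(i := z)) - F x\<bar> \<le> c i"
    and V: "V = (\<Sum>i\<in>I. (c i)\<^sup>2)" "0 < V" and zero: "integral\<^sup>L (Pi\<^sub>M I M) F = 0"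
  shows "(\<integral>x. (F x)\<^sup>2 \<partial>Pi\<^sub>M I M) \<le> V / 3"
proof -
  interpret prob_space "Pi\<^sub>M I M" by (intro prob_space_PiM prob)
  \<comment> \<open>This choice makes \<open>s\<^sup>2 * V / 8\<close> equal to 1/2. With exp (1/2)
    at most 5/3, the inequality 2 + (4 / V) * E \<le> 10/3 for the second moment E yields V /
    3.\<close>
  define s where "s = 2 / sqrt V"
  have s: "s > 0" using V by (simp add: s_def)
  have s2: "s\<^sup>2 = 4 / V" using V(2) by (simp add: s_def power_divide)
  have int: "integrable (Pi\<^sub>M I M) (\<lambda>x. (F x)\<^sup>2)"
  proof (rule integrable_const_bound[where B = "B\<^sup>2"])
    show "AE x in Pi\<^sub>M I M. norm ((F x)\<^sup>2) \<le> B\<^sup>2"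
      using B by (intro AE_I2) (simp add: abs_le_square_iff[symmetric] order_trans[OF _ abs_ge_self])
  qed measurable
  have mgf: "(\<integral>\<^sup>+x. ennreal (exp (s * F x)) \<partial>Pi\<^sub>M I M) \<le> ennreal (exp (1/2))"
    using bounded_differences_nn_integral_exp[OF prob fin F B D s] zero s2 V by simp
  have mgf': "(\<integral>\<^sup>+x. ennreal (exp (s * - F x)) \<partial>Pi\<^sub>M I M) \<le> ennreal (exp (1/2))"
  proof -
    have "(\<integral>\<^sup>+x. ennreal (exp (s * (- F x - integral\<^sup>L (Pi\<^sub>M I M) (\<lambda>x. - F x)))) \<partial>Pi\<^sub>M I M)
      \<le> ennreal (exp (s\<^sup>2 * (\<Sum>i\<in>I. (c i)\<^sup>2) / 8))"
    proof (rule bounded_differences_nn_integral_exp[OF prob fin _ _ _ s])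
      show "\<bar>- F x\<bar> \<le> B" if "x \<in> space (Pi\<^sub>M I M)" for x using B[OF that] by simp
      show "\<bar>- F (x(i := z)) - - F x\<bar> \<le> c i" if "i \<in> I" "x \<in> space (Pi\<^sub>M I M)" "z \<in> space (M i)" for i x z
        using D[OF that] by (simp add: abs_minus_commute)
    qed auto
    then show ?thesis using zero s2 V by simp
  qed
  have "ennreal (2 + s\<^sup>2 * (\<integral>x. (F x)\<^sup>2 \<partial>Pi\<^sub>M I M)) = ennreal (\<integral>x. 2 + s\<^sup>2 * (F x)\<^sup>2 \<partial>Pi\<^sub>M I M)"
    using int by (simp add: prob_space)
  also have "\<dots> = (\<integral>\<^sup>+x. ennreal (2 + s\<^sup>2 * (F x)\<^sup>2) \<partial>Pi\<^sub>M I M)"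
    by (rule nn_integral_eq_integral[symmetric]) (use int in auto)
  also have "\<dots> \<le> (\<integral>\<^sup>+x. ennreal (exp (s * F x)) + ennreal (exp (s * - F x)) \<partial>Pi\<^sub>M I M)"
    using exp_plus_exp_minus_ge[of "s * F _"]
    by (intro nn_integral_mono) (simp flip: ennreal_plus add: power_mult_distrib)
  also have "\<dots> = (\<integral>\<^sup>+x. ennreal (exp (s * F x)) \<partial>Pi\<^sub>M I M) + (\<integral>\<^sup>+x. ennreal (exp (s * - F x)) \<partial>Pi\<^sub>M I M)"
    by (rule nn_integral_add) measurable
  also have "\<dots> \<le> ennreal (exp (1/2)) + ennreal (exp (1/2))"
    by (rule add_mono[OF mgf mgf'])
  also have "\<dots> = ennreal (2 * exp (1/2))" by (simp flip: ennreal_plus)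
  finally have "2 + s\<^sup>2 * (\<integral>x. (F x)\<^sup>2 \<partial>Pi\<^sub>M I M) \<le> 2 * exp (1/2)"
    by (subst (asm) ennreal_le_iff) auto
  \<comment> \<open>Squaring reduces this to e \<le> 25/9 = 2.77...\<close>
  moreover have "exp (1/2 :: real) \<le> 5/3"
  proof (rule power2_le_imp_le)
    have "(exp (1/2 :: real))\<^sup>2 = exp 1" by (simp flip: exp_double)
    then show "(exp (1/2 :: real))\<^sup>2 \<le> (5/3)\<^sup>2" using e_less_272 by (simp add: power2_eq_square)
  qed simp
  ultimately have "2 + s\<^sup>2 * (\<integral>x. (F x)\<^sup>2 \<partial>Pi\<^sub>M I M) \<le> 10 / 3" by linarith
  then show ?thesis using V(2) by (simp add: s2 field_simps)
qed

section \<open>Trigonometric polynomials of degree one in each variable\<close>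

text \<open>The first clause lets total functions on \<open>'i\<close> play the role of points with
  \<open>I\<close> coordinates: values off \<open>I\<close> may be changed at will, which reconciles
  flows, \<open>override_on\<close> and the extensional functions of the product measure.\<close>

definition trig_poly :: "'i set \<Rightarrow> (('i \<Rightarrow> real) \<Rightarrow> real) \<Rightarrow> bool" where
  "trig_poly I f \<longleftrightarrow> (\<forall>\<theta> \<theta>'. (\<forall>i\<in>I. \<theta> i = \<theta>' i) \<longrightarrow> f \<theta> = f \<theta>') \<and>
     (\<forall>i\<in>I. \<forall>\<theta>. \<exists>a b c. \<forall>s. f (\<theta>(i := s)) = a + b * cos (2 * s) + c * sin (2 * s))"

text \<open>The parameter-shift rule. As a difference of two values it inherits bounds and
  independence of coordinates from f directly, with no appeal to differentiability.\<close>

definition shift_diff :: "'i \<Rightarrow> (('i \<Rightarrow> real) \<Rightarrow> real) \<Rightarrow> ('i \<Rightarrow> real) \<Rightarrow> real" where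
  "shift_diff i f \<theta> = f (\<theta>(i := \<theta> i + pi / 4)) - f (\<theta>(i := \<theta> i - pi / 4))"

lemma trig_polyI:
  assumes "\<And>\<theta> \<theta>'. (\<And>i. i \<in> I \<Longrightarrow> \<theta> i = \<theta>' i) \<Longrightarrow> f \<theta> = f \<theta>'"
    and "\<And>i \<theta>. i \<in> I \<Longrightarrow> \<exists>a b c. \<forall>s. f (\<theta>(i := s)) = a + b * cos (2 * s) + c * sin (2 * s)"
  shows "trig_poly I f"
  unfolding trig_poly_def using assms by blast

lemma trig_poly_cong: "trig_poly I f \<Longrightarrow> (\<And>i. i \<in> I \<Longrightarrow> \<theta> i = \<theta>' i) \<Longrightarrow> f \<theta> = f \<theta>'"
  unfolding trig_poly_def by blast

lemma trig_polyE:
  assumes "trig_poly I f" "i \<in> I"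
  obtains a b c where "\<And>s. f (\<theta>(i := s)) = a + b * cos (2 * s) + c * sin (2 * s)"
  using assms unfolding trig_poly_def by blast

lemma trig_poly_cmult: assumes "trig_poly I f" shows "trig_poly I (\<lambda>\<theta>. r * f \<theta>)"
proof (rule trig_polyI)
  fix i and \<theta> :: "'a \<Rightarrow> real" assume "i \<in> I"
  then obtain a b c where "\<And>s. f (\<theta>(i := s)) = a + b * cos (2 * s) + c * sin (2 * s)"
    using trig_polyE[OF assms] by blast
  then show "\<exists>a b c. \<forall>s. r * f (\<theta>(i := s)) = a + b * cos (2 * s) + c * sin (2 * s)"
    by (intro exI[of _ "r * a"] exI[of _ "r * b"] exI[of _ "r * c"]) (simp add: algebra_simps)
qed (use trig_poly_cong[OF assms] in metis)

lemma trig_poly_add: assumes "trig_poly I f" "trig_poly I g" shows "trig_poly I (\<lambda>\<theta>. f \<theta> + g \<theta>)"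
proof (rule trig_polyI)
  fix i and \<theta> :: "'a \<Rightarrow> real" assume i: "i \<in> I"
  obtain a b c where "\<And>s. f (\<theta>(i := s)) = a + b * cos (2 * s) + c * sin (2 * s)"
    using trig_polyE[OF assms(1) i] by blast
  moreover obtain a' b' c' where "\<And>s. g (\<theta>(i := s)) = a' + b' * cos (2 * s) + c' * sin (2 * s)"
    using trig_polyE[OF assms(2) i] by blast
  ultimately show "\<exists>a b c. \<forall>s. f (\<theta>(i := s)) + g (\<theta>(i := s)) = a + b * cos (2 * s) + c * sin (2 * s)"
    by (intro exI[of _ "a + a'"] exI[of _ "b + b'"] exI[of _ "c + c'"]) (simp add: algebra_simps)
qed (use trig_poly_cong[OF assms(1)] trig_poly_cong[OF assms(2)] in metis)

lemma trig_poly_sum: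
  "(\<And>k. k \<in> K \<Longrightarrow> trig_poly I (f k)) \<Longrightarrow> trig_poly I (\<lambda>\<theta>. \<Sum>k\<in>K. f k \<theta>)"
proof (induction K rule: infinite_finite_induct)
  case (insert k K) then show ?case by (simp add: trig_poly_add)
next
  case empty show ?case by (auto simp: trig_poly_def intro!: exI[of _ 0])
next
  case (infinite K) then show ?case by (auto simp: trig_poly_def intro!: exI[of _ 0])
qed

text \<open>In the shifted coordinate the coefficients become 0, 2c, -2b; in any other coordinate
  the two updates commute and the coefficients subtract. Hence derivatives can be shifted again,
  which is how second-order bounds arise.\<close>

lemma trig_poly_shift_diff:
  assumes f: "trig_poly I f" and i: "i \<in> I" shows "trig_poly I (shift_diff i f)"
proof (rule trig_polyI)
  show "shift_diff i f \<theta> = shift_diff i f \<theta>'" if "\<And>i. i \<in> I \<Longrightarrow> \<theta> i = \<theta>' i" for \<theta> \<theta>'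
    unfolding shift_diff_def using that i
    by (intro arg_cong2[where f = "(-)"] trig_poly_cong[OF f]) auto
  fix j and \<theta> :: "'a \<Rightarrow> real" assume j: "j \<in> I"
  show "\<exists>a b c. \<forall>s. shift_diff i f (\<theta>(j := s)) = a + b * cos (2 * s) + c * sin (2 * s)"
  proof (cases "j = i")
    case True
    obtain a b c where e: "\<And>s. f (\<theta>(i := s)) = a + b * cos (2 * s) + c * sin (2 * s)"
      using trig_polyE[OF f i] by blast
    have "shift_diff i f (\<theta>(j := s)) = 0 + (2 * c) * cos (2 * s) + (- 2 * b) * sin (2 * s)" for s
      by (simp add: True shift_diff_def e distrib_left right_diff_distrib cos_add cos_diff sin_add sin_diff)
    then show ?thesis by blast
  next
    case False
    obtain a b c where e: "\<And>s. f (\<theta>(i := \<theta> i + pi / 4, j := s)) = a + b * cos (2 * s) + c * sin (2 * s)"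
      using trig_polyE[OF f j] by blast
    obtain a' b' c' where e': "\<And>s. f (\<theta>(i := \<theta> i - pi / 4, j := s)) = a' + b' * cos (2 * s) + c' * sin (2 * s)"
      using trig_polyE[OF f j] by blast
    have "shift_diff i f (\<theta>(j := s)) = (a - a') + (b - b') * cos (2 * s) + (c - c') * sin (2 * s)" for s
      using False by (simp add: shift_diff_def fun_upd_twist[OF False] e e' algebra_simps)
    then show ?thesis by blast
  qed
qed

lemma trig_poly_has_derivative:
  assumes f: "trig_poly I f" and i: "i \<in> I"
  shows "((\<lambda>s. f (\<theta>(i := s))) has_real_derivative shift_diff i f (\<theta>(i := s))) (at s within S)"
proof -
  obtain a b c where e: "\<And>s. f (\<theta>(i := s)) = a + b * cos (2 * s) + c * sin (2 * s)"
    using trig_polyE[OF f i] by blast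
  have d: "shift_diff i f (\<theta>(i := s)) = (2 * c) * cos (2 * s) + (- 2 * b) * sin (2 * s)"
    by (simp add: shift_diff_def e distrib_left right_diff_distrib cos_add cos_diff sin_add sin_diff)
  show ?thesis unfolding e d by (auto intro!: derivative_eq_intros)
qed

lemma partial_deriv_trig_poly:
  assumes "trig_poly I f" "i \<in> I" shows "partial_deriv i f \<theta> = shift_diff i f \<theta>"
  using DERIV_imp_deriv[OF trig_poly_has_derivative[OF assms, of \<theta> "\<theta> i" UNIV]]
  by (simp add: partial_deriv_def)

text \<open>The values at 0, pi/2 and pi/4 are a + b, a - b and a + c, and these determine the
  coefficients. The weights involve only \<open>s\<close>, and the other factors are values of f
  with coordinate \<open>i\<close> frozen, so regularity in the remaining coordinates is
  inherited.\<close>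

lemma trig_poly_interpolation:
  assumes f: "trig_poly I f" and i: "i \<in> I"
  shows "f (\<theta>(i := s)) = (1 + cos (2 * s) - sin (2 * s)) / 2 * f (\<theta>(i := 0))
    + (1 - cos (2 * s) - sin (2 * s)) / 2 * f (\<theta>(i := pi / 2)) + sin (2 * s) * f (\<theta>(i := pi / 4))"
proof -
  obtain a b c where e: "\<And>s. f (\<theta>(i := s)) = a + b * cos (2 * s) + c * sin (2 * s)"
    using trig_polyE[OF f i] by blast
  show ?thesis unfolding e by (simp add: field_simps)
qed

lemma trig_poly_shift_diff_interpolation:
  assumes f: "trig_poly I f" and i: "i \<in> I"
  shows "shift_diff i f (\<theta>(i := s)) = (- sin (2 * s) - cos (2 * s)) * f (\<theta>(i := 0))
    + (sin (2 * s) - cos (2 * s)) * f (\<theta>(i := pi / 2)) + 2 * cos (2 * s) * f (\<theta>(i := pi / 4))"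
proof -
  obtain a b c where e: "\<And>s. f (\<theta>(i := s)) = a + b * cos (2 * s) + c * sin (2 * s)"
    using trig_polyE[OF f i] by blast
  show ?thesis
    unfolding shift_diff_def e
    by (simp add: e distrib_left right_diff_distrib cos_add cos_diff sin_add sin_diff) (simp add: field_simps)
qed

section \<open>Joint regularity by induction on the coordinates\<close>

lemma override_on_insert_upd: "j \<notin> J \<Longrightarrow> (override_on \<theta> g J)(j := q) = override_on (\<theta>(j := q)) g J"
  by (auto simp: override_on_def)

text \<open>Interpolation in the newly freed coordinate writes f as a sum of three products, each of
  an explicit function of \<open>\<gamma> t j\<close> and a function in which fewer coordinates
  move. The product rule then suffices, and joint differentiability is never invoked.\<close>

lemma trig_poly_override_has_derivative:
  assumes f: "trig_poly I f" and "finite J" "J \<subseteq> I"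
    and "\<And>i. i \<in> J \<Longrightarrow> ((\<lambda>t. \<gamma> t i) has_real_derivative \<gamma>' i) (at t within S)"
  shows "((\<lambda>t. f (override_on \<theta> (\<gamma> t) J)) has_real_derivative
     (\<Sum>i\<in>J. shift_diff i f (override_on \<theta> (\<gamma> t) J) * \<gamma>' i)) (at t within S)"
  using assms(2-)
proof (induction J arbitrary: \<theta>)
  case (insert j J)
  then have j: "j \<in> I" and JI: "J \<subseteq> I" by auto
  \<comment> \<open>Coordinate \<open>j\<close> is frozen at the node \<open>q\<close> by changing
    the base point; for this reason the induction keeps \<theta> arbitrary.\<close>
  define X where "X q t = override_on (\<theta>(j := q)) (\<gamma> t) J" for q t
  have upd: "override_on \<theta> (\<gamma> t) (insert j J) = (override_on \<theta> (\<gamma> t) J)(j := \<gamma> t j)" for t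
    using insert.hyps by (auto simp: override_on_def)
  have X: "(override_on \<theta> (\<gamma> t) J)(j := q) = X q t" for q t
    unfolding X_def by (rule override_on_insert_upd[OF insert.hyps(2)])
  have IH: "((\<lambda>t. f (X q t)) has_real_derivative (\<Sum>i\<in>J. shift_diff i f (X q t) * \<gamma>' i)) (at t within S)" for q
    unfolding X_def by (rule insert.IH[OF JI insert.prems(2)]) simp
  note g = insert.prems(2)[of j, simplified]
  let ?s = "\<gamma> t j"
  \<comment> \<open>The derivatives of the three frozen functions recombine because each
    \<open>shift_diff i f\<close> is itself a trigonometric polynomial in coordinate
    \<open>j\<close> and obeys the same interpolation.\<close>
  have sum: "(\<Sum>i\<in>J. shift_diff i f (X ?s t) * \<gamma>' i) =
      (1 + cos (2 * ?s) - sin (2 * ?s)) / 2 * (\<Sum>i\<in>J. shift_diff i f (X 0 t) * \<gamma>' i)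
    + (1 - cos (2 * ?s) - sin (2 * ?s)) / 2 * (\<Sum>i\<in>J. shift_diff i f (X (pi / 2) t) * \<gamma>' i)
    + sin (2 * ?s) * (\<Sum>i\<in>J. shift_diff i f (X (pi / 4) t) * \<gamma>' i)"
    unfolding sum_distrib_left sum.distrib[symmetric]
  proof (rule sum.cong)
    fix i assume "i \<in> J"
    then have "trig_poly I (shift_diff i f)" using JI f by (auto intro: trig_poly_shift_diff)
    from trig_poly_interpolation[OF this j, of "override_on \<theta> (\<gamma> t) J" ?s]
    show "shift_diff i f (X ?s t) * \<gamma>' i =
        (1 + cos (2 * ?s) - sin (2 * ?s)) / 2 * (shift_diff i f (X 0 t) * \<gamma>' i)
      + (1 - cos (2 * ?s) - sin (2 * ?s)) / 2 * (shift_diff i f (X (pi / 2) t) * \<gamma>' i)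
      + sin (2 * ?s) * (shift_diff i f (X (pi / 4) t) * \<gamma>' i)"
      unfolding X by (simp add: algebra_simps)
  qed simp
  have sj: "shift_diff j f (X ?s t) = (- sin (2 * ?s) - cos (2 * ?s)) * f (X 0 t)
    + (sin (2 * ?s) - cos (2 * ?s)) * f (X (pi / 2) t) + 2 * cos (2 * ?s) * f (X (pi / 4) t)"
    using trig_poly_shift_diff_interpolation[OF f j, of "override_on \<theta> (\<gamma> t) J" ?s] unfolding X .
  have fX: "f (X (\<gamma> t j) t) = (1 + cos (2 * \<gamma> t j) - sin (2 * \<gamma> t j)) / 2 * f (X 0 t)
    + (1 - cos (2 * \<gamma> t j) - sin (2 * \<gamma> t j)) / 2 * f (X (pi / 2) t) + sin (2 * \<gamma> t j) * f (X (pi / 4) t)" for t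
    using trig_poly_interpolation[OF f j, of "override_on \<theta> (\<gamma> t) J" "\<gamma> t j"] unfolding X .
  have "((\<lambda>t. f (X (\<gamma> t j) t)) has_real_derivative
     shift_diff j f (X ?s t) * \<gamma>' j + (\<Sum>i\<in>J. shift_diff i f (X ?s t) * \<gamma>' i)) (at t within S)"
    unfolding fX sum sj
    by (rule derivative_eq_intros IH g refl | simp)+ (simp add: field_simps)
  then show ?case using insert.hyps by (simp add: upd X)
qed simp

lemma trig_poly_chain_rule:
  assumes f: "trig_poly I f" and "finite I"
    and "\<And>i. i \<in> I \<Longrightarrow> ((\<lambda>t. \<gamma> t i) has_real_derivative \<gamma>' i) (at t within S)"
  shows "((\<lambda>t. f (\<gamma> t)) has_real_derivative (\<Sum>i\<in>I. shift_diff i f (\<gamma> t) * \<gamma>' i)) (at t within S)"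
proof -
  have "f (override_on undefined (\<gamma> t) I) = f (\<gamma> t)" for t
    by (rule trig_poly_cong[OF f]) simp
  moreover have "shift_diff i f (override_on undefined (\<gamma> t) I) = shift_diff i f (\<gamma> t)" if "i \<in> I" for i
    by (rule trig_poly_cong[OF trig_poly_shift_diff[OF f that]]) simp
  ultimately show ?thesis
    using trig_poly_override_has_derivative[OF f assms(2) order_refl,
        where \<theta> = undefined and \<gamma> = \<gamma> and \<gamma>' = \<gamma>' and t = t and S = S] assms(3)
    by simp
qed

text \<open>The same induction: each further coordinate enters through cos and sin of a measurable
  projection, with frozen values of f as the remaining factors.\<close>

lemma trig_poly_measurable:
  assumes f: "trig_poly I f" and fin: "finite I" and N: "sets N = sets borel"
  shows "f \<in> borel_measurable (Pi\<^sub>M I (\<lambda>_. N))"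
proof -
  have "(\<lambda>\<theta>. f (override_on \<theta>' \<theta> J)) \<in> borel_measurable (Pi\<^sub>M I (\<lambda>_. N))" if "finite J" "J \<subseteq> I" for J \<theta>'
    using that
  proof (induction J arbitrary: \<theta>')
    case (insert j J)
    then have j: "j \<in> I" and JI: "J \<subseteq> I" by auto
    note [measurable] = insert.IH[OF JI] measurable_component_singleton[OF j, of "\<lambda>_. N", unfolded measurable_cong_sets[OF refl N]]
    have e: "f (override_on \<theta>' \<theta> (insert j J)) = (1 + cos (2 * \<theta> j) - sin (2 * \<theta> j)) / 2 * f (override_on (\<theta>'(j := 0)) \<theta> J)
    + (1 - cos (2 * \<theta> j) - sin (2 * \<theta> j)) / 2 * f (override_on (\<theta>'(j := pi / 2)) \<theta> J) + sin (2 * \<theta> j) * f (override_on (\<theta>'(j := pi / 4)) \<theta> J)" for \<theta>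
    proof -
      have "override_on \<theta>' \<theta> (insert j J) = (override_on \<theta>' \<theta> J)(j := \<theta> j)"
        by (auto simp: override_on_def)
      then show ?thesis
        using trig_poly_interpolation[OF f j, of "override_on \<theta>' \<theta> J" "\<theta> j"]
        by (simp add: override_on_insert_upd[OF insert.hyps(2)])
    qed
    show ?case unfolding e by measurable
  qed simp
  from this[OF fin order_refl, of undefined]
  show ?thesis
    by (rule iffD1[OF measurable_cong, rotated]) (rule trig_poly_cong[OF f], simp)
qed

text \<open>Both the derivative and the oscillation are differences of two values in [-B, B]. The
  Lipschitz half of the minimum serves the training dynamics, the constant half serves the bounded
  differences at initialization.\<close>

lemma trig_poly_coord_lipschitz:
  assumes f: "trig_poly I f" and i: "i \<in> I" and B: "\<And>\<theta>. \<bar>f \<theta>\<bar> \<le> B"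
  shows "\<bar>f (\<theta>(i := s)) - f (\<theta>(i := s'))\<bar> \<le> 2 * B * min 1 \<bar>s - s'\<bar>"
proof -
  have sd: "\<bar>shift_diff i f \<theta>\<bar> \<le> 2 * B" for \<theta>
    using B[of "\<theta>(i := \<theta> i + pi / 4)"] B[of "\<theta>(i := \<theta> i - pi / 4)"]
    unfolding shift_diff_def by linarith
  have "norm (f (\<theta>(i := s)) - f (\<theta>(i := s'))) \<le> 2 * B * norm (s - s')"
  proof (rule field_differentiable_bound[where S = UNIV])
    show "((\<lambda>s. f (\<theta>(i := s))) has_field_derivative shift_diff i f (\<theta>(i := z))) (at z within UNIV)" for z
      by (rule trig_poly_has_derivative[OF f i])
  qed (use sd in auto)
  moreover have "\<bar>f (\<theta>(i := s)) - f (\<theta>(i := s'))\<bar> \<le> 2 * B"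
    using B[of "\<theta>(i := s)"] B[of "\<theta>(i := s')"] by linarith
  ultimately show ?thesis by (simp add: min_def)
qed

text \<open>Coordinates are replaced one at a time, so the increments add up to the l1
  distance.\<close>

lemma coordwise_lipschitz:
  fixes h :: "('i \<Rightarrow> real) \<Rightarrow> real"
  assumes "finite I" and cong: "\<And>\<theta> \<theta>'. (\<And>i. i \<in> I \<Longrightarrow> \<theta> i = \<theta>' i) \<Longrightarrow> h \<theta> = h \<theta>'"
    and L: "\<And>i \<theta> s. i \<in> I \<Longrightarrow> \<bar>h (\<theta>(i := s)) - h \<theta>\<bar> \<le> c * \<bar>s - \<theta> i\<bar>"
  shows "\<bar>h \<theta>' - h \<theta>\<bar> \<le> c * (\<Sum>i\<in>I. \<bar>\<theta>' i - \<theta> i\<bar>)"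
proof -
  have "\<bar>h (override_on \<theta> \<theta>' J) - h \<theta>\<bar> \<le> c * (\<Sum>i\<in>J. \<bar>\<theta>' i - \<theta> i\<bar>)" if "finite J" "J \<subseteq> I" for J
    using that
  proof (induction J)
    case (insert j J)
    have "override_on \<theta> \<theta>' (insert j J) = (override_on \<theta> \<theta>' J)(j := \<theta>' j)" by (auto simp: override_on_def)
    then have "\<bar>h (override_on \<theta> \<theta>' (insert j J)) - h (override_on \<theta> \<theta>' J)\<bar> \<le> c * \<bar>\<theta>' j - \<theta> j\<bar>"
      using L[of j "override_on \<theta> \<theta>' J" "\<theta>' j"] insert by simp
    with insert show ?case by (simp add: distrib_left)
  qed simp
  moreover have "h (override_on \<theta> \<theta>' I) = h \<theta>'" by (rule cong) simp
  ultimately show ?thesis using assms(1) by (metis order_refl)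
qed

section \<open>Quadratic forms and the smallest eigenvalue\<close>

definition quad_form :: "nat \<Rightarrow> (nat \<Rightarrow> nat \<Rightarrow> real) \<Rightarrow> (nat \<Rightarrow> real) \<Rightarrow> real" where
  "quad_form n k v = (\<Sum>i<n. \<Sum>j<n. v i * k i j * v j)"

text \<open>Vectors are functions in the product topology. Forcing them to vanish from index n on
  places the sphere as a closed subset of a product of compact sets, to which Tychonoff's theorem
  applies.\<close>

lemma compact_unit_sphere_fun:
  "compact {v :: nat \<Rightarrow> real. (\<forall>i\<ge>n. v i = 0) \<and> (\<Sum>i<n. (v i)\<^sup>2) = 1}" (is "compact ?S")
proof -
  define B where "B = (\<Pi>\<^sub>E i\<in>UNIV. if i < n then {-1..1} else {0 :: real})"
  have "compactin (product_topology (\<lambda>i. euclidean) UNIV) B"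
    unfolding B_def by (subst compactin_PiE) auto
  then have B: "compact B" by (simp add: euclidean_product_topology)
  have cont: "continuous_on UNIV (\<lambda>v :: nat \<Rightarrow> real. \<Sum>i<n. (v i)\<^sup>2)"
    by (intro continuous_intros continuous_on_product_coordinates)
  have "closed {v :: nat \<Rightarrow> real. (\<Sum>i<n. (v i)\<^sup>2) = 1}"
    by (intro closed_Collect_eq cont continuous_intros)
  moreover have "?S = B \<inter> {v. (\<Sum>i<n. (v i)\<^sup>2) = 1}"
  proof (intro equalityI subsetI)
    fix v assume v: "v \<in> ?S"
    have "v i \<in> (if i < n then {-1..1} else {0})" for i
    proof (cases "i < n")
      case True
      then have "(v i)\<^sup>2 \<le> (\<Sum>i<n. (v i)\<^sup>2)" by (intro member_le_sum) auto
      with v True show ?thesis by (simp add: abs_square_le_1 abs_le_iff)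
    qed (use v in auto)
    with v show "v \<in> B \<inter> {v. (\<Sum>i<n. (v i)\<^sup>2) = 1}" by (auto simp: B_def)
  next
    fix v assume v: "v \<in> B \<inter> {v. (\<Sum>i<n. (v i)\<^sup>2) = 1}"
    note vi = PiE_mem[OF IntD1[OF v, unfolded B_def] UNIV_I]
    show "v \<in> ?S"
    proof (intro CollectI conjI allI impI)
      show "v i = 0" if "n \<le> i" for i using vi[of i] leD[OF that] by simp
      show "(\<Sum>i<n. (v i)\<^sup>2) = 1" using IntD2[OF v] by (rule CollectD)
    qed
  qed
  ultimately show ?thesis using compact_Int_closed[OF B] by simp
qed

text \<open>First-order stationarity: for small \<open>e\<close> of the sign opposite to \<beta> the
  linear term wins over the quadratic one.\<close>

lemma quadratic_nonneg_imp_zero: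
  fixes \<beta> \<gamma> :: real
  assumes "\<And>e. 0 \<le> 2 * e * \<beta> + e\<^sup>2 * \<gamma>" shows "\<beta> = 0"
proof (rule ccontr)
  assume b: "\<beta> \<noteq> 0"
  define g where "g = \<bar>\<gamma>\<bar> + 1"
  have g: "g > 0" by (simp add: g_def add_nonneg_pos)
  have g2: "\<gamma> - 2 * g < 0" using abs_ge_self[of \<gamma>] g by (simp add: g_def)
  have "2 * (- \<beta> / g) * \<beta> + (- \<beta> / g)\<^sup>2 * \<gamma> = (\<beta> / g)\<^sup>2 * (\<gamma> - 2 * g)"
    using g by (simp add: field_simps power2_eq_square)
  also have "\<dots> < 0" using b g g2 by (intro mult_pos_neg) auto
  finally show False using assms[of "- \<beta> / g"] by simp
qed

text \<open>The variational characterization of the smallest eigenvalue. By compactness the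
  quadratic form attains its minimum \<mu> on the unit sphere; the minimizer is stationary, hence an
  eigenvector, so \<mu> lies in the spectrum and bounds its minimum from above.\<close>

lemma Min_spectrum_le_quad_form:
  assumes sym: "\<And>i j. i < n \<Longrightarrow> j < n \<Longrightarrow> k i j = k j i"
  shows "Min (spectrum (mat n n (\<lambda>(i, j). k i j))) * (\<Sum>i<n. (v i)\<^sup>2) \<le> quad_form n k v"
proof (cases "(\<Sum>i<n. (v i)\<^sup>2) = 0")
  case True
  then have "v i = 0" if "i < n" for i using that by (simp add: sum_nonneg_eq_0_iff)
  then show ?thesis by (simp add: quad_form_def)
next
  case False
  define S where "S = {v :: nat \<Rightarrow> real. (\<forall>i\<ge>n. v i = 0) \<and> (\<Sum>i<n. (v i)\<^sup>2) = 1}"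
  define nrm where "nrm w = (\<Sum>i<n. (w i)\<^sup>2)" for w :: "nat \<Rightarrow> real"
  have nrm_nonneg: "0 \<le> nrm w" for w by (simp add: nrm_def sum_nonneg)
  have normalize: "(\<lambda>i. if i < n then w i / sqrt (nrm w) else 0) \<in> S" if "nrm w \<noteq> 0" for w
  proof -
    have "(\<Sum>i<n. (w i / sqrt (nrm w))\<^sup>2) = nrm w / nrm w"
      using nrm_nonneg[of w] by (simp add: power_divide sum_divide_distrib[symmetric] nrm_def[symmetric])
    then show ?thesis using that by (simp add: S_def)
  qed
  have "S \<noteq> {}" using normalize[of v] False by (auto simp: nrm_def)
  moreover have "continuous_on S (quad_form n k)"
    unfolding quad_form_def[abs_def]
    by (rule continuous_on_subset[of UNIV]) (intro continuous_intros continuous_on_product_coordinates, simp)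
  ultimately obtain v0 where v0: "v0 \<in> S" and min: "\<And>w. w \<in> S \<Longrightarrow> quad_form n k v0 \<le> quad_form n k w"
    using continuous_attains_inf[of S "quad_form n k"] compact_unit_sphere_fun[of n] unfolding S_def by blast
  define \<mu> where "\<mu> = quad_form n k v0"
  have psd: "\<mu> * nrm w \<le> quad_form n k w" for w
  proof (cases "nrm w = 0")
    case True
    then have "w i = 0" if "i < n" for i using that by (simp add: sum_nonneg_eq_0_iff nrm_def)
    with True show ?thesis by (simp add: quad_form_def)
  next
    case False
    then have pos: "nrm w > 0" using nrm_nonneg[of w] by simp
    have "\<mu> \<le> quad_form n k (\<lambda>i. if i < n then w i / sqrt (nrm w) else 0)"
      unfolding \<mu>_def by (rule min[OF normalize[OF False]])
    also have "\<dots> = quad_form n k w / nrm w"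
      using pos unfolding quad_form_def sum_divide_distrib by (intro sum.cong refl) simp
    finally show ?thesis using pos by (simp add: field_simps)
  qed
  have nv0: "nrm v0 = 1" using v0 by (simp add: S_def nrm_def)
  \<comment> \<open>The residual of the eigenvalue equation at \<open>v0\<close>. Perturbing
    \<open>v0\<close> in this very direction makes the first-order coefficient equal to the squared
    norm of \<open>d\<close>, which stationarity forces to be 0.\<close>
  define d where "d i = (\<Sum>j<n. k i j * v0 j) - \<mu> * v0 i" for i
  define \<gamma> where "\<gamma> = quad_form n k d - \<mu> * nrm d"
  have qe: "quad_form n k (\<lambda>i. v0 i + e * d i) = \<mu> + 2 * e * (\<Sum>i<n. d i * (\<Sum>j<n. k i j * v0 j)) + e\<^sup>2 * quad_form n k d" for e
  proof -
    have "(\<Sum>i<n. \<Sum>j<n. v0 i * k i j * d j) = (\<Sum>i<n. \<Sum>j<n. d i * k i j * v0 j)"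
      by (subst sum.swap) (auto intro!: sum.cong simp: sym)
    moreover have "quad_form n k (\<lambda>i. v0 i + e * d i) = \<mu> + e * (\<Sum>i<n. \<Sum>j<n. v0 i * k i j * d j)
       + e * (\<Sum>i<n. \<Sum>j<n. d i * k i j * v0 j) + e\<^sup>2 * quad_form n k d"
      unfolding \<mu>_def quad_form_def sum_distrib_left sum.distrib[symmetric]
      by (intro sum.cong refl) (simp add: algebra_simps power2_eq_square)
    ultimately show ?thesis by (simp add: sum_distrib_left mult.assoc)
  qed
  have ne: "nrm (\<lambda>i. v0 i + e * d i) = 1 + 2 * e * (\<Sum>i<n. d i * v0 i) + e\<^sup>2 * nrm d" for e
    unfolding nv0[symmetric] nrm_def sum_distrib_left sum.distrib[symmetric]
    by (intro sum.cong refl) (simp add: algebra_simps power2_eq_square)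
  have dd: "(\<Sum>i<n. d i * (\<Sum>j<n. k i j * v0 j)) - \<mu> * (\<Sum>i<n. d i * v0 i) = (\<Sum>i<n. (d i)\<^sup>2)"
    unfolding sum_distrib_left[of \<mu>] sum_subtractf[symmetric]
  proof (intro sum.cong refl)
    fix i
    define a where "a = (\<Sum>j<n. k i j * v0 j)"
    have d: "d i = a - \<mu> * v0 i" by (simp add: d_def a_def)
    show "d i * (\<Sum>j<n. k i j * v0 j) - \<mu> * (d i * v0 i) = (d i)\<^sup>2"
      by (subst a_def[symmetric]) (simp add: d algebra_simps power2_eq_square)
  qed
  have "(\<Sum>i<n. (d i)\<^sup>2) = 0"
  proof (rule quadratic_nonneg_imp_zero)
    fix e
    show "0 \<le> 2 * e * (\<Sum>i<n. (d i)\<^sup>2) + e\<^sup>2 * \<gamma>"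
      using psd[of "\<lambda>i. v0 i + e * d i"] unfolding qe ne dd[symmetric] \<gamma>_def by (simp add: algebra_simps)
  qed
  then have d0: "d i = 0" if "i < n" for i using that by (simp add: sum_nonneg_eq_0_iff)
  let ?A = "mat n n (\<lambda>(i, j). k i j)"
  have A: "?A \<in> carrier_mat n n" by simp
  have "eigenvector ?A (vec n v0) \<mu>"
    unfolding eigenvector_def
  proof (intro conjI)
    show "vec n v0 \<noteq> 0\<^sub>v (dim_row ?A)"
    proof
      assume "vec n v0 = 0\<^sub>v (dim_row ?A)"
      then have "v0 i = 0" if "i < n" for i using that by (metis index_vec index_zero_vec(1) dim_row_mat(1))
      then show False using nv0 by (simp add: nrm_def)
    qed
    show "?A *\<^sub>v vec n v0 = \<mu> \<cdot>\<^sub>v vec n v0"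
      using d0 by (intro eq_vecI) (auto simp: d_def scalar_prod_def lessThan_atLeast0)
  qed simp
  then have "\<mu> \<in> spectrum ?A" by (auto simp: spectrum_def eigenvalue_def)
  then have "Min (spectrum ?A) \<le> \<mu>" using card_finite_spectrum(1)[OF A] by simp
  then have "Min (spectrum ?A) * nrm v \<le> \<mu> * nrm v" using nrm_nonneg by (rule mult_right_mono)
  also note psd[of v]
  finally show ?thesis by (simp add: nrm_def)
qed

section \<open>Norm estimates from Cauchy-Schwarz\<close>

lemma abs_sum_le_sqrt_card_L2:
  fixes v :: "'j \<Rightarrow> real"
  shows "(\<Sum>i\<in>J. \<bar>v i\<bar>) \<le> sqrt (real (card J)) * L2_set v J"
proof -
  have "(\<Sum>i\<in>J. \<bar>1\<bar> * \<bar>v i\<bar>) \<le> L2_set (\<lambda>_. 1) J * L2_set v J" by (rule L2_set_mult_ineq)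
  then show ?thesis by (simp add: L2_set_def)
qed

text \<open>Cauchy-Schwarz costs a factor sqrt n on either side. The resulting n is the one that
  appears in \<open>g_const\<close> and \<open>h_const\<close>, which convert entrywise kernel
  errors.\<close>

lemma abs_bilinear_le:
  fixes e :: "nat \<Rightarrow> nat \<Rightarrow> real"
  assumes e: "\<And>i j. i < n \<Longrightarrow> j < n \<Longrightarrow> \<bar>e i j\<bar> \<le> \<epsilon>" and "0 \<le> \<epsilon>"
  shows "\<bar>\<Sum>i<n. \<Sum>j<n. u i * e i j * v j\<bar> \<le> real n * \<epsilon> * L2_set u {..<n} * L2_set v {..<n}"
proof -
  have "\<bar>\<Sum>i<n. \<Sum>j<n. u i * e i j * v j\<bar> \<le> (\<Sum>i<n. \<Sum>j<n. \<epsilon> * (\<bar>u i\<bar> * \<bar>v j\<bar>))"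
  proof (intro order_trans[OF sum_abs] sum_mono)
    fix i j assume "i \<in> {..<n}" "j \<in> {..<n}"
    then have "\<bar>u i\<bar> * \<bar>e i j\<bar> * \<bar>v j\<bar> \<le> \<bar>u i\<bar> * \<epsilon> * \<bar>v j\<bar>" using e by (intro mult_right_mono mult_left_mono) auto
    then show "\<bar>u i * e i j * v j\<bar> \<le> \<epsilon> * (\<bar>u i\<bar> * \<bar>v j\<bar>)" by (simp add: abs_mult algebra_simps)
  qed
  also have "\<dots> = \<epsilon> * ((\<Sum>i<n. \<bar>u i\<bar>) * (\<Sum>j<n. \<bar>v j\<bar>))"
    by (simp only: sum_product[where f = "\<lambda>i. \<bar>u i\<bar>" and g = "\<lambda>j. \<bar>v j\<bar>"] sum_distrib_left[of \<epsilon>])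
  also have "\<dots> \<le> \<epsilon> * ((sqrt (real n) * L2_set u {..<n}) * (sqrt (real n) * L2_set v {..<n}))"
    using abs_sum_le_sqrt_card_L2[of u "{..<n}"] abs_sum_le_sqrt_card_L2[of v "{..<n}"] assms(2)
    by (intro mult_left_mono mult_mono) (auto intro: sum_nonneg)
  also have "\<dots> = real n * \<epsilon> * L2_set u {..<n} * L2_set v {..<n}"
    using real_sqrt_mult_self[of "real n"] by (simp add: algebra_simps)
  finally show ?thesis .
qed

section \<open>Gradient flow in the lazy regime\<close>

text \<open>Derivatives are relative to the half-line because a flow starts at time 0; the mean
  value theorem is applied after restriction to a compact interval.\<close>

lemma deriv_le_imp_le:
  fixes g h :: "real \<Rightarrow> real"
  assumes "0 \<le> \<tau>"
    and g: "\<And>t. 0 \<le> t \<Longrightarrow> t \<le> \<tau> \<Longrightarrow> (g has_real_derivative g' t) (at t within {0..})"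
    and h: "\<And>t. 0 \<le> t \<Longrightarrow> t \<le> \<tau> \<Longrightarrow> (h has_real_derivative h' t) (at t within {0..})"
    and le: "\<And>t. 0 \<le> t \<Longrightarrow> t \<le> \<tau> \<Longrightarrow> g' t \<le> h' t"
    and "g 0 \<le> h 0"
  shows "g \<tau> \<le> h \<tau>"
proof (cases "\<tau> = 0")
  case False
  then have pos: "0 < \<tau>" using assms(1) by simp
  have "((\<lambda>t. h t - g t) has_derivative (*) (h' t - g' t)) (at t within {0..\<tau>})" if "0 \<le> t" "t \<le> \<tau>" for t
    using DERIV_subset[OF DERIV_diff[OF h[OF that] g[OF that]], of "{0..\<tau>}"]
    by (simp add: has_field_derivative_def)
  from mvt_simple[OF pos this] obtain s where s: "s \<in> {0<..<\<tau>}"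
    and e: "(h \<tau> - g \<tau>) - (h 0 - g 0) = (h' s - g' s) * (\<tau> - 0)"
    by auto
  have "0 \<le> (h' s - g' s) * (\<tau> - 0)" using s le[of s] pos by (intro mult_nonneg_nonneg) auto
  with e assms(5) show ?thesis by linarith
qed (use assms in simp)

lemma abs_deriv_le_imp_abs_le:
  fixes g h :: "real \<Rightarrow> real"
  assumes "0 \<le> \<tau>"
    and g: "\<And>t. 0 \<le> t \<Longrightarrow> t \<le> \<tau> \<Longrightarrow> (g has_real_derivative g' t) (at t within {0..})"
    and h: "\<And>t. 0 \<le> t \<Longrightarrow> t \<le> \<tau> \<Longrightarrow> (h has_real_derivative h' t) (at t within {0..})"
    and le: "\<And>t. 0 \<le> t \<Longrightarrow> t \<le> \<tau> \<Longrightarrow> \<bar>g' t\<bar> \<le> h' t"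
  shows "\<bar>g \<tau> - g 0\<bar> \<le> h \<tau> - h 0"
proof -
  have "g \<tau> - g 0 \<le> h \<tau> - h 0"
    by (rule deriv_le_imp_le[where g' = g' and h' = h', OF assms(1)])
       (use le g h in \<open>auto intro!: derivative_eq_intros simp: abs_le_iff\<close>)
  moreover have "- (g \<tau> - g 0) \<le> h \<tau> - h 0"
    by (rule deriv_le_imp_le[where g' = "\<lambda>t. - g' t" and h' = h', OF assms(1)])
       (use le g h in \<open>auto intro!: derivative_eq_intros simp: abs_le_iff\<close>)
  ultimately show ?thesis by (simp add: abs_le_iff)
qed

text \<open>The function \<open>y\<close> vanishes at time 0, where the square root is not
  differentiable. The regularization sqrt (y + e^2) has derivative at most q throughout, and then e
  tends to 0.\<close>

lemma sqrt_gronwall: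
  fixes y :: "real \<Rightarrow> real"
  assumes "0 \<le> \<tau>"
    and y: "\<And>t. 0 \<le> t \<Longrightarrow> (y has_real_derivative y' t) (at t within {0..})"
    and pos: "\<And>t. 0 \<le> y t" and "y 0 = 0" and q: "0 \<le> q"
    and le: "\<And>t. 0 \<le> t \<Longrightarrow> y' t \<le> 2 * q * sqrt (y t)"
  shows "sqrt (y \<tau>) \<le> q * \<tau>"
proof (rule field_le_epsilon)
  fix e :: real assume e: "0 < e"
  have p: "0 < y t + e\<^sup>2" for t using pos[of t] e by (simp add: add_nonneg_pos)
  have "sqrt (y \<tau> + e\<^sup>2) \<le> q * \<tau> + e"
  proof (rule deriv_le_imp_le[where g' = "\<lambda>t. y' t / (2 * sqrt (y t + e\<^sup>2))" and h' = "\<lambda>_. q", OF assms(1)])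
    fix t assume t: "0 \<le> t" "t \<le> \<tau>"
    show "((\<lambda>t. sqrt (y t + e\<^sup>2)) has_real_derivative y' t / (2 * sqrt (y t + e\<^sup>2))) (at t within {0..})"
      using p[of t] by (auto intro!: derivative_eq_intros y[OF t(1)] simp: field_simps)
    have "y' t \<le> 2 * q * sqrt (y t)" by (rule le[OF t(1)])
    also have "\<dots> \<le> 2 * q * sqrt (y t + e\<^sup>2)" using q by (intro mult_left_mono) auto
    finally show "y' t / (2 * sqrt (y t + e\<^sup>2)) \<le> q" using p[of t] by (simp add: field_simps)
  qed (use assms e in \<open>auto intro!: derivative_eq_intros\<close>)
  moreover have "sqrt (y \<tau>) \<le> sqrt (y \<tau> + e\<^sup>2)" by simp
  ultimately show "sqrt (y \<tau>) \<le> q * \<tau> + e" by linarith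
qed

text \<open>At the first time when some coordinate reaches \<rho>, the closed bound still holds up
  to and including that time, so \<open>step\<close> makes every coordinate strictly smaller there:
  a contradiction. Finiteness of \<open>I\<close> makes the set of bad times closed.\<close>

lemma continuous_bootstrap:
  fixes d :: "'i \<Rightarrow> real \<Rightarrow> real"
  assumes fin: "finite I" and cont: "\<And>i. i \<in> I \<Longrightarrow> continuous_on {0..} (d i)"
    and zero: "\<And>i. i \<in> I \<Longrightarrow> d i 0 = 0" and \<rho>: "0 < \<rho>"
    and step: "\<And>\<tau> i. 0 \<le> \<tau> \<Longrightarrow> i \<in> I \<Longrightarrow> (\<And>t j. 0 \<le> t \<Longrightarrow> t \<le> \<tau> \<Longrightarrow> j \<in> I \<Longrightarrow> \<bar>d j t\<bar> \<le> \<rho>) \<Longrightarrow> \<bar>d i \<tau>\<bar> < \<rho>"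
    and "0 \<le> t" "i \<in> I"
  shows "\<bar>d i t\<bar> < \<rho>"
proof (rule ccontr)
  assume contra: "\<not> \<bar>d i t\<bar> < \<rho>"
  define S where "S = (\<Union>i\<in>I. {t \<in> {0..}. \<rho> \<le> \<bar>d i t\<bar>})"
  have "closed {t \<in> {0..}. \<rho> \<le> \<bar>d i t\<bar>}" if "i \<in> I" for i
  proof -
    have "closed ({0..} \<inter> (\<lambda>t. \<bar>d i t\<bar>) -` {\<rho>..})"
      by (intro continuous_closed_preimage continuous_on_rabs cont[OF that]) auto
    also have "{0..} \<inter> (\<lambda>t. \<bar>d i t\<bar>) -` {\<rho>..} = {t \<in> {0..}. \<rho> \<le> \<bar>d i t\<bar>}" by auto
    finally show ?thesis .
  qed
  then have cl: "closed S" unfolding S_def using fin by auto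
  have ne: "S \<noteq> {}" using contra assms(6,7) by (auto simp: S_def not_less)
  have bdd: "bdd_below S" by (auto simp: S_def)
  define \<tau> where "\<tau> = Inf S"
  have "\<tau> \<in> S" unfolding \<tau>_def by (rule closed_contains_Inf[OF ne bdd cl])
  then have \<tau>0: "0 \<le> \<tau>" and ex: "\<exists>i\<in>I. \<rho> \<le> \<bar>d i \<tau>\<bar>" by (auto simp: S_def)
  have before: "\<bar>d j s\<bar> < \<rho>" if "0 \<le> s" "s < \<tau>" "j \<in> I" for s j
  proof (rule ccontr)
    assume "\<not> \<bar>d j s\<bar> < \<rho>"
    then have "s \<in> S" using that by (auto simp: S_def not_less intro!: bexI[of _ j])
    then have "\<tau> \<le> s" unfolding \<tau>_def by (rule cInf_lower[OF _ bdd])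
    then show False using that by simp
  qed
  have "\<bar>d j s\<bar> \<le> \<rho>" if "0 \<le> s" "s \<le> \<tau>" "j \<in> I" for s j
  proof (rule ccontr)
    assume c: "\<not> \<bar>d j s\<bar> \<le> \<rho>"
    then have s: "s = \<tau>" using before[of s j] that by fastforce
    \<comment> \<open>A coordinate beyond \<rho> at the first bad time would have crossed \<rho>
      strictly earlier.\<close>
    have "\<exists>x\<ge>0. x \<le> \<tau> \<and> \<bar>d j x\<bar> = \<rho>"
      using c s that(3) \<tau>0 \<rho> zero[OF that(3)]
      by (intro IVT'[of "\<lambda>t. \<bar>d j t\<bar>"] continuous_on_rabs continuous_on_subset[OF cont[OF that(3)]]) auto
    then obtain x where x: "0 \<le> x" "x \<le> \<tau>" "\<bar>d j x\<bar> = \<rho>" by blast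
    then have "x \<noteq> \<tau>" using c s by auto
    then show False using before[of x j] x that(3) by simp
  qed
  with step[OF \<tau>0] ex show False by (meson not_less)
qed

lemma abs_sum_mult_le_L2:
  assumes a: "\<And>j. j < n \<Longrightarrow> \<bar>a j\<bar> \<le> (m :: real)" and m: "0 \<le> m"
  shows "\<bar>\<Sum>j<n. a j * v j\<bar> \<le> m * (sqrt (real n) * L2_set v {..<n})"
proof -
  have "\<bar>\<Sum>j<n. a j * v j\<bar> \<le> (\<Sum>j<n. m * \<bar>v j\<bar>)"
    using a by (intro order_trans[OF sum_abs] sum_mono) (simp add: abs_mult mult_right_mono)
  also have "\<dots> \<le> m * (sqrt (real n) * L2_set v {..<n})"
    using abs_sum_le_sqrt_card_L2[of v "{..<n}"] m
    by (simp add: sum_distrib_left[symmetric] mult_left_mono)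
  finally show ?thesis .
qed

text \<open>The empirical kernel of an arbitrary model, with parameter shifts in place of partial
  derivatives, so that the dynamics can be studied apart from quantum circuits.\<close>

definition tangent_kernel :: "'i set \<Rightarrow> (('i \<Rightarrow> real) \<Rightarrow> 'x \<Rightarrow> real) \<Rightarrow> ('i \<Rightarrow> real) \<Rightarrow> 'x \<Rightarrow> 'x \<Rightarrow> real" where
  "tangent_kernel I f \<theta> x x' = (\<Sum>i\<in>I. shift_diff i (\<lambda>\<theta>. f \<theta> x) \<theta> * shift_diff i (\<lambda>\<theta>. f \<theta> x') \<theta>)"

lemma tangent_kernel_cong:
  assumes "trig_poly I (\<lambda>\<theta>. f \<theta> x)" "trig_poly I (\<lambda>\<theta>. f \<theta> x')" "\<And>i. i \<in> I \<Longrightarrow> \<theta> i = \<theta>' i"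
  shows "tangent_kernel I f \<theta> x x' = tangent_kernel I f \<theta>' x x'"
  unfolding tangent_kernel_def
  by (intro sum.cong refl arg_cong2[where f = "(*)"] trig_poly_cong[OF trig_poly_shift_diff[OF assms(1)]]
      trig_poly_cong[OF trig_poly_shift_diff[OF assms(2)]] assms(3))

lemma tangent_kernel_bound:
  assumes "0 \<le> p" and d: "\<And>i. i \<in> I \<Longrightarrow> \<bar>shift_diff i (\<lambda>\<theta>. f \<theta> x) \<theta>\<bar> \<le> p" "\<And>i. i \<in> I \<Longrightarrow> \<bar>shift_diff i (\<lambda>\<theta>. f \<theta> x') \<theta>\<bar> \<le> p"
  shows "\<bar>tangent_kernel I f \<theta> x x'\<bar> \<le> real (card I) * p\<^sup>2"
proof -
  have "\<bar>tangent_kernel I f \<theta> x x'\<bar> \<le> (\<Sum>i\<in>I. p * p)"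
    unfolding tangent_kernel_def abs_mult
    using assms by (intro order_trans[OF sum_abs] sum_mono) (auto simp: abs_mult intro!: mult_mono)
  then show ?thesis by (simp add: power2_eq_square)
qed

text \<open>Everything that the dynamics needs to know about the model: p bounds the gradient, c is
  the Lipschitz constant of the kernel per coordinate, \<Lambda> the decay rate, R the initial
  residual. Positivity is assumed only within p * sqrt n * R / \<Lambda>. This is the integral over
  all times of the speed bound \<eta> * p * sqrt n * R * exp (- \<eta> * \<Lambda> * t), hence the
  furthest a coordinate can travel while the decay lasts.\<close>

locale lazy_training =
  fixes I :: "'i set" and f :: "('i \<Rightarrow> real) \<Rightarrow> 'x \<Rightarrow> real" and X :: "'x set"
    and n :: nat and xs :: "nat \<Rightarrow> 'x" and ys :: "nat \<Rightarrow> real" and \<eta> p c \<Lambda> R :: real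
    and \<theta>0 :: "'i \<Rightarrow> real" and \<gamma> \<gamma>l :: "real \<Rightarrow> 'i \<Rightarrow> real"
  assumes fin: "finite I" and trig: "\<And>x. x \<in> X \<Longrightarrow> trig_poly I (\<lambda>\<theta>. f \<theta> x)"
    and n: "1 \<le> n" and xs: "\<And>j. j < n \<Longrightarrow> xs j \<in> X" and \<eta>: "0 < \<eta>" and p: "0 < p" and c: "0 \<le> c" and \<Lambda>: "0 < \<Lambda>" and R: "0 < R"
    and grad: "\<And>x i \<theta>. x \<in> X \<Longrightarrow> i \<in> I \<Longrightarrow> \<bar>shift_diff i (\<lambda>\<theta>. f \<theta> x) \<theta>\<bar> \<le> p"
    and lip: "\<And>x x' i \<theta> s. x \<in> X \<Longrightarrow> x' \<in> X \<Longrightarrow> i \<in> I \<Longrightarrow>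
        \<bar>tangent_kernel I f (\<theta>(i := s)) x x' - tangent_kernel I f \<theta> x x'\<bar> \<le> c * \<bar>s - \<theta> i\<bar>"
    and psd: "\<And>\<theta> v. (\<And>i. i \<in> I \<Longrightarrow> \<bar>\<theta> i - \<theta>0 i\<bar> \<le> p * sqrt (real n) * R / \<Lambda>) \<Longrightarrow>
        \<Lambda> * (\<Sum>j<n. (v j)\<^sup>2) \<le> quad_form n (\<lambda>j k. tangent_kernel I f \<theta> (xs j) (xs k)) v"
    and init: "L2_set (\<lambda>j. f \<theta>0 (xs j) - ys j) {..<n} \<le> R"
    and \<gamma>0: "\<And>i. i \<in> I \<Longrightarrow> \<gamma> 0 i = \<theta>0 i"
    and \<gamma>l0: "\<And>i. i \<in> I \<Longrightarrow> \<gamma>l 0 i = \<theta>0 i"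
    and flow: "\<And>i t. i \<in> I \<Longrightarrow> 0 \<le> t \<Longrightarrow> ((\<lambda>t. \<gamma> t i) has_real_derivative
        - \<eta> * (\<Sum>j<n. (f (\<gamma> t) (xs j) - ys j) * shift_diff i (\<lambda>\<theta>. f \<theta> (xs j)) (\<gamma> t))) (at t within {0..})"
    and flow_lin: "\<And>i t. i \<in> I \<Longrightarrow> 0 \<le> t \<Longrightarrow> ((\<lambda>t. \<gamma>l t i) has_real_derivative
        - \<eta> * (\<Sum>j<n. (f \<theta>0 (xs j) + (\<Sum>i\<in>I. shift_diff i (\<lambda>\<theta>. f \<theta> (xs j)) \<theta>0 * (\<gamma>l t i - \<theta>0 i)) - ys j)
           * shift_diff i (\<lambda>\<theta>. f \<theta> (xs j)) \<theta>0)) (at t within {0..})"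
begin

abbreviation "K \<equiv> tangent_kernel I f"
definition "r t j = f (\<gamma> t) (xs j) - ys j"
definition "fl t x = f \<theta>0 x + (\<Sum>i\<in>I. shift_diff i (\<lambda>\<theta>. f \<theta> x) \<theta>0 * (\<gamma>l t i - \<theta>0 i))"
definition "dev t x = f (\<gamma> t) x - fl t x"
definition "\<rho> = p * sqrt (real n) * R / \<Lambda>"
definition "nparams = real (card I)"

lemma \<rho>_pos: "0 < \<rho>" unfolding \<rho>_def using p R \<Lambda> n by simp

lemma K_lipschitz:
  assumes "x \<in> X" "x' \<in> X" and d: "\<And>i. i \<in> I \<Longrightarrow> \<bar>\<theta> i - \<theta>0 i\<bar> \<le> e"
  shows "\<bar>K \<theta> x x' - K \<theta>0 x x'\<bar> \<le> c * (nparams * e)"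
proof -
  have "\<bar>K \<theta> x x' - K \<theta>0 x x'\<bar> \<le> c * (\<Sum>i\<in>I. \<bar>\<theta> i - \<theta>0 i\<bar>)"
    by (rule coordwise_lipschitz[OF fin]) (use tangent_kernel_cong[OF trig[OF assms(1)] trig[OF assms(2)]] lip[OF assms(1,2)] in blast)+
  also have "(\<Sum>i\<in>I. \<bar>\<theta> i - \<theta>0 i\<bar>) \<le> (\<Sum>i\<in>I. e)" by (intro sum_mono d)
  finally show ?thesis using c by (simp add: nparams_def mult_left_mono)
qed

lemma K_bound: "x \<in> X \<Longrightarrow> x' \<in> X \<Longrightarrow> \<bar>K \<theta> x x'\<bar> \<le> nparams * p\<^sup>2"
  unfolding nparams_def by (rule tangent_kernel_bound) (use grad p in auto)

text \<open>Inserting the flow into the chain rule and exchanging the sums over parameters and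
  samples leaves an equation in function space, in which the gradients enter only through the
  kernel.\<close>

lemma f_deriv:
  assumes x: "x \<in> X" and t: "0 \<le> t"
  shows "((\<lambda>t. f (\<gamma> t) x) has_real_derivative - \<eta> * (\<Sum>j<n. K (\<gamma> t) x (xs j) * r t j)) (at t within {0..})"
proof -
  have "(\<Sum>i\<in>I. shift_diff i (\<lambda>\<theta>. f \<theta> x) (\<gamma> t) * (- \<eta> * (\<Sum>j<n. r t j * shift_diff i (\<lambda>\<theta>. f \<theta> (xs j)) (\<gamma> t))))
    = - \<eta> * (\<Sum>j<n. K (\<gamma> t) x (xs j) * r t j)"
    unfolding tangent_kernel_def sum_distrib_left sum_distrib_right
    by (subst sum.swap) (simp add: mult_ac)
  then show ?thesis
    using trig_poly_chain_rule[OF trig[OF x] fin, where \<gamma> = \<gamma> and t = t and S = "{0..}", OF flow[OF _ t]]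
    by (simp add: r_def)
qed

lemma fl_deriv:
  assumes t: "0 \<le> t"
  shows "((\<lambda>t. fl t x) has_real_derivative - \<eta> * (\<Sum>j<n. K \<theta>0 x (xs j) * (fl t (xs j) - ys j))) (at t within {0..})"
proof -
  have "(\<Sum>i\<in>I. shift_diff i (\<lambda>\<theta>. f \<theta> x) \<theta>0 * (- \<eta> * (\<Sum>j<n. (fl t (xs j) - ys j) * shift_diff i (\<lambda>\<theta>. f \<theta> (xs j)) \<theta>0)))
    = - \<eta> * (\<Sum>j<n. K \<theta>0 x (xs j) * (fl t (xs j) - ys j))"
    unfolding tangent_kernel_def sum_distrib_left sum_distrib_right
    by (subst sum.swap) (simp add: mult_ac)
  moreover have "((\<lambda>t. fl t x) has_real_derivative
     (\<Sum>i\<in>I. shift_diff i (\<lambda>\<theta>. f \<theta> x) \<theta>0 * (- \<eta> * (\<Sum>j<n. (fl t (xs j) - ys j) * shift_diff i (\<lambda>\<theta>. f \<theta> (xs j)) \<theta>0)))) (at t within {0..})"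
    unfolding fl_def[of _ x]
    by (rule derivative_eq_intros flow_lin[OF _ t] refl | simp)+ (simp add: fl_def mult_ac)
  ultimately show ?thesis by simp
qed

text \<open>The squared residual u satisfies u' = -2 \<eta> r^T K r \<le> -2 \<eta> \<Lambda> u, so
  u * exp (2 \<eta> \<Lambda> t) does not increase. The bound is conditional on \<open>near\<close>
  up to time \<tau>, since nothing yet confines the parameters.\<close>

lemma residual_decay:
  assumes \<tau>: "0 \<le> \<tau>" and near: "\<And>t i. 0 \<le> t \<Longrightarrow> t \<le> \<tau> \<Longrightarrow> i \<in> I \<Longrightarrow> \<bar>\<gamma> t i - \<theta>0 i\<bar> \<le> \<rho>"
  shows "L2_set (r \<tau>) {..<n} \<le> R * exp (- \<eta> * \<Lambda> * \<tau>)"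
proof -
  define u where "u t = (\<Sum>j<n. (r t j)\<^sup>2)" for t
  define qf where "qf t = quad_form n (\<lambda>j k. K (\<gamma> t) (xs j) (xs k)) (r t)" for t
  have rd: "((\<lambda>t. r t j) has_real_derivative - \<eta> * (\<Sum>k<n. K (\<gamma> t) (xs j) (xs k) * r t k)) (at t within {0..})"
    if "0 \<le> t" "j < n" for t j
    unfolding r_def using f_deriv[OF xs[OF that(2)] that(1)] by (auto intro!: derivative_eq_intros simp: r_def)
  have ud: "(u has_real_derivative - 2 * \<eta> * qf t) (at t within {0..})" if "0 \<le> t" for t
  proof -
    have "(u has_real_derivative (\<Sum>j<n. 2 * r t j * (- \<eta> * (\<Sum>k<n. K (\<gamma> t) (xs j) (xs k) * r t k)))) (at t within {0..})"
      unfolding u_def by (rule derivative_eq_intros rd[OF that] refl | simp)+ (simp add: mult_ac)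
    also have "(\<Sum>j<n. 2 * r t j * (- \<eta> * (\<Sum>k<n. K (\<gamma> t) (xs j) (xs k) * r t k))) = - 2 * \<eta> * qf t"
      unfolding qf_def quad_form_def sum_distrib_left by (intro sum.cong refl) (simp add: mult_ac)
    finally show ?thesis .
  qed
  have "u \<tau> * exp (2 * \<eta> * \<Lambda> * \<tau>) \<le> u 0"
  proof (rule deriv_le_imp_le[where g = "\<lambda>t. u t * exp (2 * \<eta> * \<Lambda> * t)" and h = "\<lambda>_. u 0" and h' = "\<lambda>_. 0"
        and g' = "\<lambda>t. 2 * \<eta> * exp (2 * \<eta> * \<Lambda> * t) * (\<Lambda> * u t - qf t)", OF \<tau>])
    fix t assume t: "0 \<le> t" "t \<le> \<tau>"
    show "((\<lambda>t. u t * exp (2 * \<eta> * \<Lambda> * t)) has_real_derivative 2 * \<eta> * exp (2 * \<eta> * \<Lambda> * t) * (\<Lambda> * u t - qf t)) (at t within {0..})"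
      by (rule derivative_eq_intros ud[OF t(1)] refl | simp)+ (simp add: algebra_simps)
    have "\<Lambda> * u t \<le> qf t" unfolding u_def qf_def
      using near[OF t] unfolding \<rho>_def by (intro psd) auto
    then show "2 * \<eta> * exp (2 * \<eta> * \<Lambda> * t) * (\<Lambda> * u t - qf t) \<le> 0"
      using \<eta> by (intro mult_nonneg_nonpos) auto
  qed (auto)
  also have "u 0 \<le> R\<^sup>2"
  proof -
    have "r 0 j = f \<theta>0 (xs j) - ys j" if "j < n" for j
      unfolding r_def using trig_poly_cong[OF trig[OF xs[OF that]]] \<gamma>0 by (metis (no_types, lifting))
    then have "sqrt (u 0) = L2_set (\<lambda>j. f \<theta>0 (xs j) - ys j) {..<n}"
      by (simp add: u_def L2_set_def)
    then show ?thesis using init R by (metis real_sqrt_le_iff real_sqrt_unique abs_of_pos real_sqrt_abs)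
  qed
  finally have "u \<tau> \<le> (R * exp (- \<eta> * \<Lambda> * \<tau>))\<^sup>2"
    by (simp add: power_mult_distrib exp_minus field_simps flip: exp_double)
  then show ?thesis unfolding L2_set_def u_def[symmetric] using R by (intro real_le_lsqrt) auto
qed

text \<open>By the residual decay the speed of a coordinate is at most
  \<open>\<rho> * \<eta> * \<Lambda> * exp (- \<eta> * \<Lambda> * t)\<close>, and the bound is its
  primitive.\<close>

lemma displacement:
  assumes \<tau>: "0 \<le> \<tau>" and near: "\<And>t i. 0 \<le> t \<Longrightarrow> t \<le> \<tau> \<Longrightarrow> i \<in> I \<Longrightarrow> \<bar>\<gamma> t i - \<theta>0 i\<bar> \<le> \<rho>" and i: "i \<in> I"
  shows "\<bar>\<gamma> \<tau> i - \<theta>0 i\<bar> \<le> \<rho> * (1 - exp (- \<eta> * \<Lambda> * \<tau>))"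
proof -
  define D where "D t = - \<eta> * (\<Sum>j<n. (f (\<gamma> t) (xs j) - ys j) * shift_diff i (\<lambda>\<theta>. f \<theta> (xs j)) (\<gamma> t))" for t
  define h where "h t = \<rho> * (1 - exp (- \<eta> * \<Lambda> * t))" for t
  have "\<bar>\<gamma> \<tau> i - \<gamma> 0 i\<bar> \<le> h \<tau> - h 0"
  proof (rule abs_deriv_le_imp_abs_le[where g' = D and h' = "\<lambda>t. \<rho> * (\<eta> * \<Lambda> * exp (- \<eta> * \<Lambda> * t))", OF \<tau>])
    fix t assume t: "0 \<le> t" "t \<le> \<tau>"
    show "((\<lambda>t. \<gamma> t i) has_real_derivative D t) (at t within {0..})"
      unfolding D_def by (rule flow[OF i t(1)])
    show "(h has_real_derivative \<rho> * (\<eta> * \<Lambda> * exp (- \<eta> * \<Lambda> * t))) (at t within {0..})"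
      unfolding h_def by (rule derivative_eq_intros refl | simp)+
    have "\<bar>\<Sum>j<n. shift_diff i (\<lambda>\<theta>. f \<theta> (xs j)) (\<gamma> t) * r t j\<bar> \<le> p * (sqrt (real n) * L2_set (r t) {..<n})"
      by (rule abs_sum_mult_le_L2) (use grad[OF xs i] p in auto)
    also have "\<dots> \<le> p * (sqrt (real n) * (R * exp (- \<eta> * \<Lambda> * t)))"
      using residual_decay[OF t(1)] near t(2) p by (intro mult_left_mono) auto
    finally have "\<eta> * \<bar>\<Sum>j<n. r t j * shift_diff i (\<lambda>\<theta>. f \<theta> (xs j)) (\<gamma> t)\<bar> \<le> \<eta> * (p * (sqrt (real n) * (R * exp (- \<eta> * \<Lambda> * t))))"
      using \<eta> by (intro mult_left_mono) (simp_all add: mult.commute)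
    then show "\<bar>D t\<bar> \<le> \<rho> * (\<eta> * \<Lambda> * exp (- \<eta> * \<Lambda> * t))"
      unfolding D_def r_def[symmetric] \<rho>_def using \<eta> \<Lambda> by (simp add: abs_mult mult_ac)
  qed
  then show ?thesis using \<gamma>0[OF i] by (simp add: h_def)
qed

text \<open>At a finite time the factor 1 - exp (...) is strictly below 1; this is the strict
  improvement that the continuity argument consumes.\<close>

lemma stays_near:
  assumes "0 \<le> t" "i \<in> I" shows "\<bar>\<gamma> t i - \<theta>0 i\<bar> \<le> \<rho>"
proof -
  have "\<bar>\<gamma> t i - \<theta>0 i\<bar> < \<rho>"
  proof (rule continuous_bootstrap[OF fin _ _ \<rho>_pos, where d = "\<lambda>i t. \<gamma> t i - \<theta>0 i"])
    show "continuous_on {0..} (\<lambda>t. \<gamma> t i - \<theta>0 i)" if "i \<in> I" for i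
      by (rule continuous_on_diff[OF DERIV_continuous_on continuous_on_const], rule flow[OF that]) simp
    show "\<bar>\<gamma> \<tau> i - \<theta>0 i\<bar> < \<rho>"
      if "0 \<le> \<tau>" "i \<in> I" "\<And>t j. 0 \<le> t \<Longrightarrow> t \<le> \<tau> \<Longrightarrow> j \<in> I \<Longrightarrow> \<bar>\<gamma> t j - \<theta>0 j\<bar> \<le> \<rho>" for \<tau> i
    proof -
      have "\<bar>\<gamma> \<tau> i - \<theta>0 i\<bar> \<le> \<rho> * (1 - exp (- \<eta> * \<Lambda> * \<tau>))" by (rule displacement) (use that in auto)
      also have "\<dots> < \<rho>" using \<rho>_pos by (simp add: algebra_simps)
      finally show ?thesis .
    qed
  qed (use assms \<gamma>0 in auto)
  then show ?thesis by simp
qed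

section \<open>Bounds for all times and comparison with the linearized flow\<close>

lemma residual_bound: "0 \<le> t \<Longrightarrow> L2_set (r t) {..<n} \<le> R * exp (- \<eta> * \<Lambda> * t)"
  by (rule residual_decay) (use stays_near in auto)

lemma displacement_bound: "0 \<le> t \<Longrightarrow> i \<in> I \<Longrightarrow> \<bar>\<gamma> t i - \<theta>0 i\<bar> \<le> \<rho> * (1 - exp (- \<eta> * \<Lambda> * t))"
  by (rule displacement) (use stays_near in auto)

text \<open>Subtracting the two evolutions in function space and using that \<open>dev\<close> is
  the difference of the two residuals separates a source, driven by the motion of the kernel, from a
  linear term with the kernel frozen at \<theta>0.\<close>

lemma dev_deriv:
  assumes x: "x \<in> X" and t: "0 \<le> t"
  shows "((\<lambda>t. dev t x) has_real_derivative
     - \<eta> * ((\<Sum>k<n. (K (\<gamma> t) x (xs k) - K \<theta>0 x (xs k)) * r t k) + (\<Sum>k<n. K \<theta>0 x (xs k) * dev t (xs k)))) (at t within {0..})"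
proof -
  have e: "(K (\<gamma> t) x (xs k) - K \<theta>0 x (xs k)) * r t k + K \<theta>0 x (xs k) * dev t (xs k)
     = K (\<gamma> t) x (xs k) * r t k - K \<theta>0 x (xs k) * (fl t (xs k) - ys k)" for k
    by (simp add: dev_def r_def algebra_simps)
  have eq: "(\<Sum>k<n. (K (\<gamma> t) x (xs k) - K \<theta>0 x (xs k)) * r t k) + (\<Sum>k<n. K \<theta>0 x (xs k) * dev t (xs k))
     = (\<Sum>k<n. K (\<gamma> t) x (xs k) * r t k) - (\<Sum>k<n. K \<theta>0 x (xs k) * (fl t (xs k) - ys k))"
    unfolding sum.distrib[symmetric] sum_subtractf[symmetric] by (intro sum.cong refl e)
  show ?thesis unfolding eq dev_def[of _ x] right_diff_distrib[of "- \<eta>"]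
    by (intro DERIV_diff f_deriv[OF x t] fl_deriv[OF t])
qed

lemma dev_0: "x \<in> X \<Longrightarrow> dev 0 x = 0"
proof -
  assume x: "x \<in> X"
  have "f (\<gamma> 0) x = f \<theta>0 x" by (rule trig_poly_cong[OF trig[OF x]]) (rule \<gamma>0)
  then show ?thesis by (simp add: dev_def fl_def \<gamma>l0)
qed

lemma dev_train_bound:
  assumes \<tau>: "0 \<le> \<tau>"
  shows "L2_set (dev \<tau> \<circ> xs) {..<n} \<le> \<eta> * (real n * (c * (nparams * \<rho>)) * R) * \<tau> * exp (- \<eta> * \<Lambda> * \<tau>)"
proof -
  define b where "b = c * (nparams * \<rho>)"
  define w where "w t = (\<Sum>j<n. (dev t (xs j))\<^sup>2)" for t
  define E where "E t j k = K (\<gamma> t) (xs j) (xs k) - K \<theta>0 (xs j) (xs k)" for t j k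
  define y where "y t = w t * exp (2 * \<eta> * \<Lambda> * t)" for t
  define q1 where "q1 t = (\<Sum>j<n. \<Sum>k<n. dev t (xs j) * E t j k * r t k)" for t
  define q0 where "q0 t = quad_form n (\<lambda>j k. K \<theta>0 (xs j) (xs k)) (\<lambda>j. dev t (xs j))" for t
  have b0: "0 \<le> b" unfolding b_def nparams_def using c \<rho>_pos by simp
  have w: "L2_set (\<lambda>j. dev t (xs j)) {..<n} = sqrt (w t)" for t by (simp add: L2_set_def w_def)
  have wpos: "0 \<le> w t" for t by (simp add: w_def sum_nonneg)
  have wd: "(w has_real_derivative - 2 * \<eta> * (q1 t + q0 t)) (at t within {0..})" if "0 \<le> t" for t
  proof -
    have "(w has_real_derivative (\<Sum>j<n. 2 * dev t (xs j) * (- \<eta> * ((\<Sum>k<n. E t j k * r t k) + (\<Sum>k<n. K \<theta>0 (xs j) (xs k) * dev t (xs k)))))) (at t within {0..})"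
      unfolding w_def E_def by (rule derivative_eq_intros dev_deriv[OF _ that] xs refl | simp)+ (simp add: mult_ac)
    also have "(\<Sum>j<n. 2 * dev t (xs j) * (- \<eta> * ((\<Sum>k<n. E t j k * r t k) + (\<Sum>k<n. K \<theta>0 (xs j) (xs k) * dev t (xs k)))))
      = - 2 * \<eta> * (q1 t + q0 t)"
      unfolding q1_def q0_def quad_form_def sum.distrib[symmetric] sum_distrib_left
      by (intro sum.cong refl) (simp add: algebra_simps)
    finally show ?thesis .
  qed
  have sqrt_y: "sqrt (y t) = sqrt (w t) * exp (\<eta> * \<Lambda> * t)" for t
  proof -
    have "exp (2 * \<eta> * \<Lambda> * t) = (exp (\<eta> * \<Lambda> * t))\<^sup>2" by (simp add: mult.assoc flip: exp_double)
    then show ?thesis by (simp add: y_def real_sqrt_mult)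
  qed
  have "sqrt (y \<tau>) \<le> \<eta> * (real n * b * R) * \<tau>"
  proof (rule sqrt_gronwall[OF \<tau>, where y' = "\<lambda>t. 2 * \<eta> * exp (2 * \<eta> * \<Lambda> * t) * (\<Lambda> * w t - q1 t - q0 t)"])
    fix t :: real assume t: "0 \<le> t"
    show "(y has_real_derivative 2 * \<eta> * exp (2 * \<eta> * \<Lambda> * t) * (\<Lambda> * w t - q1 t - q0 t)) (at t within {0..})"
      unfolding y_def by (rule derivative_eq_intros wd[OF t] refl | simp)+ (simp add: algebra_simps)
    \<comment> \<open>Positivity is used here at the centre \<theta>0 of the ball, where every
      displacement is 0.\<close>
    have "\<Lambda> * w t \<le> q0 t" unfolding w_def q0_def
      using \<rho>_pos unfolding \<rho>_def by (intro psd) auto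
    moreover have "\<bar>q1 t\<bar> \<le> real n * b * sqrt (w t) * L2_set (r t) {..<n}"
      unfolding q1_def w[symmetric]
      by (rule abs_bilinear_le[OF _ b0]) (use K_lipschitz[OF xs xs stays_near[OF t]] in \<open>auto simp: E_def b_def\<close>)
    moreover have "\<dots> \<le> real n * b * sqrt (w t) * (R * exp (- \<eta> * \<Lambda> * t))"
      by (intro mult_left_mono residual_bound[OF t] mult_nonneg_nonneg b0) (simp_all add: wpos)
    ultimately have "\<Lambda> * w t - q1 t - q0 t \<le> real n * b * sqrt (w t) * (R * exp (- \<eta> * \<Lambda> * t))" by linarith
    then have "2 * \<eta> * exp (2 * \<eta> * \<Lambda> * t) * (\<Lambda> * w t - q1 t - q0 t)
      \<le> 2 * \<eta> * exp (2 * \<eta> * \<Lambda> * t) * (real n * b * sqrt (w t) * (R * exp (- \<eta> * \<Lambda> * t)))"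
      using \<eta> by (intro mult_left_mono) auto
    also have "\<dots> = 2 * (\<eta> * (real n * b * R)) * (sqrt (w t) * (exp (2 * \<eta> * \<Lambda> * t) * exp (- \<eta> * \<Lambda> * t)))"
      by (simp only: mult_ac)
    also have "exp (2 * \<eta> * \<Lambda> * t) * exp (- \<eta> * \<Lambda> * t) = exp (\<eta> * \<Lambda> * t)"
      by (simp flip: exp_add)
    also have "sqrt (w t) * exp (\<eta> * \<Lambda> * t) = sqrt (y t)" by (rule sqrt_y[symmetric])
    finally show "2 * \<eta> * exp (2 * \<eta> * \<Lambda> * t) * (\<Lambda> * w t - q1 t - q0 t) \<le> 2 * (\<eta> * (real n * b * R)) * sqrt (y t)" .
  qed (use wpos dev_0[OF xs] b0 \<eta> R in \<open>auto simp: y_def w_def\<close>)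
  then show ?thesis
    unfolding sqrt_y b_def[symmetric] comp_def w by (simp add: exp_minus field_simps)
qed

text \<open>At an input outside the training set the equation for \<open>dev\<close> offers no
  damping. Both terms are therefore integrated in time, the second one with the decay already known
  on the training set.\<close>

lemma dev_bound:
  assumes \<tau>: "0 \<le> \<tau>" and x: "x \<in> X"
  shows "\<bar>dev \<tau> x\<bar> \<le> sqrt (real n) * c * nparams * \<rho> * R / (2 * \<Lambda>)
    + nparams * p\<^sup>2 * sqrt (real n) * real n * c * nparams * \<rho> * R / \<Lambda>\<^sup>2"
proof -
  define b where "b = c * (nparams * \<rho>)"
  define \<alpha> where "\<alpha> = \<eta> * \<Lambda>"
  define e where "e t = exp (- \<alpha> * t)" for t
  \<comment> \<open>Primitives of (1 - e) * e and of t * e. Keeping the factor 1 - e in the kernel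
    change, instead of bounding it by 1, yields the 1/2 in the first term; with twice that term the
    numerical inequality behind 132 would fail.\<close>
  define h where "h t = sqrt (real n) * b * R * ((1 - e t)\<^sup>2 / (2 * \<Lambda>))
     + nparams * p\<^sup>2 * sqrt (real n) * (real n * b * R) * ((1 - (1 + \<alpha> * t) * e t) / \<Lambda>\<^sup>2)" for t
  define h' where "h' t = \<eta> * (b * (1 - e t) * (sqrt (real n) * (R * e t))
     + nparams * p\<^sup>2 * (sqrt (real n) * (\<eta> * (real n * b * R) * t * e t)))" for t
  have b0: "0 \<le> b" unfolding b_def nparams_def using c \<rho>_pos by simp
  have \<alpha>: "0 < \<alpha>" using \<eta> \<Lambda> by (simp add: \<alpha>_def)
  have e1: "e t \<le> 1" if "0 \<le> t" for t using that \<alpha> by (simp add: e_def)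
  have ed: "(e has_real_derivative - \<alpha> * e t) (at t within S)" for t S
    unfolding e_def by (rule derivative_eq_intros refl | simp)+
  have "\<bar>dev \<tau> x - dev 0 x\<bar> \<le> h \<tau> - h 0"
  proof (rule abs_deriv_le_imp_abs_le[OF \<tau> dev_deriv[OF x], where h' = h'])
    fix t assume t: "0 \<le> t" "t \<le> \<tau>"
    show "(h has_real_derivative h' t) (at t within {0..})"
      unfolding h_def using \<Lambda> \<eta>
      by (auto intro!: derivative_eq_intros ed simp: h'_def \<alpha>_def field_simps power2_eq_square)
    have "\<bar>\<Sum>k<n. (K (\<gamma> t) x (xs k) - K \<theta>0 x (xs k)) * r t k\<bar> \<le> b * (1 - e t) * (sqrt (real n) * L2_set (r t) {..<n})"
    proof (rule abs_sum_mult_le_L2)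
      show "\<bar>K (\<gamma> t) x (xs k) - K \<theta>0 x (xs k)\<bar> \<le> b * (1 - e t)" if "k < n" for k
        using K_lipschitz[OF x xs[OF that] displacement_bound[OF t(1)]] by (simp add: b_def e_def \<alpha>_def mult_ac)
      show "0 \<le> b * (1 - e t)" using b0 e1[OF t(1)] by simp
    qed
    also have "\<dots> \<le> b * (1 - e t) * (sqrt (real n) * (R * e t))"
      using residual_bound[OF t(1)] b0 e1[OF t(1)] by (intro mult_left_mono) (auto simp: e_def \<alpha>_def)
    finally have 1: "\<bar>\<Sum>k<n. (K (\<gamma> t) x (xs k) - K \<theta>0 x (xs k)) * r t k\<bar> \<le> b * (1 - e t) * (sqrt (real n) * (R * e t))" .
    have "\<bar>\<Sum>k<n. K \<theta>0 x (xs k) * dev t (xs k)\<bar> \<le> nparams * p\<^sup>2 * (sqrt (real n) * L2_set (\<lambda>k. dev t (xs k)) {..<n})"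
      by (rule abs_sum_mult_le_L2) (use K_bound[OF x xs] in \<open>auto simp: nparams_def\<close>)
    also have "\<dots> \<le> nparams * p\<^sup>2 * (sqrt (real n) * (\<eta> * (real n * b * R) * t * e t))"
      using dev_train_bound[OF t(1)] by (intro mult_left_mono) (auto simp: e_def \<alpha>_def b_def comp_def nparams_def)
    finally have 2: "\<bar>\<Sum>k<n. K \<theta>0 x (xs k) * dev t (xs k)\<bar> \<le> nparams * p\<^sup>2 * (sqrt (real n) * (\<eta> * (real n * b * R) * t * e t))" .
    show "\<bar>- \<eta> * ((\<Sum>k<n. (K (\<gamma> t) x (xs k) - K \<theta>0 x (xs k)) * r t k) + (\<Sum>k<n. K \<theta>0 x (xs k) * dev t (xs k)))\<bar> \<le> h' t"
      unfolding h'_def abs_mult using \<eta> order_trans[OF abs_triangle_ineq add_mono[OF 1 2]]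
      by (simp add: mult_left_mono)
  qed
  also have "h \<tau> - h 0 \<le> sqrt (real n) * b * R * (1 / (2 * \<Lambda>)) + nparams * p\<^sup>2 * sqrt (real n) * (real n * b * R) * (1 / \<Lambda>\<^sup>2)"
  proof -
    have "h 0 = 0" by (simp add: h_def e_def)
    moreover have "(1 - e \<tau>)\<^sup>2 / (2 * \<Lambda>) \<le> 1 / (2 * \<Lambda>)"
      using e1[OF \<tau>] \<Lambda> by (intro divide_right_mono power_le_one) (auto simp: e_def)
    moreover have "(1 - (1 + \<alpha> * \<tau>) * e \<tau>) / \<Lambda>\<^sup>2 \<le> 1 / \<Lambda>\<^sup>2"
      using \<alpha> \<tau> by (intro divide_right_mono) (auto simp: e_def)
    moreover have "0 \<le> sqrt (real n) * b * R" "0 \<le> nparams * p\<^sup>2 * sqrt (real n) * (real n * b * R)"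
      using b0 R by (simp_all add: nparams_def)
    ultimately show ?thesis unfolding h_def[of \<tau>]
      using add_mono[OF mult_left_mono mult_left_mono] by (metis diff_zero)
  qed
  finally show ?thesis using dev_0[OF x] by (simp add: b_def mult_ac)
qed

end

section \<open>Operators on qubits\<close>

lemma index_mult_mat_sum:
  assumes "A \<in> carrier_mat n p" "B \<in> carrier_mat p q" "i < n" "j < q"
  shows "(A * B) $$ (i, j) = (\<Sum>l<p. A $$ (i, l) * B $$ (l, j))"
  using assms by (simp add: scalar_prod_def lessThan_atLeast0)

lemma mat_adjoint_carrier: "A \<in> carrier_mat n p \<Longrightarrow> mat_adjoint A \<in> carrier_mat p n"
  by (rule carrier_matI) (simp_all add: mat_adjoint_def)

lemma index_mat_adjoint:
  fixes A :: "complex mat"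
  assumes "A \<in> carrier_mat n p" "i < p" "j < n"
  shows "mat_adjoint A $$ (i, j) = cnj (A $$ (j, i))"
  using assms by (simp add: mat_adjoint_def mat_of_rows_index)

lemma mat_adjoint_mult:
  fixes A B :: "complex mat"
  assumes A: "A \<in> carrier_mat n p" and B: "B \<in> carrier_mat p q"
  shows "mat_adjoint (A * B) = mat_adjoint B * mat_adjoint A"
proof (rule eq_matI)
  note AB = mult_carrier_mat[OF A B] and A' = mat_adjoint_carrier[OF A] and B' = mat_adjoint_carrier[OF B]
  fix i j assume "i < dim_row (mat_adjoint B * mat_adjoint A)" "j < dim_col (mat_adjoint B * mat_adjoint A)"
  then have i: "i < q" and j: "j < n" using A' B' by auto
  show "mat_adjoint (A * B) $$ (i, j) = (mat_adjoint B * mat_adjoint A) $$ (i, j)"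
    using i j by (simp add: index_mat_adjoint[OF AB] index_mult_mat_sum[OF A B] index_mult_mat_sum[OF B' A']
        index_mat_adjoint[OF A] index_mat_adjoint[OF B] mult.commute)
qed (use mat_adjoint_carrier[OF A] mat_adjoint_carrier[OF B] mat_adjoint_carrier[OF mult_carrier_mat[OF A B]] in auto)

section \<open>Bits of basis indices\<close>

lemma qubit_bit_less: "qubit_bit m i k < 2"
  by (simp add: qubit_bit_def)

lemma qubit_bit_Suc: "k \<le> m \<Longrightarrow> qubit_bit (Suc m) i k = qubit_bit m (i div 2) k"
  by (simp add: qubit_bit_def Suc_diff_le div_mult2_eq)

lemma qubit_bit_last: "qubit_bit m i m = i mod 2"
  by (simp add: qubit_bit_def)

text \<open>Qubit m carries the least significant bit, so halving the index removes it and leaves an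
  index on m - 1 qubits.\<close>

lemma index_eqI:
  assumes "i < 2 ^ m" "j < 2 ^ m" "\<And>k. k \<in> {1..m} \<Longrightarrow> qubit_bit m i k = qubit_bit m j k"
  shows "i = j"
  using assms
proof (induction m arbitrary: i j)
  case (Suc m)
  have "i div 2 = j div 2"
  proof (rule Suc.IH)
    fix k assume "k \<in> {1..m}"
    then show "qubit_bit m (i div 2) k = qubit_bit m (j div 2) k"
      using Suc.prems(3)[of k] by (simp add: qubit_bit_Suc)
  qed (use Suc.prems in auto)
  moreover have "i mod 2 = j mod 2"
    using Suc.prems(3)[of "Suc m"] by (simp add: qubit_bit_last)
  ultimately show ?case by (metis div_mult_mod_eq)
qed simp

lemma index_of_bits:
  assumes "\<And>k. b k < 2"
  shows "\<exists>i<2 ^ m. \<forall>k\<in>{1..m}. qubit_bit m i k = b k"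
proof (induction m)
  case (Suc m)
  then obtain i where i: "i < 2 ^ m" "\<forall>k\<in>{1..m}. qubit_bit m i k = b k" by blast
  have b: "b (Suc m) < 2" by (rule assms)
  have "qubit_bit (Suc m) (2 * i + b (Suc m)) k = b k" if "k \<in> {1..Suc m}" for k
  proof (cases "k = Suc m")
    case True then show ?thesis using b by (simp add: qubit_bit_last)
  next
    case False then show ?thesis using that b i(2) by (simp add: qubit_bit_Suc)
  qed
  moreover have "2 * i + b (Suc m) < 2 ^ Suc m" using i(1) b by simp
  ultimately show ?case by blast
qed simp

text \<open>A matrix product sums over an intermediate basis index. When nonzero terms prescribe
  each of its bits, the sum collapses to one term; products of operators on different qubits are
  computed this way.\<close>

lemma sum_index_unique:
  fixes t :: "nat \<Rightarrow> complex"
  assumes b: "\<And>k. b k < 2"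
    and t: "\<And>l k. l < 2 ^ m \<Longrightarrow> t l \<noteq> 0 \<Longrightarrow> k \<in> {1..m} \<Longrightarrow> qubit_bit m l k = b k"
  shows "\<exists>l0<2 ^ m. (\<forall>k\<in>{1..m}. qubit_bit m l0 k = b k) \<and> (\<Sum>l<2 ^ m. t l) = t l0"
proof -
  obtain l0 where l0: "l0 < 2 ^ m" "\<And>k. k \<in> {1..m} \<Longrightarrow> qubit_bit m l0 k = b k"
    using index_of_bits[of b m, OF b] by blast
  have "t l = 0" if "l < 2 ^ m" "l \<noteq> l0" for l
    using index_eqI[of l m l0] t[of l] l0 that by metis
  then have "(\<Sum>l<2 ^ m. t l) = (\<Sum>l\<in>{l0}. t l)"
    by (intro sum.mono_neutral_right) (use l0(1) in auto)
  with l0 show ?thesis by (intro exI[of _ l0]) simp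
qed

lemma sub_index_Nil: "sub_index m [] i = 0"
  by (simp add: sub_index_def)

lemma sub_index_snoc: "sub_index m (ks @ [k]) i = 2 * sub_index m ks i + qubit_bit m i k"
  by (simp add: sub_index_def)

lemma sub_index_single: "sub_index m [k] i = qubit_bit m i k"
  by (simp add: sub_index_def)

lemma sub_index_less: "sub_index m ks i < 2 ^ length ks"
proof (induction ks rule: rev_induct)
  case (snoc k ks) then show ?case using qubit_bit_less[of m i k] by (simp add: sub_index_snoc)
qed (simp add: sub_index_Nil)

lemma sub_index_eq_iff:
  "sub_index m ks i = sub_index m ks j \<longleftrightarrow> (\<forall>k\<in>set ks. qubit_bit m i k = qubit_bit m j k)"
proof (induction ks rule: rev_induct)
  case (snoc k ks)
  have "2 * a + qubit_bit m i k = 2 * a' + qubit_bit m j k \<longleftrightarrow> a = a' \<and> qubit_bit m i k = qubit_bit m j k" for a a'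
    using qubit_bit_less[of m i k] qubit_bit_less[of m j k] by presburger
  with snoc show ?case by (auto simp: sub_index_snoc)
qed (simp add: sub_index_Nil)

text \<open>The change of variables behind \<open>embed_op_mult\<close>: the intermediate indices
  that agree with \<open>i\<close> off \<open>ks\<close> are parametrized by their local index on
  \<open>ks\<close>.\<close>

lemma bij_betw_sub_index:
  assumes ks: "distinct ks" "set ks \<subseteq> {1..m}"
  shows "bij_betw (sub_index m ks) {l. l < 2 ^ m \<and> (\<forall>k\<in>{1..m} - set ks. qubit_bit m i k = qubit_bit m l k)} {..<2 ^ length ks}"
    (is "bij_betw _ ?S _")
proof -
  have inj: "inj_on (sub_index m ks) ?S"
  proof (rule inj_onI)
    fix x y assume xy: "x \<in> ?S" "y \<in> ?S" "sub_index m ks x = sub_index m ks y"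
    show "x = y"
    proof (rule index_eqI)
      fix k assume k: "k \<in> {1..m}"
      show "qubit_bit m x k = qubit_bit m y k"
      proof (cases "k \<in> set ks")
        case True then show ?thesis using xy(3) by (simp add: sub_index_eq_iff)
      next
        case False
        then have "qubit_bit m i k = qubit_bit m x k" "qubit_bit m i k = qubit_bit m y k" using k xy(1,2) by blast+
        then show ?thesis by simp
      qed
    qed (use xy in auto)
  qed
  have ex: "\<exists>l. l < 2 ^ m \<and> (\<forall>k\<in>{1..m} - set ks. qubit_bit m i k = qubit_bit m l k) \<and> sub_index m ks l = a"
    if "a < 2 ^ length ks" for a
    using that ks
  proof (induction ks arbitrary: a rule: rev_induct)
    case Nil
    have "\<exists>l<2 ^ m. \<forall>k\<in>{1..m}. qubit_bit m l k = qubit_bit m i k"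
      by (rule index_of_bits) (rule qubit_bit_less)
    then obtain l where "l < 2 ^ m" "\<And>k. k \<in> {1..m} \<Longrightarrow> qubit_bit m l k = qubit_bit m i k" by blast
    then show ?case using Nil by (intro exI[of _ l]) (simp add: sub_index_Nil)
  next
    case (snoc k ks)
    have k: "k \<in> {1..m}" "k \<notin> set ks" using snoc.prems by auto
    have "a div 2 < 2 ^ length ks" using snoc.prems(1) by simp
    then obtain l where l: "l < 2 ^ m" "\<forall>k\<in>{1..m} - set ks. qubit_bit m i k = qubit_bit m l k" "sub_index m ks l = a div 2"
      using snoc.IH[of "a div 2"] snoc.prems by auto
    have "\<exists>l'<2 ^ m. \<forall>k'\<in>{1..m}. qubit_bit m l' k' = (if k' = k then a mod 2 else qubit_bit m l k')"
      by (rule index_of_bits) (simp add: qubit_bit_less)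
    then obtain l' where l': "l' < 2 ^ m" "\<And>k'. k' \<in> {1..m} \<Longrightarrow> qubit_bit m l' k' = (if k' = k then a mod 2 else qubit_bit m l k')"
      by blast
    have "sub_index m ks l' = sub_index m ks l"
      unfolding sub_index_eq_iff using l'(2) k snoc.prems(3) by auto
    then have "sub_index m (ks @ [k]) l' = a" using l(3) l'(2)[OF k(1)] by (simp add: sub_index_snoc)
    moreover have "\<forall>k'\<in>{1..m} - set (ks @ [k]). qubit_bit m i k' = qubit_bit m l' k'"
      using l(2) l'(2) by auto
    ultimately show ?case using l'(1) by blast
  qed
  show ?thesis unfolding bij_betw_def
    using inj ex sub_index_less by (auto simp: image_iff) (metis+)?
qed

section \<open>Embedded operators\<close>

lemma embed_op_carrier [simp]: "embed_op m ks A \<in> carrier_mat (2 ^ m) (2 ^ m)"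
  by (simp add: embed_op_def)

lemma index_embed_op:
  "i < 2 ^ m \<Longrightarrow> j < 2 ^ m \<Longrightarrow> embed_op m ks A $$ (i, j) =
    (if \<forall>k\<in>{1..m} - set ks. qubit_bit m i k = qubit_bit m j k then A $$ (sub_index m ks i, sub_index m ks j) else 0)"
  by (simp add: embed_op_def)

lemma embed_op_adjoint:
  assumes "A \<in> carrier_mat (2 ^ length ks) (2 ^ length ks)"
  shows "mat_adjoint (embed_op m ks A) = embed_op m ks (mat_adjoint A)"
proof (rule eq_matI)
  fix i j assume "i < dim_row (embed_op m ks (mat_adjoint A))" "j < dim_col (embed_op m ks (mat_adjoint A))"
  then have ij: "i < 2 ^ m" "j < 2 ^ m" by (auto simp: embed_op_def)
  then show "mat_adjoint (embed_op m ks A) $$ (i, j) = embed_op m ks (mat_adjoint A) $$ (i, j)"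
    by (auto simp: index_mat_adjoint[OF embed_op_carrier] index_embed_op index_mat_adjoint[OF assms] sub_index_less)
qed (use mat_adjoint_carrier[OF embed_op_carrier, of m ks A] in \<open>auto simp: embed_op_def\<close>)

lemma embed_op_mult:
  assumes ks: "distinct ks" "set ks \<subseteq> {1..m}"
    and A: "A \<in> carrier_mat (2 ^ length ks) (2 ^ length ks)" and B: "B \<in> carrier_mat (2 ^ length ks) (2 ^ length ks)"
  shows "embed_op m ks A * embed_op m ks B = embed_op m ks (A * B)"
proof (rule eq_matI)
  fix i j assume "i < dim_row (embed_op m ks (A * B))" "j < dim_col (embed_op m ks (A * B))"
  then have ij: "i < 2 ^ m" "j < 2 ^ m" by (auto simp: embed_op_def)
  let ?ag = "\<lambda>i l. \<forall>k\<in>{1..m} - set ks. qubit_bit m i k = qubit_bit m l k"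
  let ?S = "{l. l < 2 ^ m \<and> ?ag i l}"
  have if_out: "(\<Sum>l\<in>T. if b then g l else 0) = (if b then sum g T else 0)" for b and T :: "nat set" and g :: "nat \<Rightarrow> complex"
    by simp
  have "(embed_op m ks A * embed_op m ks B) $$ (i, j)
     = (\<Sum>l<2 ^ m. embed_op m ks A $$ (i, l) * embed_op m ks B $$ (l, j))"
    by (rule index_mult_mat_sum[OF embed_op_carrier embed_op_carrier ij])
  also have "\<dots> = (\<Sum>l\<in>?S. if ?ag i j then A $$ (sub_index m ks i, sub_index m ks l) * B $$ (sub_index m ks l, sub_index m ks j) else 0)"
    using ij by (intro sum.mono_neutral_cong_right) (auto simp: index_embed_op)
  also have "\<dots> = (if ?ag i j then (\<Sum>l\<in>?S. A $$ (sub_index m ks i, sub_index m ks l) * B $$ (sub_index m ks l, sub_index m ks j)) else 0)"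
    by (rule if_out)
  also have "(\<Sum>l\<in>?S. A $$ (sub_index m ks i, sub_index m ks l) * B $$ (sub_index m ks l, sub_index m ks j))
     = (\<Sum>a<2 ^ length ks. A $$ (sub_index m ks i, a) * B $$ (a, sub_index m ks j))"
    by (rule sum.reindex_bij_betw[OF bij_betw_sub_index[OF ks]])
  also have "\<dots> = (A * B) $$ (sub_index m ks i, sub_index m ks j)"
    by (rule index_mult_mat_sum[OF A B, symmetric]) (rule sub_index_less)+
  finally show "(embed_op m ks A * embed_op m ks B) $$ (i, j) = embed_op m ks (A * B) $$ (i, j)"
    using ij by (simp add: index_embed_op)
qed (auto simp: embed_op_def)

lemma embed_op_scalar:
  assumes "set ks \<subseteq> {1..m}"
  shows "embed_op m ks (a \<cdot>\<^sub>m 1\<^sub>m (2 ^ length ks)) = a \<cdot>\<^sub>m 1\<^sub>m (2 ^ m)"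
proof (rule eq_matI)
  fix i j assume "i < dim_row (a \<cdot>\<^sub>m 1\<^sub>m (2 ^ m))" "j < dim_col (a \<cdot>\<^sub>m 1\<^sub>m (2 ^ m) :: complex mat)"
  then have ij: "i < 2 ^ m" "j < 2 ^ m" by auto
  have "i = j" if "\<forall>k\<in>{1..m} - set ks. qubit_bit m i k = qubit_bit m j k" "sub_index m ks i = sub_index m ks j"
    by (rule index_eqI[OF ij]) (use that sub_index_eq_iff in blast)
  then show "embed_op m ks (a \<cdot>\<^sub>m 1\<^sub>m (2 ^ length ks)) $$ (i, j) = (a \<cdot>\<^sub>m 1\<^sub>m (2 ^ m)) $$ (i, j)"
    using ij by (auto simp: index_embed_op sub_index_less)
qed (auto simp: embed_op_def)

lemma embed_op_one: "set ks \<subseteq> {1..m} \<Longrightarrow> embed_op m ks (1\<^sub>m (2 ^ length ks)) = 1\<^sub>m (2 ^ m)"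
proof -
  have "1 \<cdot>\<^sub>m 1\<^sub>m k = (1\<^sub>m k :: complex mat)" for k by (rule eq_matI) auto
  then show "set ks \<subseteq> {1..m} \<Longrightarrow> ?thesis" using embed_op_scalar[of ks m 1] by simp
qed

text \<open>The first factor preserves bits off \<open>ks\<close>, the second preserves bits off
  \<open>ks'\<close>. With disjoint lists the intermediate index must carry the bits of
  \<open>j\<close> on \<open>ks\<close> and those of \<open>i\<close> elsewhere. The formula is
  symmetric in the two factors, whence they commute.\<close>

lemma index_embed_op_mult_disjoint:
  assumes ks: "set ks \<subseteq> {1..m}" "set ks' \<subseteq> {1..m}" and disj: "set ks \<inter> set ks' = {}" and ij: "i < 2 ^ m" "j < 2 ^ m"
  shows "(embed_op m ks A * embed_op m ks' B) $$ (i, j) =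
    (if \<forall>k\<in>{1..m} - (set ks \<union> set ks'). qubit_bit m i k = qubit_bit m j k
     then A $$ (sub_index m ks i, sub_index m ks j) * B $$ (sub_index m ks' i, sub_index m ks' j) else 0)"
proof -
  define t where "t l = embed_op m ks A $$ (i, l) * embed_op m ks' B $$ (l, j)" for l
  have bits: "qubit_bit m l k = (if k \<in> set ks then qubit_bit m j k else qubit_bit m i k)"
    if l: "l < 2 ^ m" "t l \<noteq> 0" and k: "k \<in> {1..m}" for l k
  proof -
    have a: "\<forall>k\<in>{1..m} - set ks. qubit_bit m i k = qubit_bit m l k" "\<forall>k\<in>{1..m} - set ks'. qubit_bit m l k = qubit_bit m j k"
      using ij l by (auto simp: t_def index_embed_op split: if_splits)
    show ?thesis
    proof (cases "k \<in> set ks")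
      case True
      then have "k \<in> {1..m} - set ks'" using k disj by auto
      then show ?thesis using a(2) True by simp
    qed (use a(1) k in simp)
  qed
  have "\<exists>l0<2 ^ m. (\<forall>k\<in>{1..m}. qubit_bit m l0 k = (if k \<in> set ks then qubit_bit m j k else qubit_bit m i k)) \<and> (\<Sum>l<2 ^ m. t l) = t l0"
    by (rule sum_index_unique[OF _ bits]) (simp_all add: qubit_bit_less)
  then obtain l0 where l0: "l0 < 2 ^ m" "\<And>k. k \<in> {1..m} \<Longrightarrow> qubit_bit m l0 k = (if k \<in> set ks then qubit_bit m j k else qubit_bit m i k)"
      "(\<Sum>l<2 ^ m. t l) = t l0"
    by blast
  have "(embed_op m ks A * embed_op m ks' B) $$ (i, j) = t l0"
    using index_mult_mat_sum[OF embed_op_carrier embed_op_carrier ij] l0(3) by (simp only: t_def)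
  also have "\<dots> = (if \<forall>k\<in>{1..m} - (set ks \<union> set ks'). qubit_bit m i k = qubit_bit m j k
     then A $$ (sub_index m ks i, sub_index m ks j) * B $$ (sub_index m ks' i, sub_index m ks' j) else 0)"
  proof -
    have a1: "\<forall>k\<in>{1..m} - set ks. qubit_bit m i k = qubit_bit m l0 k" using l0(2) by simp
    have a2: "(\<forall>k\<in>{1..m} - set ks'. qubit_bit m l0 k = qubit_bit m j k)
       \<longleftrightarrow> (\<forall>k\<in>{1..m} - (set ks \<union> set ks'). qubit_bit m i k = qubit_bit m j k)" (is "?L \<longleftrightarrow> ?R")
    proof
      assume L: ?L
      show ?R
      proof
        fix k assume "k \<in> {1..m} - (set ks \<union> set ks')"
        then show "qubit_bit m i k = qubit_bit m j k" using L l0(2)[of k] by simp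
      qed
    next
      assume R: ?R
      show ?L
      proof
        fix k assume "k \<in> {1..m} - set ks'"
        then show "qubit_bit m l0 k = qubit_bit m j k" using R l0(2)[of k] by (cases "k \<in> set ks") simp_all
      qed
    qed
    have a3: "sub_index m ks l0 = sub_index m ks j"
      unfolding sub_index_eq_iff
    proof
      fix k assume "k \<in> set ks"
      then show "qubit_bit m l0 k = qubit_bit m j k" using l0(2)[of k] ks by (simp add: subset_iff)
    qed
    have a4: "sub_index m ks' l0 = sub_index m ks' i"
      unfolding sub_index_eq_iff
    proof
      fix k assume "k \<in> set ks'"
      then have "k \<in> {1..m}" "k \<notin> set ks" using ks disj by blast+
      then show "qubit_bit m l0 k = qubit_bit m i k" using l0(2)[of k] by simp
    qed
    show ?thesis
      unfolding t_def index_embed_op[OF ij(1) l0(1)] index_embed_op[OF l0(1) ij(2)] if_P[OF a1] a2 a3 a4 by simp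
  qed
  finally show ?thesis .
qed

lemma embed_op_commute:
  assumes "set ks \<subseteq> {1..m}" "set ks' \<subseteq> {1..m}" "set ks \<inter> set ks' = {}"
  shows "embed_op m ks A * embed_op m ks' B = embed_op m ks' B * embed_op m ks A"
proof (rule eq_matI)
  fix i j assume "i < dim_row (embed_op m ks' B * embed_op m ks A)" "j < dim_col (embed_op m ks' B * embed_op m ks A)"
  then have ij: "i < 2 ^ m" "j < 2 ^ m" by (auto simp: embed_op_def)
  have d': "set ks' \<inter> set ks = {}" using assms(3) by blast
  show "(embed_op m ks A * embed_op m ks' B) $$ (i, j) = (embed_op m ks' B * embed_op m ks A) $$ (i, j)"
    unfolding index_embed_op_mult_disjoint[OF assms ij] index_embed_op_mult_disjoint[OF assms(2,1) d' ij]
    by (simp add: Un_commute mult.commute)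
qed (auto simp: embed_op_def)

section \<open>Unitary operators\<close>

lemma unitary_matD:
  assumes "unitary_mat U" "U \<in> carrier_mat n n"
  shows "mat_adjoint U * U = 1\<^sub>m n" "U * mat_adjoint U = 1\<^sub>m n"
  using assms mat_adjoint_carrier[OF assms(2)] by (auto simp: unitary_mat_def inverts_mat_def)

lemma unitary_matI:
  assumes U: "U \<in> carrier_mat n n" and "mat_adjoint U * U = 1\<^sub>m n" "U * mat_adjoint U = 1\<^sub>m n"
  shows "unitary_mat U"
  using assms mat_adjoint_carrier[OF U] by (auto simp: unitary_mat_def inverts_mat_def)

lemma unitary_embed_op:
  assumes ks: "distinct ks" "set ks \<subseteq> {1..m}" and G: "G \<in> carrier_mat (2 ^ length ks) (2 ^ length ks)" "unitary_mat G"
  shows "unitary_mat (embed_op m ks G)"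
  by (rule unitary_matI[OF embed_op_carrier])
    (simp_all add: embed_op_adjoint[OF G(1)] embed_op_mult[OF ks] G(1) mat_adjoint_carrier[OF G(1)]
      unitary_matD[OF G(2,1)] embed_op_one[OF ks(2)])

lemma mat_adjoint_one: "mat_adjoint (1\<^sub>m n) = (1\<^sub>m n :: complex mat)"
  by (rule eq_matI) (use mat_adjoint_carrier[of "1\<^sub>m n :: complex mat" n n] in \<open>auto simp: index_mat_adjoint[of _ n n]\<close>)

lemma unitary_one: "unitary_mat (1\<^sub>m n)"
  by (rule unitary_matI[of _ n]) (simp_all add: mat_adjoint_one)

lemma unitary_mult:
  assumes U: "U \<in> carrier_mat n n" "unitary_mat U" and V: "V \<in> carrier_mat n n" "unitary_mat V"
  shows "unitary_mat (U * V)"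
proof (rule unitary_matI[of _ n])
  note c = U(1) V(1) mat_adjoint_carrier[OF U(1)] mat_adjoint_carrier[OF V(1)]
  have "mat_adjoint (U * V) * (U * V) = mat_adjoint V * (mat_adjoint U * U) * V"
    unfolding mat_adjoint_mult[OF U(1) V(1)] using c by (simp add: assoc_mult_mat[of _ n n _ n _ n])
  then show "mat_adjoint (U * V) * (U * V) = 1\<^sub>m n" using c by (simp add: unitary_matD[OF U(2,1)] unitary_matD[OF V(2,1)])
  have "(U * V) * mat_adjoint (U * V) = U * (V * mat_adjoint V) * mat_adjoint U"
    unfolding mat_adjoint_mult[OF U(1) V(1)] using c by (simp add: assoc_mult_mat[of _ n n _ n _ n])
  then show "(U * V) * mat_adjoint (U * V) = 1\<^sub>m n" using c by (simp add: unitary_matD[OF U(2,1)] unitary_matD[OF V(2,1)])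
qed (use U V in auto)

section \<open>Products of gates\<close>

text \<open>A common form for the entangling part and the rotation part of a layer, so that
  light-cone arguments are inductions on a list of gates.\<close>

definition gate_prod :: "nat \<Rightarrow> (nat list \<times> complex mat) list \<Rightarrow> complex mat" where
  "gate_prod m gs = foldr (\<lambda>g B. embed_op m (fst g) (snd g) * B) gs (1\<^sub>m (2 ^ m))"

definition valid_gate :: "nat \<Rightarrow> nat list \<times> complex mat \<Rightarrow> bool" where
  "valid_gate m g \<longleftrightarrow> distinct (fst g) \<and> set (fst g) \<subseteq> {1..m} \<and>
     snd g \<in> carrier_mat (2 ^ length (fst g)) (2 ^ length (fst g)) \<and> unitary_mat (snd g)"

lemma gate_prod_Nil: "gate_prod m [] = 1\<^sub>m (2 ^ m)"
  and gate_prod_Cons: "gate_prod m (g # gs) = embed_op m (fst g) (snd g) * gate_prod m gs"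
  by (simp_all add: gate_prod_def)

lemma gate_prod_carrier [simp]: "gate_prod m gs \<in> carrier_mat (2 ^ m) (2 ^ m)"
  by (induction gs) (auto simp: gate_prod_Nil gate_prod_Cons intro!: mult_carrier_mat)

lemma unitary_valid_gate: "valid_gate m g \<Longrightarrow> unitary_mat (embed_op m (fst g) (snd g))"
  unfolding valid_gate_def by (intro unitary_embed_op) auto

lemma unitary_gate_prod: "(\<And>g. g \<in> set gs \<Longrightarrow> valid_gate m g) \<Longrightarrow> unitary_mat (gate_prod m gs)"
proof (induction gs)
  case (Cons g gs)
  then show ?case
    unfolding gate_prod_Cons by (intro unitary_mult[where n = "2 ^ m"] unitary_valid_gate) auto
qed (simp add: gate_prod_Nil unitary_one)

section \<open>Heisenberg evolution and the growth of supports\<close>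

definition conj_op :: "complex mat \<Rightarrow> complex mat \<Rightarrow> complex mat" where
  "conj_op U A = mat_adjoint U * A * U"

lemma conj_op_carrier: "U \<in> carrier_mat n n \<Longrightarrow> A \<in> carrier_mat n n \<Longrightarrow> conj_op U A \<in> carrier_mat n n"
  unfolding conj_op_def by (intro mult_carrier_mat mat_adjoint_carrier)

lemma conj_op_mult:
  assumes U: "U \<in> carrier_mat n n" and V: "V \<in> carrier_mat n n" and A: "A \<in> carrier_mat n n"
  shows "conj_op (U * V) A = conj_op V (conj_op U A)"
  using assms mat_adjoint_carrier[OF U] mat_adjoint_carrier[OF V]
  unfolding conj_op_def mat_adjoint_mult[OF U V] by (simp add: assoc_mult_mat[of _ n n _ n _ n])

lemma conj_op_one: "A \<in> carrier_mat n n \<Longrightarrow> conj_op (1\<^sub>m n) A = A"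
  by (simp add: conj_op_def mat_adjoint_one)

text \<open>Support is expressed through the commutant, so that conjugation by a gate away from S fixes the
  operator. Testing against one- and two-qubit operators suffices, as no gate is larger.\<close>

definition supported :: "nat \<Rightarrow> nat set \<Rightarrow> complex mat \<Rightarrow> bool" where
  "supported m S A \<longleftrightarrow> A \<in> carrier_mat (2 ^ m) (2 ^ m) \<and>
     (\<forall>ks B. set ks \<subseteq> {1..m} \<longrightarrow> set ks \<inter> S = {} \<longrightarrow> length ks \<le> 2 \<longrightarrow> A * embed_op m ks B = embed_op m ks B * A)"

lemma supported_carrier: "supported m S A \<Longrightarrow> A \<in> carrier_mat (2 ^ m) (2 ^ m)"
  by (simp add: supported_def)

lemma supported_mono: "supported m S A \<Longrightarrow> S \<subseteq> T \<Longrightarrow> supported m T A"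
  unfolding supported_def by blast

lemma supported_embed_op: "set ks \<subseteq> {1..m} \<Longrightarrow> supported m (set ks) (embed_op m ks A)"
  unfolding supported_def by (intro conjI allI impI embed_op_carrier embed_op_commute) auto

lemma conj_op_disjoint_gate:
  assumes A: "supported m S A" and g: "valid_gate m g" "length (fst g) \<le> 2" and disj: "set (fst g) \<inter> S = {}"
  shows "conj_op (embed_op m (fst g) (snd g)) A = A"
proof -
  let ?E = "embed_op m (fst g) (snd g)"
  note A' = supported_carrier[OF A] and E' = mat_adjoint_carrier[OF embed_op_carrier[of m "fst g" "snd g"]]
  have "conj_op ?E A = mat_adjoint ?E * (A * ?E)"
    unfolding conj_op_def by (rule assoc_mult_mat[OF E' A' embed_op_carrier])
  also have "A * ?E = ?E * A"
    using A g disj unfolding supported_def valid_gate_def by blast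
  also have "mat_adjoint ?E * (?E * A) = mat_adjoint ?E * ?E * A"
    by (rule assoc_mult_mat[OF E' embed_op_carrier A', symmetric])
  also have "\<dots> = A"
    using unitary_matD(1)[OF unitary_valid_gate[OF g(1)] embed_op_carrier] A' by simp
  finally show ?thesis .
qed

text \<open>A test operator away from both \<open>S\<close> and the gate commutes with each of the
  three factors; for the adjoint factor this holds because it is again an embedded operator on the
  same qubits.\<close>

lemma supported_conj_op_gate:
  assumes A: "supported m S A" and g: "valid_gate m g"
  shows "supported m (S \<union> set (fst g)) (conj_op (embed_op m (fst g) (snd g)) A)"
  unfolding supported_def
proof (intro conjI allI impI)
  let ?E = "embed_op m (fst g) (snd g)"
  note A' = supported_carrier[OF A] and E' = mat_adjoint_carrier[OF embed_op_carrier[of m "fst g" "snd g"]]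
  have G: "set (fst g) \<subseteq> {1..m}" "snd g \<in> carrier_mat (2 ^ length (fst g)) (2 ^ length (fst g))"
    using g by (auto simp: valid_gate_def)
  show "conj_op ?E A \<in> carrier_mat (2 ^ m) (2 ^ m)" by (rule conj_op_carrier[OF embed_op_carrier A'])
  fix ks B assume ks: "set ks \<subseteq> {1..m}" "set ks \<inter> (S \<union> set (fst g)) = {}" "length ks \<le> 2"
  let ?B = "embed_op m ks B"
  have 1: "?E * ?B = ?B * ?E" by (rule embed_op_commute) (use G ks in auto)
  have 2: "mat_adjoint ?E * ?B = ?B * mat_adjoint ?E"
    unfolding embed_op_adjoint[OF G(2)] by (rule embed_op_commute) (use G ks in auto)
  have 3: "A * ?B = ?B * A" using A ks unfolding supported_def by blast
  note as = assoc_mult_mat[of _ "2 ^ m" "2 ^ m" _ "2 ^ m" _ "2 ^ m"] mult_carrier_mat[of _ "2 ^ m" "2 ^ m" _ "2 ^ m"]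
  have "conj_op ?E A * ?B = mat_adjoint ?E * A * (?E * ?B)"
    unfolding conj_op_def using A' E' by (simp add: as)
  also have "\<dots> = mat_adjoint ?E * (A * ?B) * ?E" unfolding 1 using A' E' by (simp add: as)
  also have "\<dots> = (mat_adjoint ?E * ?B) * A * ?E" unfolding 3 using A' E' by (simp add: as)
  also have "\<dots> = ?B * conj_op ?E A" unfolding 2 conj_op_def using A' E' by (simp add: as)
  finally show "conj_op ?E A * ?B = ?B * conj_op ?E A" .
qed

text \<open>Since the gates act on disjoint qubits, absorbing a gate into the support never makes it
  meet a further gate that did not already meet \<open>S\<close>. So a whole list of gates enlarges
  the support by a single step.\<close>

lemma supported_conj_op_gates:
  assumes "\<And>g. g \<in> set gs \<Longrightarrow> valid_gate m g \<and> length (fst g) \<le> 2" and "distinct (concat (map fst gs))"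
    and "supported m S A"
  shows "supported m (S \<union> \<Union>{set (fst g) | g. g \<in> set gs \<and> set (fst g) \<inter> S \<noteq> {}}) (conj_op (gate_prod m gs) A)"
  using assms
proof (induction gs arbitrary: S A)
  case Nil
  then show ?case by (simp add: gate_prod_Nil conj_op_one[OF supported_carrier])
next
  case (Cons g gs)
  let ?A = "conj_op (embed_op m (fst g) (snd g)) A"
  have e: "conj_op (gate_prod m (g # gs)) A = conj_op (gate_prod m gs) ?A"
    unfolding gate_prod_Cons
    by (rule conj_op_mult[OF embed_op_carrier gate_prod_carrier supported_carrier[OF Cons.prems(3)]])
  have disj: "set (fst h) \<inter> set (fst g) = {}" if "h \<in> set gs" for h
    using Cons.prems(2) that by auto
  show ?case
  proof (cases "set (fst g) \<inter> S = {}")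
    case True
    have "?A = A" by (rule conj_op_disjoint_gate[OF Cons.prems(3) _ _ True]) (use Cons.prems(1)[of g] in auto)
    have "supported m (S \<union> \<Union>{set (fst h) |h. h \<in> set gs \<and> set (fst h) \<inter> S \<noteq> {}}) (conj_op (gate_prod m gs) A)"
      by (rule Cons.IH[OF _ _ Cons.prems(3)]) (use Cons.prems(1,2) in auto)
    then show ?thesis unfolding e \<open>?A = A\<close> by (rule supported_mono) auto
  next
    case False
    have "supported m (S \<union> set (fst g)) ?A" by (rule supported_conj_op_gate[OF Cons.prems(3)]) (use Cons.prems(1)[of g] in auto)
    from Cons.IH[OF _ _ this] Cons.prems(1,2)
    have "supported m (S \<union> set (fst g) \<union> \<Union>{set (fst h) |h. h \<in> set gs \<and> set (fst h) \<inter> (S \<union> set (fst g)) \<noteq> {}}) (conj_op (gate_prod m gs) ?A)"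
      by auto
    then show ?thesis unfolding e
    proof (rule supported_mono, intro subsetI)
      fix q assume "q \<in> S \<union> set (fst g) \<union> \<Union>{set (fst h) |h. h \<in> set gs \<and> set (fst h) \<inter> (S \<union> set (fst g)) \<noteq> {}}"
      then consider "q \<in> S" | "q \<in> set (fst g)"
        | h where "h \<in> set gs" "set (fst h) \<inter> (S \<union> set (fst g)) \<noteq> {}" "q \<in> set (fst h)" by blast
      then show "q \<in> S \<union> \<Union>{set (fst h) |h. h \<in> set (g # gs) \<and> set (fst h) \<inter> S \<noteq> {}}"
      proof cases
        case 2
        have "g \<in> set (g # gs)" by simp
        then show ?thesis using 2 False by blast
      next
        case 3
        then have "set (fst h) \<inter> S \<noteq> {}" using disj by blast
        moreover have "h \<in> set (g # gs)" using 3 by simp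
        ultimately show ?thesis using 3(3) by blast
      qed simp
    qed
  qed
qed

text \<open>A rotation on a qubit of \<open>S\<close> leaves the support unchanged, and one outside
  \<open>S\<close> cancels whatever its angle. Both conclusions are proved together, as each
  cancellation needs the support after the previous gate.\<close>

lemma conj_op_single_qubit_gates:
  assumes "\<And>k. k \<in> set kl \<Longrightarrow> valid_gate m ([k], W k) \<and> valid_gate m ([k], W' k)"
    and "\<And>k. k \<in> set kl \<Longrightarrow> k \<in> S \<Longrightarrow> W k = W' k" and "supported m S A"
  shows "conj_op (gate_prod m (map (\<lambda>k. ([k], W k)) kl)) A = conj_op (gate_prod m (map (\<lambda>k. ([k], W' k)) kl)) A
    \<and> supported m S (conj_op (gate_prod m (map (\<lambda>k. ([k], W k)) kl)) A)"
  using assms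
proof (induction kl arbitrary: A)
  case Nil
  then show ?case by (simp add: gate_prod_Nil conj_op_one[OF supported_carrier])
next
  case (Cons k kl)
  have e: "conj_op (gate_prod m (map (\<lambda>k. ([k], V k)) (k # kl))) A
      = conj_op (gate_prod m (map (\<lambda>k. ([k], V k)) kl)) (conj_op (embed_op m [k] (V k)) A)" for V
    using conj_op_mult[OF embed_op_carrier gate_prod_carrier supported_carrier[OF Cons.prems(3)]]
    by (simp add: gate_prod_Cons)
  have v: "valid_gate m ([k], W k)" "valid_gate m ([k], W' k)" using Cons.prems(1)[of k] by auto
  let ?A = "conj_op (embed_op m [k] (W k)) A"
  have A: "?A = conj_op (embed_op m [k] (W' k)) A \<and> supported m S (conj_op (embed_op m [k] (W k)) A)"
  proof (cases "k \<in> S")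
    case True
    then show ?thesis using Cons.prems(2)[of k] supported_conj_op_gate[OF Cons.prems(3) v(1)]
      by (simp add: insert_absorb)
  next
    case False
    then show ?thesis using conj_op_disjoint_gate[OF Cons.prems(3) v(1)] conj_op_disjoint_gate[OF Cons.prems(3) v(2)] Cons.prems(3)
      by simp
  qed
  have "conj_op (gate_prod m (map (\<lambda>k. ([k], W k)) kl)) ?A = conj_op (gate_prod m (map (\<lambda>k. ([k], W' k)) kl)) ?A
    \<and> supported m S (conj_op (gate_prod m (map (\<lambda>k. ([k], W k)) kl)) ?A)"
    by (rule Cons.IH) (use Cons.prems(1,2) A in auto)
  with A show ?case unfolding e by metis
qed


section \<open>Single-qubit rotations\<close>

text \<open>The identity in slot \<open>k\<close> forces bit \<open>k\<close> of the intermediate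
  index to be that of \<open>j\<close>, and the embedded operator forces the other bits to be those
  of \<open>i\<close>: again only one term survives.\<close>

lemma embed_op_mult_tensor_ops:
  assumes k: "k \<in> {1..m}" and A: "A k = 1\<^sub>m 2"
  shows "embed_op m [k] B * tensor_ops m A = tensor_ops m (A(k := B))"
proof (rule eq_matI)
  fix i j assume "i < dim_row (tensor_ops m (A(k := B)))" "j < dim_col (tensor_ops m (A(k := B)))"
  then have ij: "i < 2 ^ m" "j < 2 ^ m" by (auto simp: tensor_ops_def)
  have T: "tensor_ops m A \<in> carrier_mat (2 ^ m) (2 ^ m)" by (simp add: tensor_ops_def)
  define t where "t l = embed_op m [k] B $$ (i, l) * tensor_ops m A $$ (l, j)" for l
  have bits: "qubit_bit m l k' = (if k' = k then qubit_bit m j k' else qubit_bit m i k')"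
    if l: "l < 2 ^ m" "t l \<noteq> 0" and k': "k' \<in> {1..m}" for l k'
  proof -
    have a: "\<forall>k'\<in>{1..m} - {k}. qubit_bit m i k' = qubit_bit m l k'"
      using ij l by (auto simp: t_def index_embed_op split: if_splits)
    have "A k $$ (qubit_bit m l k, qubit_bit m j k) \<noteq> 0"
    proof
      assume "A k $$ (qubit_bit m l k, qubit_bit m j k) = 0"
      then have "(\<Prod>k = 1..m. A k $$ (qubit_bit m l k, qubit_bit m j k)) = 0"
        using k by (intro prod_zero) auto
      then show False using ij l by (simp add: t_def tensor_ops_def)
    qed
    then have "qubit_bit m l k = qubit_bit m j k"
      using A qubit_bit_less by (auto split: if_splits)
    then show ?thesis using a k' by (cases "k' = k") simp_all
  qed
  have "\<exists>l0<2 ^ m. (\<forall>k'\<in>{1..m}. qubit_bit m l0 k' = (if k' = k then qubit_bit m j k' else qubit_bit m i k')) \<and> (\<Sum>l<2 ^ m. t l) = t l0"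
    by (rule sum_index_unique[OF _ bits]) (simp_all add: qubit_bit_less)
  then obtain l0 where l0: "l0 < 2 ^ m" "\<And>k'. k' \<in> {1..m} \<Longrightarrow> qubit_bit m l0 k' = (if k' = k then qubit_bit m j k' else qubit_bit m i k')"
      "(\<Sum>l<2 ^ m. t l) = t l0"
    by blast
  have "(embed_op m [k] B * tensor_ops m A) $$ (i, j) = t l0"
    using index_mult_mat_sum[OF embed_op_carrier T ij] l0(3) by (simp only: t_def)
  also have "\<dots> = B $$ (qubit_bit m i k, qubit_bit m j k) * (\<Prod>k' = 1..m. A k' $$ (qubit_bit m l0 k', qubit_bit m j k'))"
  proof -
    have a1: "\<forall>k'\<in>{1..m} - set [k]. qubit_bit m i k' = qubit_bit m l0 k'" using l0(2) by simp
    show ?thesis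
      unfolding t_def index_embed_op[OF ij(1) l0(1)] if_P[OF a1] sub_index_single
      using ij l0(1) l0(2)[OF k] by (simp add: tensor_ops_def)
  qed
  also have "(\<Prod>k' = 1..m. A k' $$ (qubit_bit m l0 k', qubit_bit m j k'))
      = A k $$ (qubit_bit m l0 k, qubit_bit m j k) * (\<Prod>k'\<in>{1..m} - {k}. A k' $$ (qubit_bit m l0 k', qubit_bit m j k'))"
    by (rule prod.remove) (use k in auto)
  also have "A k $$ (qubit_bit m l0 k, qubit_bit m j k) = 1"
    using A l0(2)[OF k] qubit_bit_less by simp
  also have "(\<Prod>k'\<in>{1..m} - {k}. A k' $$ (qubit_bit m l0 k', qubit_bit m j k'))
      = (\<Prod>k'\<in>{1..m} - {k}. (A(k := B)) k' $$ (qubit_bit m i k', qubit_bit m j k'))"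
    by (rule prod.cong) (use l0(2) in auto)
  also have "B $$ (qubit_bit m i k, qubit_bit m j k) * (1 * \<dots>) = (\<Prod>k' = 1..m. (A(k := B)) k' $$ (qubit_bit m i k', qubit_bit m j k'))"
    by (subst prod.remove[of "{1..m}" k]) (use k in auto)
  finally show "(embed_op m [k] B * tensor_ops m A) $$ (i, j) = tensor_ops m (A(k := B)) $$ (i, j)"
    using ij by (simp add: tensor_ops_def)
qed (auto simp: tensor_ops_def embed_op_def)

lemma tensor_ops_one: "tensor_ops m (\<lambda>k. 1\<^sub>m 2) = 1\<^sub>m (2 ^ m)"
proof (rule eq_matI)
  fix i j assume "i < dim_row (1\<^sub>m (2 ^ m) :: complex mat)" "j < dim_col (1\<^sub>m (2 ^ m) :: complex mat)"
  then have ij: "i < 2 ^ m" "j < 2 ^ m" by auto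
  have e: "tensor_ops m (\<lambda>k. 1\<^sub>m 2) $$ (i, j) = (\<Prod>k = 1..m. if qubit_bit m i k = qubit_bit m j k then 1 else 0)"
    using ij qubit_bit_less by (simp add: tensor_ops_def)
  show "tensor_ops m (\<lambda>k. 1\<^sub>m 2) $$ (i, j) = 1\<^sub>m (2 ^ m) $$ (i, j)"
  proof (cases "i = j")
    case False
    then obtain k where "k \<in> {1..m}" "qubit_bit m i k \<noteq> qubit_bit m j k" using index_eqI[OF ij] by blast
    then have "(\<Prod>k = 1..m. if qubit_bit m i k = qubit_bit m j k then 1 else 0 :: complex) = 0"
      by (intro prod_zero) auto
    then show ?thesis using e False ij by simp
  qed (use e ij in simp)
qed (auto simp: tensor_ops_def)

lemma tensor_ops_cong: "(\<And>k. k \<in> {1..m} \<Longrightarrow> A k = B k) \<Longrightarrow> tensor_ops m A = tensor_ops m B"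
  by (simp add: tensor_ops_def)

text \<open>Starting from identities in all slots, the factors are filled in one qubit at a time.
  This brings the rotation layer under the results on gate lists.\<close>

lemma tensor_ops_eq_gate_prod: "tensor_ops m A = gate_prod m (map (\<lambda>k. ([k], A k)) [1..<Suc m])"
proof -
  have "gate_prod m (map (\<lambda>k. ([k], A k)) ks) = tensor_ops m (\<lambda>k. if k \<in> set ks then A k else 1\<^sub>m 2)"
    if "distinct ks" "set ks \<subseteq> {1..m}" for ks
    using that
  proof (induction ks)
    case (Cons k ks)
    have "gate_prod m (map (\<lambda>k. ([k], A k)) (k # ks)) = embed_op m [k] (A k) * tensor_ops m (\<lambda>k. if k \<in> set ks then A k else 1\<^sub>m 2)"
      using Cons by (simp add: gate_prod_Cons)
    also have "\<dots> = tensor_ops m ((\<lambda>k. if k \<in> set ks then A k else 1\<^sub>m 2)(k := A k))"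
      by (rule embed_op_mult_tensor_ops) (use Cons.prems in auto)
    also have "(\<lambda>k. if k \<in> set ks then A k else 1\<^sub>m 2)(k := A k) = (\<lambda>k'. if k' \<in> set (k # ks) then A k' else 1\<^sub>m 2)"
      using Cons.prems by auto
    finally show ?case .
  qed (simp add: gate_prod_Nil tensor_ops_one)
  from this[of "[1..<Suc m]"] show ?thesis
    by (simp add: atLeastLessThanSuc_atLeastAtMost del: upt_Suc) (rule tensor_ops_cong, simp)
qed

lemma tensor_ops_carrier [simp]: "tensor_ops m A \<in> carrier_mat (2 ^ m) (2 ^ m)"
  by (simp add: tensor_ops_def)

lemma involution_combination_mult:
  fixes G :: "complex mat"
  assumes G: "G \<in> carrier_mat n n" and GG: "G * G = 1\<^sub>m n"
  shows "(a \<cdot>\<^sub>m 1\<^sub>m n + b \<cdot>\<^sub>m G) * (c \<cdot>\<^sub>m 1\<^sub>m n + d \<cdot>\<^sub>m G) = (a * c + b * d) \<cdot>\<^sub>m 1\<^sub>m n + (a * d + b * c) \<cdot>\<^sub>m G"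
proof (rule eq_matI)
  fix i j assume "i < dim_row ((a * c + b * d) \<cdot>\<^sub>m 1\<^sub>m n + (a * d + b * c) \<cdot>\<^sub>m G)"
    "j < dim_col ((a * c + b * d) \<cdot>\<^sub>m 1\<^sub>m n + (a * d + b * c) \<cdot>\<^sub>m G)"
  then have ij: "i < n" "j < n" using G by auto
  have g: "(\<Sum>l<n. G $$ (i, l) * G $$ (l, j)) = (if i = j then 1 else 0)"
    using index_mult_mat_sum[OF G G ij] GG ij by simp
  have "((a \<cdot>\<^sub>m 1\<^sub>m n + b \<cdot>\<^sub>m G) * (c \<cdot>\<^sub>m 1\<^sub>m n + d \<cdot>\<^sub>m G)) $$ (i, j)
     = (\<Sum>l<n. (a * (if i = l then 1 else 0) + b * G $$ (i, l)) * (c * (if l = j then 1 else 0) + d * G $$ (l, j)))"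
    using ij G by (subst index_mult_mat_sum[of _ n n _ n]) auto
  also have "\<dots> = (\<Sum>l<n. (if i = l then a * c * (if l = j then 1 else 0) + a * d * G $$ (l, j) else 0)
      + (if l = j then b * c * G $$ (i, l) else 0) + b * d * (G $$ (i, l) * G $$ (l, j)))"
    by (intro sum.cong refl) (simp add: algebra_simps)
  also have "\<dots> = a * c * (if i = j then 1 else 0) + a * d * G $$ (i, j) + b * c * G $$ (i, j) + b * d * (if i = j then 1 else 0)"
    using ij by (simp add: sum.distrib sum.delta' sum.delta g flip: sum_distrib_left)
  finally show "((a \<cdot>\<^sub>m 1\<^sub>m n + b \<cdot>\<^sub>m G) * (c \<cdot>\<^sub>m 1\<^sub>m n + d \<cdot>\<^sub>m G)) $$ (i, j)
     = ((a * c + b * d) \<cdot>\<^sub>m 1\<^sub>m n + (a * d + b * c) \<cdot>\<^sub>m G) $$ (i, j)"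
    using ij G by (simp add: algebra_simps)
qed (use G in auto)

lemma mat_exp_involution:
  fixes G :: "complex mat"
  assumes G: "G \<in> carrier_mat n n" and GG: "G * G = 1\<^sub>m n"
  shows "mat_exp ((- \<i> * complex_of_real t) \<cdot>\<^sub>m G)
    = complex_of_real (cos t) \<cdot>\<^sub>m 1\<^sub>m n + (- \<i> * complex_of_real (sin t)) \<cdot>\<^sub>m G"
proof (rule eq_matI)
  define z where "z = - \<i> * complex_of_real t"
  fix i j assume "i < dim_row (complex_of_real (cos t) \<cdot>\<^sub>m 1\<^sub>m n + (- \<i> * complex_of_real (sin t)) \<cdot>\<^sub>m G)"
    "j < dim_col (complex_of_real (cos t) \<cdot>\<^sub>m 1\<^sub>m n + (- \<i> * complex_of_real (sin t)) \<cdot>\<^sub>m G)"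
  then have ij: "i < n" "j < n" using G by auto
  define \<delta> :: complex where "\<delta> = (if i = j then 1 else 0)"
  have ss: "a \<cdot>\<^sub>m (b \<cdot>\<^sub>m M) = (a * b) \<cdot>\<^sub>m M" for a b and M :: "complex mat"
    by (rule eq_matI) auto
  have pow: "(z \<cdot>\<^sub>m G) ^\<^sub>m p = (if even p then z ^ p \<cdot>\<^sub>m 1\<^sub>m n else z ^ p \<cdot>\<^sub>m G)" for p
  proof (induction p)
    case 0
    show ?case using G by (intro eq_matI) auto
  next
    case (Suc p)
    then show ?case
      using G by (auto simp: mult_smult_distrib[of _ n n _ n] mult_smult_assoc_mat[of _ n n _ n] GG ss mult.commute)
  qed
  \<comment> \<open>The two weights are the entries of the spectral projections (1 + G) / 2 and (1 -
    G) / 2, so the matrix series splits into two scalar exponential series.\<close>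
  have e: "((z \<cdot>\<^sub>m G) ^\<^sub>m p) $$ (i, j) / of_nat (fact p)
      = (\<delta> + G $$ (i, j)) / 2 * (z ^ p /\<^sub>R fact p) + (\<delta> - G $$ (i, j)) / 2 * ((- z) ^ p /\<^sub>R fact p)" for p
    unfolding pow using ij G by (auto simp: \<delta>_def scaleR_conv_of_real field_simps)
  have s: "(\<lambda>p. ((z \<cdot>\<^sub>m G) ^\<^sub>m p) $$ (i, j) / of_nat (fact p)) sums
      ((\<delta> + G $$ (i, j)) / 2 * exp z + (\<delta> - G $$ (i, j)) / 2 * exp (- z))"
    unfolding e by (intro sums_add sums_mult exp_converges)
  have ez: "exp z = complex_of_real (cos t) - \<i> * complex_of_real (sin t)"
    using cis_conv_exp[of "- t"] by (simp add: z_def cis.code complex_eq_iff)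
  have ez': "exp (- z) = complex_of_real (cos t) + \<i> * complex_of_real (sin t)"
    using cis_conv_exp[of t] by (simp add: z_def complex_eq_iff)
  have "mat_exp (z \<cdot>\<^sub>m G) $$ (i, j) = (\<delta> + G $$ (i, j)) / 2 * exp z + (\<delta> - G $$ (i, j)) / 2 * exp (- z)"
    using sums_unique[OF s] ij G by (simp add: mat_exp_def)
  also have "\<dots> = complex_of_real (cos t) * \<delta> + (- \<i> * complex_of_real (sin t)) * G $$ (i, j)"
    unfolding ez ez' by (simp add: field_simps)
  finally show "mat_exp ((- \<i> * complex_of_real t) \<cdot>\<^sub>m G) $$ (i, j)
    = (complex_of_real (cos t) \<cdot>\<^sub>m 1\<^sub>m n + (- \<i> * complex_of_real (sin t)) \<cdot>\<^sub>m G) $$ (i, j)"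
    using ij G by (simp add: z_def \<delta>_def)
qed (use G in \<open>auto simp: mat_exp_def\<close>)

lemma unitary_rotation:
  fixes G :: "complex mat"
  assumes G: "G \<in> carrier_mat n n" "hermitian_mat G" and GG: "G * G = 1\<^sub>m n"
  shows "unitary_mat (complex_of_real (cos t) \<cdot>\<^sub>m 1\<^sub>m n + (- \<i> * complex_of_real (sin t)) \<cdot>\<^sub>m G)"
proof (rule unitary_matI[of _ n])
  let ?U = "complex_of_real (cos t) \<cdot>\<^sub>m 1\<^sub>m n + (- \<i> * complex_of_real (sin t)) \<cdot>\<^sub>m G"
  let ?V = "complex_of_real (cos t) \<cdot>\<^sub>m 1\<^sub>m n + (\<i> * complex_of_real (sin t)) \<cdot>\<^sub>m G"
  show U: "?U \<in> carrier_mat n n" using G by simp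
  have Gc: "cnj (G $$ (j, i)) = G $$ (i, j)" if "i < n" "j < n" for i j
    using G(2) index_mat_adjoint[OF G(1) that] by (simp add: hermitian_mat_def)
  have adj: "mat_adjoint ?U = ?V"
  proof (rule eq_matI)
    fix i j assume "i < dim_row ?V" "j < dim_col ?V"
    then have ij: "i < n" "j < n" using G by auto
    then show "mat_adjoint ?U $$ (i, j) = ?V $$ (i, j)"
      using G Gc by (subst index_mat_adjoint[OF U]) auto
  qed (use G mat_adjoint_carrier[OF U] in auto)
  have one: "complex_of_real (cos t) * complex_of_real (cos t) + complex_of_real (sin t) * complex_of_real (sin t) = 1"
    by (metis of_real_1 of_real_add of_real_mult power2_eq_square sin_cos_squared_add2)
  have fin: "1 \<cdot>\<^sub>m 1\<^sub>m n + 0 \<cdot>\<^sub>m G = 1\<^sub>m n" by (rule eq_matI) (use G in auto)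
  have two: "\<i> * complex_of_real (sin t) * (- \<i> * complex_of_real (sin t)) = complex_of_real (sin t) * complex_of_real (sin t)"
    "- \<i> * complex_of_real (sin t) * (\<i> * complex_of_real (sin t)) = complex_of_real (sin t) * complex_of_real (sin t)"
    by (simp_all add: complex_eq_iff)
  show "mat_adjoint ?U * ?U = 1\<^sub>m n" "?U * mat_adjoint ?U = 1\<^sub>m n"
    unfolding adj involution_combination_mult[OF G(1) GG] two one by (simp_all add: fin)
qed


section \<open>The circuit\<close>

lemma param_index_in: "k \<in> {1..qubits Q} \<Longrightarrow> l \<in> {1..layers Q} \<Longrightarrow> param_index Q l k \<in> param_indices Q"
proof -
  assume k: "k \<in> {1..qubits Q}" and l: "l \<in> {1..layers Q}"
  have "qubits Q * (l - 1) + k \<le> qubits Q * (l - 1) + qubits Q" using k by simp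
  also have "\<dots> = qubits Q * l" using l by (cases l) auto
  also have "\<dots> \<le> qubits Q * layers Q" using l by simp
  finally show ?thesis using k by (simp add: param_index_def param_indices_def mult.commute)
qed

lemma param_index_inj:
  assumes "k \<in> {1..qubits Q}" "k' \<in> {1..qubits Q}" "1 \<le> l" "1 \<le> l'" "param_index Q l k = param_index Q l' k'"
  shows "l = l' \<and> k = k'"
proof -
  have e: "qubits Q * (l - 1) + (k - 1) = qubits Q * (l' - 1) + (k' - 1)"
    using assms by (simp add: param_index_def)
  have b: "k - 1 < qubits Q" "k' - 1 < qubits Q" using assms by auto
  have "l - 1 = l' - 1" using arg_cong[OF e, of "\<lambda>a. a div qubits Q"] b by simp
  moreover have "k - 1 = k' - 1" using arg_cong[OF e, of "\<lambda>a. a mod qubits Q"] b by simp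
  ultimately show ?thesis using assms by auto
qed

lemma param_index_surj:
  assumes "i \<in> param_indices Q" and m: "1 \<le> qubits Q"
  obtains l k where "l \<in> {1..layers Q}" "k \<in> {1..qubits Q}" "i = param_index Q l k"
proof
  have i: "1 \<le> i" "i \<le> layers Q * qubits Q" using assms by (auto simp: param_indices_def)
  have "(i - 1) div qubits Q < layers Q" using i m by (simp add: div_less_iff_less_mult)
  then show "(i - 1) div qubits Q + 1 \<in> {1..layers Q}" by simp
  show "(i - 1) mod qubits Q + 1 \<in> {1..qubits Q}" using m by (simp add: Suc_leI)
  show "i = param_index Q ((i - 1) div qubits Q + 1) ((i - 1) mod qubits Q + 1)"
    using i by (simp add: param_index_def)
qed

lemma W_op_rotation:
  assumes Q: "valid_circuit Q" and i: "i \<in> param_indices Q"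
  shows "W_op Q i t = complex_of_real (cos t) \<cdot>\<^sub>m 1\<^sub>m 2 + (- \<i> * complex_of_real (sin t)) \<cdot>\<^sub>m generator Q i"
proof -
  have G: "generator Q i \<in> carrier_mat 2 2" "inverts_mat (generator Q i) (generator Q i)"
    using Q i by (auto simp: valid_circuit_def)
  then have "generator Q i * generator Q i = 1\<^sub>m 2" by (simp add: inverts_mat_def)
  then show ?thesis unfolding W_op_def by (rule mat_exp_involution[OF G(1)])
qed

lemma valid_W_gate:
  assumes Q: "valid_circuit Q" and k: "k \<in> {1..qubits Q}" and i: "i \<in> param_indices Q"
  shows "valid_gate (qubits Q) ([k], W_op Q i t)"
proof -
  have G: "generator Q i \<in> carrier_mat 2 2" "hermitian_mat (generator Q i)" "inverts_mat (generator Q i) (generator Q i)"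
    using Q i by (auto simp: valid_circuit_def)
  then have GG: "generator Q i * generator Q i = 1\<^sub>m 2" by (simp add: inverts_mat_def)
  show ?thesis using k unitary_rotation[OF G(1,2) GG, of t] G(1)
    by (simp add: valid_gate_def W_op_rotation[OF Q i])
qed

definition V_gates :: "'x qnn \<Rightarrow> nat \<Rightarrow> 'x \<Rightarrow> (nat list \<times> complex mat) list" where
  "V_gates Q l x = map (\<lambda>ks. (ks, gate Q l ks x)) (placement Q l)"

definition W_gates :: "'x qnn \<Rightarrow> nat \<Rightarrow> params \<Rightarrow> (nat list \<times> complex mat) list" where
  "W_gates Q l \<theta> = map (\<lambda>k. ([k], W_op Q (param_index Q l k) (\<theta> (param_index Q l k)))) [1..<Suc (qubits Q)]"

lemma layer_op_eq: "layer_op Q l \<theta> x = gate_prod (qubits Q) (V_gates Q l x) * gate_prod (qubits Q) (W_gates Q l \<theta>)"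
  by (simp add: layer_op_def V_op_def tensor_ops_eq_gate_prod V_gates_def W_gates_def gate_prod_def foldr_map comp_def del: upt_Suc)

lemma V_op_eq: "V_op Q l x = gate_prod (qubits Q) (V_gates Q l x)"
  by (simp add: V_op_def V_gates_def gate_prod_def foldr_map comp_def)

lemma layer_op_carrier [simp]: "layer_op Q l \<theta> x \<in> carrier_mat (2 ^ qubits Q) (2 ^ qubits Q)"
  by (simp add: layer_op_eq mult_carrier_mat[OF gate_prod_carrier gate_prod_carrier])

lemma circuit_upto_carrier [simp]: "circuit_upto Q l \<theta> x \<in> carrier_mat (2 ^ qubits Q) (2 ^ qubits Q)"
  by (induction l) (auto intro!: mult_carrier_mat[OF layer_op_carrier])

lemma valid_V_gates:
  assumes Q: "valid_circuit Q" and l: "l \<in> {1..layers Q}" and g: "g \<in> set (V_gates Q l x)"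
  shows "valid_gate (qubits Q) g \<and> length (fst g) \<le> 2"
proof -
  obtain ks where ks: "ks \<in> set (placement Q l)" "g = (ks, gate Q l ks x)" using g by (auto simp: V_gates_def)
  have d: "distinct (concat (placement Q l))" and
    v: "length ks \<in> {1, 2}" "set ks \<subseteq> {1..qubits Q}"
      "gate Q l ks x \<in> carrier_mat (2 ^ length ks) (2 ^ length ks)" "unitary_mat (gate Q l ks x)"
    using Q l ks(1) unfolding valid_circuit_def by blast+
  have "distinct ks" using d ks(1) by (simp add: distinct_concat_iff)
  then show ?thesis using v ks(2) by (auto simp: valid_gate_def)
qed

lemma valid_W_gates:
  assumes Q: "valid_circuit Q" and l: "l \<in> {1..layers Q}" and g: "g \<in> set (W_gates Q l \<theta>)"
  shows "valid_gate (qubits Q) g"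
  using g valid_W_gate[OF Q _ param_index_in] l by (auto simp: W_gates_def simp del: upt_Suc)

lemma unitary_circuit_upto:
  assumes Q: "valid_circuit Q" and "l \<le> layers Q"
  shows "unitary_mat (circuit_upto Q l \<theta> x)"
  using assms(2)
proof (induction l)
  case (Suc l)
  then have l: "Suc l \<in> {1..layers Q}" by simp
  have "unitary_mat (layer_op Q (Suc l) \<theta> x)"
    unfolding layer_op_eq using valid_V_gates[OF Q l] valid_W_gates[OF Q l]
    by (intro unitary_mult[OF gate_prod_carrier _ gate_prod_carrier] unitary_gate_prod) blast+
  then show ?case using Suc by (simp add: unitary_mult[OF layer_op_carrier _ circuit_upto_carrier])
qed (simp add: unitary_one)

lemma f_local_eq:
  "f_local Q k \<theta> x = Re (conj_op (circuit Q \<theta> x) (embed_op (qubits Q) [k] (observable Q k)) $$ (0, 0))"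
  by (simp add: f_local_def conj_op_def)

section \<open>Light cones\<close>

lemma interacting_subset:
  assumes "valid_circuit Q" "l \<in> {1..layers Q}" "k \<in> {1..qubits Q}"
  shows "interacting Q l k \<subseteq> {1..qubits Q}"
  using assms unfolding valid_circuit_def interacting_def by blast

lemma light_cone_rec_subset:
  assumes Q: "valid_circuit Q" and k: "k \<in> {1..qubits Q}"
  shows "j < layers Q \<Longrightarrow> light_cone_rec Q k j \<subseteq> {1..qubits Q}"
proof (induction j)
  case 0
  then show ?case using interacting_subset[OF Q _ k, of "layers Q"] by simp
next
  case (Suc j)
  then show ?case using interacting_subset[OF Q, of "layers Q - Suc j"] by fastforce
qed

lemma light_cone_subset:
  assumes "valid_circuit Q" "k \<in> {1..qubits Q}" "l \<in> {1..layers Q}"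
  shows "light_cone Q l k \<subseteq> {1..qubits Q}"
  unfolding light_cone_def by (rule light_cone_rec_subset) (use assms in auto)

lemma light_cone_step:
  assumes "1 \<le> l" "Suc l \<le> layers Q"
  shows "light_cone Q l k = (\<Union>k'\<in>light_cone Q (Suc l) k. interacting Q l k')"
proof -
  have "layers Q - l = Suc (layers Q - Suc l)" "layers Q - Suc (layers Q - Suc l) = l" using assms by auto
  then show ?thesis by (simp add: light_cone_def)
qed

lemma past_cone_subset:
  assumes "valid_circuit Q" "k \<in> {1..qubits Q}"
  shows "past_cone Q k \<subseteq> param_indices Q"
  unfolding past_cone_def using light_cone_subset[OF assms] param_index_in by blast

text \<open>Conjugation meets the gates of \<open>V_op\<close> before the rotations of the same
  layer. The support therefore spreads first, and it is the enlarged set that decides which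
  rotations of this layer matter; accordingly the cone at a layer already includes the interactions
  in that layer.\<close>

lemma conj_op_layer_supported:
  assumes Q: "valid_circuit Q" and l: "l \<in> {1..layers Q}" and A: "supported (qubits Q) T A"
    and S: "(\<Union>k'\<in>T. interacting Q l k') \<subseteq> S"
    and eq: "\<And>k'. k' \<in> S \<Longrightarrow> \<theta> (param_index Q l k') = \<theta>' (param_index Q l k')"
  shows "supported (qubits Q) S (conj_op (layer_op Q l \<theta> x) A)"
    and "conj_op (layer_op Q l \<theta> x) A = conj_op (layer_op Q l \<theta>' x) A"
proof -
  let ?m = "qubits Q"
  let ?A = "conj_op (gate_prod ?m (V_gates Q l x)) A"
  have e: "conj_op (layer_op Q l \<theta> x) A = conj_op (gate_prod ?m (W_gates Q l \<theta>)) ?A" for \<theta>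
    unfolding layer_op_eq by (rule conj_op_mult[OF gate_prod_carrier gate_prod_carrier supported_carrier[OF A]])
  have "distinct (concat (map fst (V_gates Q l x)))"
    using Q l unfolding valid_circuit_def by (simp add: V_gates_def comp_def)
  from supported_conj_op_gates[OF valid_V_gates[OF Q l] this A]
  have "supported ?m (T \<union> \<Union>{set (fst g) |g. g \<in> set (V_gates Q l x) \<and> set (fst g) \<inter> T \<noteq> {}}) ?A" .
  then have A': "supported ?m S ?A"
  proof (rule supported_mono, intro subsetI)
    fix q assume "q \<in> T \<union> \<Union>{set (fst g) |g. g \<in> set (V_gates Q l x) \<and> set (fst g) \<inter> T \<noteq> {}}"
    then consider "q \<in> T" | ks k where "ks \<in> set (placement Q l)" "k \<in> set ks" "k \<in> T" "q \<in> set ks"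
      by (auto simp: V_gates_def)
    then show "q \<in> S"
    proof cases
      case 1 then show ?thesis using S by (auto simp: interacting_def)
    next
      case 2
      \<comment> \<open>\<open>interacting\<close> counts two-qubit gates only; a one-qubit gate
        adds nothing, as its sole qubit already lies in \<open>T\<close>.\<close>
      have "length ks \<in> {1, 2}" using Q l 2(1) unfolding valid_circuit_def by blast
      then show ?thesis
      proof (elim insertE)
        assume "length ks = 1"
        then have "q = k" using 2 by (cases ks) auto
        then show ?thesis using S 2 by (auto simp: interacting_def)
      next
        assume "length ks = 2"
        then have "q \<in> interacting Q l k" using 2 by (auto simp: interacting_def)
        then show ?thesis using S 2 by blast
      qed simp
    qed
  qed
  have "conj_op (gate_prod ?m (W_gates Q l \<theta>)) ?A = conj_op (gate_prod ?m (W_gates Q l \<theta>')) ?A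
      \<and> supported ?m S (conj_op (gate_prod ?m (W_gates Q l \<theta>)) ?A)"
    unfolding W_gates_def
    by (rule conj_op_single_qubit_gates[OF _ _ A'])
       (use valid_W_gate[OF Q _ param_index_in] l eq in \<open>auto simp del: upt_Suc\<close>)
  then show "supported ?m S (conj_op (layer_op Q l \<theta> x) A)"
    and "conj_op (layer_op Q l \<theta> x) A = conj_op (layer_op Q l \<theta>' x) A"
    unfolding e by blast+
qed

text \<open>Layers are peeled off from the last one. The operator and its support vary in the
  induction; the invariant is that the next spreading step stays inside the light cone. It is
  guarded by \<open>1 \<le> l\<close> because there is no layer 0.\<close>

lemma conj_op_circuit_upto_cong:
  assumes Q: "valid_circuit Q" and eq: "\<And>i. i \<in> past_cone Q k \<Longrightarrow> \<theta> i = \<theta>' i"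
  shows "l \<le> layers Q \<Longrightarrow> supported (qubits Q) T A \<Longrightarrow> (1 \<le> l \<Longrightarrow> (\<Union>k'\<in>T. interacting Q l k') \<subseteq> light_cone Q l k) \<Longrightarrow>
    conj_op (circuit_upto Q l \<theta> x) A = conj_op (circuit_upto Q l \<theta>' x) A"
proof (induction l arbitrary: T A)
  case (Suc l)
  have l: "Suc l \<in> {1..layers Q}" using Suc.prems(1) by simp
  have T: "(\<Union>k'\<in>T. interacting Q (Suc l) k') \<subseteq> light_cone Q (Suc l) k" using Suc.prems(3) by simp
  have eq': "\<theta> (param_index Q (Suc l) k') = \<theta>' (param_index Q (Suc l) k')" if "k' \<in> light_cone Q (Suc l) k" for k'
    by (rule eq) (use that l in \<open>auto simp: past_cone_def\<close>)
  note c = conj_op_layer_supported[where \<theta> = \<theta> and \<theta>' = \<theta>' and x = x, OF Q l Suc.prems(2) T eq']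
  have "conj_op (circuit_upto Q l \<theta> x) (conj_op (layer_op Q (Suc l) \<theta> x) A) = conj_op (circuit_upto Q l \<theta>' x) (conj_op (layer_op Q (Suc l) \<theta> x) A)"
  proof (rule Suc.IH[OF _ c(1)])
    show "(\<Union>k'\<in>light_cone Q (Suc l) k. interacting Q l k') \<subseteq> light_cone Q l k" if "1 \<le> l"
      by (rule equalityD2[OF light_cone_step[OF that Suc.prems(1)]])
  qed (use Suc.prems in auto)
  then show ?case
    using conj_op_mult[OF layer_op_carrier circuit_upto_carrier supported_carrier[OF Suc.prems(2)]] c(2)
    by simp
qed simp

lemma f_local_cong:
  assumes Q: "valid_circuit Q" and k: "k \<in> {1..qubits Q}" and eq: "\<And>i. i \<in> past_cone Q k \<Longrightarrow> \<theta> i = \<theta>' i"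
  shows "f_local Q k \<theta> x = f_local Q k \<theta>' x"
proof -
  have "conj_op (circuit_upto Q (layers Q) \<theta> x) (embed_op (qubits Q) [k] (observable Q k))
      = conj_op (circuit_upto Q (layers Q) \<theta>' x) (embed_op (qubits Q) [k] (observable Q k))"
    by (rule conj_op_circuit_upto_cong[OF Q eq, where k = k and T = "set [k]"])
       (use k in \<open>auto simp: light_cone_def intro!: supported_embed_op[of "[k]", simplified]\<close>)
  then show ?thesis by (simp add: f_local_eq circuit_def)
qed


section \<open>Dependence on a single parameter\<close>

text \<open>The dependence of a circuit matrix on one angle, before expectation values are taken.
  The circuit enters an expectation value twice, which doubles the frequency and leads to
  \<open>trig_poly\<close>.\<close>

definition rotating :: "nat \<Rightarrow> (real \<Rightarrow> complex mat) \<Rightarrow> bool" where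
  "rotating n F \<longleftrightarrow> (\<exists>X\<in>carrier_mat n n. \<exists>Y\<in>carrier_mat n n. \<forall>s.
     F s = complex_of_real (cos s) \<cdot>\<^sub>m X + complex_of_real (sin s) \<cdot>\<^sub>m Y)"

lemma rotating_mult_left:
  assumes "rotating n F" and A: "A \<in> carrier_mat n n" shows "rotating n (\<lambda>s. A * F s)"
proof -
  obtain X Y where X: "X \<in> carrier_mat n n" and Y: "Y \<in> carrier_mat n n"
    and F: "\<And>s. F s = complex_of_real (cos s) \<cdot>\<^sub>m X + complex_of_real (sin s) \<cdot>\<^sub>m Y"
    using assms unfolding rotating_def by blast
  have "A * F s = complex_of_real (cos s) \<cdot>\<^sub>m (A * X) + complex_of_real (sin s) \<cdot>\<^sub>m (A * Y)" for s
    unfolding F using X Y A by (simp add: mult_add_distrib_mat[of A n n _ n] mult_smult_distrib[of A n n _ n])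
  then show ?thesis unfolding rotating_def using A X Y by (blast intro: mult_carrier_mat)
qed

lemma rotating_mult_right:
  assumes "rotating n F" and A: "A \<in> carrier_mat n n" shows "rotating n (\<lambda>s. F s * A)"
proof -
  obtain X Y where X: "X \<in> carrier_mat n n" and Y: "Y \<in> carrier_mat n n"
    and F: "\<And>s. F s = complex_of_real (cos s) \<cdot>\<^sub>m X + complex_of_real (sin s) \<cdot>\<^sub>m Y"
    using assms unfolding rotating_def by blast
  have "F s * A = complex_of_real (cos s) \<cdot>\<^sub>m (X * A) + complex_of_real (sin s) \<cdot>\<^sub>m (Y * A)" for s
    unfolding F using X Y A by (simp add: add_mult_distrib_mat[of _ n n] mult_smult_assoc_mat[of _ n n])
  then show ?thesis unfolding rotating_def using A X Y by (blast intro: mult_carrier_mat)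
qed

lemma tensor_ops_linear:
  assumes k: "k \<in> {1..m}" and X: "X \<in> carrier_mat 2 2" and Y: "Y \<in> carrier_mat 2 2"
  shows "tensor_ops m (A(k := a \<cdot>\<^sub>m X + b \<cdot>\<^sub>m Y)) = a \<cdot>\<^sub>m tensor_ops m (A(k := X)) + b \<cdot>\<^sub>m tensor_ops m (A(k := Y))"
proof (rule eq_matI)
  fix i j assume "i < dim_row (a \<cdot>\<^sub>m tensor_ops m (A(k := X)) + b \<cdot>\<^sub>m tensor_ops m (A(k := Y)))"
    "j < dim_col (a \<cdot>\<^sub>m tensor_ops m (A(k := X)) + b \<cdot>\<^sub>m tensor_ops m (A(k := Y)))"
  then have ij: "i < 2 ^ m" "j < 2 ^ m" by (auto simp: tensor_ops_def)
  define r where "r = (\<Prod>k'\<in>{1..m} - {k}. A k' $$ (qubit_bit m i k', qubit_bit m j k'))"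
  have e: "tensor_ops m (A(k := B)) $$ (i, j) = B $$ (qubit_bit m i k, qubit_bit m j k) * r" for B
  proof -
    have "tensor_ops m (A(k := B)) $$ (i, j) = (\<Prod>k' = 1..m. (A(k := B)) k' $$ (qubit_bit m i k', qubit_bit m j k'))"
      using ij by (simp add: tensor_ops_def)
    also have "\<dots> = (A(k := B)) k $$ (qubit_bit m i k, qubit_bit m j k)
        * (\<Prod>k'\<in>{1..m} - {k}. (A(k := B)) k' $$ (qubit_bit m i k', qubit_bit m j k'))"
      by (rule prod.remove) (use k in auto)
    also have "(\<Prod>k'\<in>{1..m} - {k}. (A(k := B)) k' $$ (qubit_bit m i k', qubit_bit m j k')) = r"
      unfolding r_def by (rule prod.cong) auto
    finally show ?thesis unfolding fun_upd_same .
  qed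
  show "tensor_ops m (A(k := a \<cdot>\<^sub>m X + b \<cdot>\<^sub>m Y)) $$ (i, j)
      = (a \<cdot>\<^sub>m tensor_ops m (A(k := X)) + b \<cdot>\<^sub>m tensor_ops m (A(k := Y))) $$ (i, j)"
    using ij X Y qubit_bit_less by (simp add: e carrier_matD[OF tensor_ops_carrier] algebra_simps)
qed (auto simp: tensor_ops_def)

lemma layer_op_other:
  assumes "l' \<noteq> l" "1 \<le> l" "1 \<le> l'" "k \<in> {1..qubits Q}"
  shows "layer_op Q l' (\<theta>(param_index Q l k := s)) x = layer_op Q l' \<theta> x"
  unfolding layer_op_def
  by (intro arg_cong2[where f = "(*)"] refl tensor_ops_cong) (use param_index_inj[of _ Q k l' l] assms in auto)

lemma rotating_layer_op:
  assumes Q: "valid_circuit Q" and l: "l \<in> {1..layers Q}" and k: "k \<in> {1..qubits Q}"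
  shows "rotating (2 ^ qubits Q) (\<lambda>s. layer_op Q l (\<theta>(param_index Q l k := s)) x)"
proof -
  let ?i = "param_index Q l k" and ?m = "qubits Q"
  define A where "A k' = W_op Q (param_index Q l k') (\<theta> (param_index Q l k'))" for k'
  define G where "G = (- \<i>) \<cdot>\<^sub>m generator Q ?i"
  have i: "?i \<in> param_indices Q" by (rule param_index_in[OF k l])
  have G: "G \<in> carrier_mat 2 2" using Q i by (auto simp: valid_circuit_def G_def)
  have ss: "(- \<i> * complex_of_real (sin s)) \<cdot>\<^sub>m generator Q ?i = complex_of_real (sin s) \<cdot>\<^sub>m G" for s
    unfolding G_def by (rule eq_matI) auto
  have "tensor_ops ?m (\<lambda>k'. W_op Q (param_index Q l k') ((\<theta>(?i := s)) (param_index Q l k')))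
     = complex_of_real (cos s) \<cdot>\<^sub>m tensor_ops ?m (A(k := 1\<^sub>m 2)) + complex_of_real (sin s) \<cdot>\<^sub>m tensor_ops ?m (A(k := G))" for s
  proof -
    have "tensor_ops ?m (\<lambda>k'. W_op Q (param_index Q l k') ((\<theta>(?i := s)) (param_index Q l k'))) = tensor_ops ?m (A(k := W_op Q ?i s))"
      by (rule tensor_ops_cong) (use param_index_inj[of _ Q k l l] k l in \<open>auto simp: A_def\<close>)
    also have "W_op Q ?i s = complex_of_real (cos s) \<cdot>\<^sub>m 1\<^sub>m 2 + complex_of_real (sin s) \<cdot>\<^sub>m G"
      by (simp only: W_op_rotation[OF Q i] ss)
    finally show ?thesis by (simp only: tensor_ops_linear[OF k one_carrier_mat G])
  qed
  then have "rotating (2 ^ ?m) (\<lambda>s. tensor_ops ?m (\<lambda>k'. W_op Q (param_index Q l k') ((\<theta>(?i := s)) (param_index Q l k'))))"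
    unfolding rotating_def by (blast intro: tensor_ops_carrier)
  then show ?thesis unfolding layer_op_def by (rule rotating_mult_left) (simp add: V_op_eq)
qed

lemma circuit_upto_before:
  assumes "1 \<le> l" "k \<in> {1..qubits Q}"
  shows "j < l \<Longrightarrow> circuit_upto Q j (\<theta>(param_index Q l k := s)) x = circuit_upto Q j \<theta> x"
  by (induction j) (use assms in \<open>auto simp: layer_op_other\<close>)

text \<open>By injectivity of the parameter index, an angle occurs in one layer only; all other
  layers are constant factors on the left or on the right.\<close>

lemma rotating_circuit_upto:
  assumes Q: "valid_circuit Q" and l: "1 \<le> l" and k: "k \<in> {1..qubits Q}"
  shows "l \<le> j \<Longrightarrow> j \<le> layers Q \<Longrightarrow> rotating (2 ^ qubits Q) (\<lambda>s. circuit_upto Q j (\<theta>(param_index Q l k := s)) x)"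
proof (induction j)
  case (Suc j)
  show ?case
  proof (cases "l = Suc j")
    case True
    have "rotating (2 ^ qubits Q) (\<lambda>s. layer_op Q l (\<theta>(param_index Q l k := s)) x)"
      by (rule rotating_layer_op[OF Q _ k]) (use l True Suc.prems in auto)
    then have "rotating (2 ^ qubits Q) (\<lambda>s. layer_op Q l (\<theta>(param_index Q l k := s)) x * circuit_upto Q j \<theta> x)"
      by (rule rotating_mult_right) simp
    moreover have "circuit_upto Q (Suc j) (\<theta>(param_index Q l k := s)) x
        = layer_op Q l (\<theta>(param_index Q l k := s)) x * circuit_upto Q j \<theta> x" for s
      using circuit_upto_before[OF l k, of j] True by (metis circuit_upto.simps(2) lessI)
    ultimately show ?thesis by (simp only:)
  next
    case False
    then have "rotating (2 ^ qubits Q) (\<lambda>s. circuit_upto Q j (\<theta>(param_index Q l k := s)) x)"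
      by (intro Suc.IH) (use Suc.prems in simp_all)
    then have "rotating (2 ^ qubits Q) (\<lambda>s. layer_op Q (Suc j) \<theta> x * circuit_upto Q j (\<theta>(param_index Q l k := s)) x)"
      by (rule rotating_mult_left) simp
    moreover have "circuit_upto Q (Suc j) (\<theta>(param_index Q l k := s)) x
        = layer_op Q (Suc j) \<theta> x * circuit_upto Q j (\<theta>(param_index Q l k := s)) x" for s
      unfolding circuit_upto.simps by (subst layer_op_other) (use False l k in auto)
    ultimately show ?thesis by (simp only:)
  qed
qed (use l in simp)

lemma index_conj_op:
  assumes U: "U \<in> carrier_mat n n" and A: "A \<in> carrier_mat n n" and n: "0 < n"
  shows "conj_op U A $$ (0, 0) = (\<Sum>q<n. \<Sum>p<n. cnj (U $$ (p, 0)) * A $$ (p, q) * U $$ (q, 0))"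
proof -
  note U' = mat_adjoint_carrier[OF U]
  have "conj_op U A $$ (0, 0) = (\<Sum>q<n. (mat_adjoint U * A) $$ (0, q) * U $$ (q, 0))"
    unfolding conj_op_def by (rule index_mult_mat_sum[OF mult_carrier_mat[OF U' A] U n n])
  also have "\<dots> = (\<Sum>q<n. \<Sum>p<n. cnj (U $$ (p, 0)) * A $$ (p, q) * U $$ (q, 0))"
  proof (rule sum.cong)
    fix q assume "q \<in> {..<n}"
    then have "(mat_adjoint U * A) $$ (0, q) = (\<Sum>p<n. mat_adjoint U $$ (0, p) * A $$ (p, q))"
      using index_mult_mat_sum[OF U' A n] by simp
    then show "(mat_adjoint U * A) $$ (0, q) * U $$ (q, 0) = (\<Sum>p<n. cnj (U $$ (p, 0)) * A $$ (p, q) * U $$ (q, 0))"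
      by (simp add: index_mat_adjoint[OF U n] sum_distrib_right)
  qed simp
  finally show ?thesis .
qed

text \<open>The expectation value is a sesquilinear form in the first column of the circuit.
  Expanding it gives combinations of cos^2, cos * sin and sin^2, which the double-angle formulas
  turn into frequency 2.\<close>

lemma rotating_expectation:
  assumes "rotating n F" and A: "A \<in> carrier_mat n n" and n: "0 < n"
  shows "\<exists>a b c. \<forall>s. Re (conj_op (F s) A $$ (0, 0)) = a + b * cos (2 * s) + c * sin (2 * s)"
proof -
  obtain X Y where X: "X \<in> carrier_mat n n" and Y: "Y \<in> carrier_mat n n"
    and F: "\<And>s. F s = complex_of_real (cos s) \<cdot>\<^sub>m X + complex_of_real (sin s) \<cdot>\<^sub>m Y"
    using assms(1) unfolding rotating_def by blast
  define S where "S P R = (\<Sum>q<n. \<Sum>p<n. cnj (P $$ (p, 0)) * A $$ (p, q) * R $$ (q, 0))" for P R :: "complex mat"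
  have "conj_op (F s) A $$ (0, 0) = complex_of_real ((cos s)\<^sup>2) * S X X + complex_of_real (cos s * sin s) * (S X Y + S Y X)
     + complex_of_real ((sin s)\<^sup>2) * S Y Y" for s
  proof -
    have Fc: "F s \<in> carrier_mat n n" unfolding F using X Y by simp
    have Fi: "F s $$ (p, 0) = complex_of_real (cos s) * X $$ (p, 0) + complex_of_real (sin s) * Y $$ (p, 0)" if "p < n" for p
      unfolding F using X Y n that by simp
    have "conj_op (F s) A $$ (0, 0) = (\<Sum>q<n. \<Sum>p<n. complex_of_real ((cos s)\<^sup>2) * (cnj (X $$ (p, 0)) * A $$ (p, q) * X $$ (q, 0))
       + complex_of_real (cos s * sin s) * (cnj (X $$ (p, 0)) * A $$ (p, q) * Y $$ (q, 0) + cnj (Y $$ (p, 0)) * A $$ (p, q) * X $$ (q, 0))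
       + complex_of_real ((sin s)\<^sup>2) * (cnj (Y $$ (p, 0)) * A $$ (p, q) * Y $$ (q, 0)))"
      unfolding index_conj_op[OF Fc A n] by (intro sum.cong refl) (simp add: Fi algebra_simps power2_eq_square)
    then show ?thesis by (simp add: S_def sum.distrib flip: sum_distrib_left)
  qed
  then have "Re (conj_op (F s) A $$ (0, 0)) = (Re (S X X) + Re (S Y Y)) / 2 + (Re (S X X) - Re (S Y Y)) / 2 * cos (2 * s)
     + Re (S X Y + S Y X) / 2 * sin (2 * s)" for s
  proof -
    have e: "Re (conj_op (F s) A $$ (0, 0)) = (cos s)\<^sup>2 * Re (S X X) + cos s * sin s * Re (S X Y + S Y X) + (sin s)\<^sup>2 * Re (S Y Y)"
      unfolding \<open>\<And>s. conj_op (F s) A $$ (0, 0) = _ s\<close> by simp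
    have c: "(cos s)\<^sup>2 = (1 + cos (2 * s)) / 2" "(sin s)\<^sup>2 = (1 - cos (2 * s)) / 2" "cos s * sin s = sin (2 * s) / 2"
      using cos_double_cos[of s] cos_double_sin[of s] sin_double[of s] by simp_all
    show ?thesis unfolding e c by (simp add: field_simps)
  qed
  then show ?thesis by blast
qed

lemma trig_poly_f_local:
  assumes Q: "valid_circuit Q" and k: "k \<in> {1..qubits Q}"
  shows "trig_poly (param_indices Q) (\<lambda>\<theta>. f_local Q k \<theta> x)"
proof (rule trig_polyI)
  show "f_local Q k \<theta> x = f_local Q k \<theta>' x" if "\<And>i. i \<in> param_indices Q \<Longrightarrow> \<theta> i = \<theta>' i" for \<theta> \<theta>'
    by (rule f_local_cong[OF Q k]) (use past_cone_subset[OF Q k] that in blast)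
  fix i \<theta> assume i: "i \<in> param_indices Q"
  have "1 \<le> qubits Q" using Q by (simp add: valid_circuit_def)
  from param_index_surj[OF i this] obtain l k' where l: "l \<in> {1..layers Q}" "k' \<in> {1..qubits Q}" "i = param_index Q l k'"
    by blast
  have "rotating (2 ^ qubits Q) (\<lambda>s. circuit Q (\<theta>(i := s)) x)"
    unfolding circuit_def l(3) using l by (intro rotating_circuit_upto[OF Q]) auto
  from rotating_expectation[OF this embed_op_carrier]
  show "\<exists>a b c. \<forall>s. f_local Q k (\<theta>(i := s)) x = a + b * cos (2 * s) + c * sin (2 * s)"
    unfolding f_local_eq by simp
qed

section \<open>Bounds on expectation values\<close>

text \<open>A traceless Hermitian matrix has rows (x, b) and (cnj b, -x), so its square is the
  scalar x^2 + |b|^2, and the root of this scalar is up to sign an eigenvalue. The spectral bound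
  thus becomes an algebraic identity that survives embedding into m qubits.\<close>

lemma traceless_observable_square:
  fixes A :: "complex mat"
  assumes A: "A \<in> carrier_mat 2 2" and herm: "hermitian_mat A" and tr: "(\<Sum>i<2. A $$ (i, i)) = 0"
    and sp: "spectrum A \<subseteq> complex_of_real ` {- 1..1}"
  obtains r :: real where "A * A = complex_of_real r \<cdot>\<^sub>m 1\<^sub>m 2" "0 \<le> r" "r \<le> 1"
proof -
  define a b where "a = A $$ (0, 0)" and "b = A $$ (0, 1)"
  have adj: "mat_adjoint A = A" using herm by (simp add: hermitian_mat_def)
  have "cnj a = a" using index_mat_adjoint[OF A, of 0 0] adj by (simp add: a_def)
  then obtain x where x: "a = complex_of_real x" by (metis Reals_cases Reals_cnj_iff)
  have A10: "A $$ (1, 0) = cnj b" using index_mat_adjoint[OF A, of 1 0] adj by (simp add: b_def)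
  have A11: "A $$ (1, 1) = - a" using tr by (simp add: a_def lessThan_nat_numeral eq_neg_iff_add_eq_0 add.commute)
  note ent = a_def[symmetric] b_def[symmetric] A10[unfolded One_nat_def] A11[unfolded One_nat_def] A10 A11 b_def[symmetric, unfolded One_nat_def]
  define r where "r = x\<^sup>2 + (cmod b)\<^sup>2"
  have rc: "complex_of_real r = a * a + b * cnj b"
    unfolding r_def x of_real_add complex_norm_square by (simp add: power2_eq_square)
  have sq: "A * A = complex_of_real r \<cdot>\<^sub>m 1\<^sub>m 2"
  proof (rule eq_matI)
    fix i j assume "i < dim_row (complex_of_real r \<cdot>\<^sub>m 1\<^sub>m 2)" "j < dim_col (complex_of_real r \<cdot>\<^sub>m 1\<^sub>m 2)"
    then have ij: "i < 2" "j < 2" by auto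
    then have "i = 0 \<or> i = 1" "j = 0 \<or> j = 1" by auto
    then show "(A * A) $$ (i, j) = (complex_of_real r \<cdot>\<^sub>m 1\<^sub>m 2) $$ (i, j)"
      unfolding index_mult_mat_sum[OF A A ij] by (auto simp: lessThan_nat_numeral ent rc algebra_simps)
  qed (use A in auto)
  have r0: "0 \<le> r" by (simp add: r_def)
  have in_sp: "\<bar>t\<bar> \<le> 1" if "eigenvector A v (complex_of_real t)" for t v
  proof -
    have "complex_of_real t \<in> spectrum A" using that by (auto simp: spectrum_def eigenvalue_def)
    then obtain u where "complex_of_real t = complex_of_real u" "u \<in> {- 1..1}" using sp by blast
    then show ?thesis by (simp add: abs_le_iff)
  qed
  have mv: "(A *\<^sub>v v) $ i = A $$ (i, 0) * v $ 0 + A $$ (i, 1) * v $ 1" if "i < 2" "v \<in> carrier_vec 2" for i v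
    using that A by (simp add: scalar_prod_def numeral_2_eq_2)
  have "r \<le> 1"
  \<comment> \<open>The eigenvector (b, sqrt r - a) may vanish when b = 0; in that case the matrix
    is diagonal and the first basis vector serves.\<close>
  proof (cases "b = 0")
    case True
    define v :: "complex vec" where "v = vec 2 (\<lambda>i. if i = 0 then 1 else 0)"
    have "eigenvector A v (complex_of_real x)"
      unfolding eigenvector_def
    proof (intro conjI)
      show "v \<noteq> 0\<^sub>v (dim_row A)"
      proof
        assume "v = 0\<^sub>v (dim_row A)"
        from arg_cong[OF this, of "\<lambda>v. vec_index v 0"] A show False by (simp add: v_def)
      qed
      show "A *\<^sub>v v = complex_of_real x \<cdot>\<^sub>v v"
      proof (rule eq_vecI)
        fix i assume "i < dim_vec (complex_of_real x \<cdot>\<^sub>v v)"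
        then have "i < 2" "i = 0 \<or> i = 1" by (auto simp: v_def)
        then show "(A *\<^sub>v v) $ i = (complex_of_real x \<cdot>\<^sub>v v) $ i"
          by (subst mv) (auto simp: ent v_def True x)
      qed (use A in \<open>auto simp: v_def\<close>)
    qed (use A in \<open>auto simp: v_def\<close>)
    from in_sp[OF this] show ?thesis using True by (simp add: r_def abs_square_le_1)
  next
    case False
    define v where "v = vec 2 (\<lambda>i. if i = 0 then b else complex_of_real (sqrt r) - a)"
    have rr: "complex_of_real (sqrt r) * complex_of_real (sqrt r) = a * a + b * cnj b"
      using r0 by (simp flip: of_real_mult rc)
    have "eigenvector A v (complex_of_real (sqrt r))"
      unfolding eigenvector_def
    proof (intro conjI)
      show "v \<noteq> 0\<^sub>v (dim_row A)"
      proof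
        assume "v = 0\<^sub>v (dim_row A)"
        from arg_cong[OF this, of "\<lambda>v. vec_index v 0"] A False show False by (simp add: v_def)
      qed
      show "A *\<^sub>v v = complex_of_real (sqrt r) \<cdot>\<^sub>v v"
      proof (rule eq_vecI)
        fix i assume "i < dim_vec (complex_of_real (sqrt r) \<cdot>\<^sub>v v)"
        then have "i < 2" "i = 0 \<or> i = 1" by (auto simp: v_def)
        then show "(A *\<^sub>v v) $ i = (complex_of_real (sqrt r) \<cdot>\<^sub>v v) $ i"
          by (subst mv) (auto simp: ent v_def rr algebra_simps)
      qed (use A in \<open>auto simp: v_def\<close>)
    qed (use A in \<open>auto simp: v_def\<close>)
    from in_sp[OF this] show ?thesis using r0 by simp
  qed
  with sq r0 show ?thesis by (rule that)
qed

text \<open>Cauchy-Schwarz between the evolved state, of norm 1, and its image under A, whose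
  squared norm is r.\<close>

lemma conj_op_one_bound:
  assumes U: "U \<in> carrier_mat n n" "unitary_mat U" and n: "0 < n"
    and A: "A \<in> carrier_mat n n" "mat_adjoint A = A" "A * A = complex_of_real r \<cdot>\<^sub>m 1\<^sub>m n" and r: "0 \<le> r" "r \<le> 1"
  shows "\<bar>Re (conj_op U A $$ (0, 0))\<bar> \<le> 1"
proof -
  define v where "v p = U $$ (p, 0)" for p
  define w where "w p = (A * U) $$ (p, 0)" for p
  note AU = mult_carrier_mat[OF A(1) U(1)] and U' = mat_adjoint_carrier[OF U(1)]
  have sumsq: "(\<Sum>p<n. (cmod (B $$ (p, 0)))\<^sup>2) = Re ((mat_adjoint B * B) $$ (0, 0))" if "B \<in> carrier_mat n n" for B
    unfolding index_mult_mat_sum[OF mat_adjoint_carrier[OF that] that n n]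
    using index_mat_adjoint[OF that n] by (simp add: complex_norm_square[symmetric] mult.commute[of "cnj _"])
  have v: "(\<Sum>p<n. (cmod (v p))\<^sup>2) = 1"
    using sumsq[OF U(1)] n by (simp add: v_def unitary_matD(1)[OF U(2,1)])
  have "mat_adjoint (A * U) * (A * U) = complex_of_real r \<cdot>\<^sub>m 1\<^sub>m n"
  proof -
    have "mat_adjoint (A * U) * (A * U) = mat_adjoint U * (A * A) * U"
      unfolding mat_adjoint_mult[OF A(1) U(1)] A(2) using U(1) U' A(1)
      by (simp add: assoc_mult_mat[of _ n n _ n _ n] mult_carrier_mat[of _ n n _ n])
    also have "\<dots> = complex_of_real r \<cdot>\<^sub>m (mat_adjoint U * U)"
      unfolding A(3) using U(1) U' by (simp add: mult_smult_distrib[of _ n n _ n] mult_smult_assoc_mat[of _ n n _ n])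
    finally show ?thesis by (simp add: unitary_matD(1)[OF U(2,1)])
  qed
  then have w: "(\<Sum>p<n. (cmod (w p))\<^sup>2) = r" using sumsq[OF AU] n by (simp add: w_def)
  have "conj_op U A $$ (0, 0) = (\<Sum>p<n. cnj (v p) * w p)"
  proof -
    have "conj_op U A = mat_adjoint U * (A * U)" unfolding conj_op_def by (rule assoc_mult_mat[OF U' A(1) U(1)])
    then show ?thesis using index_mult_mat_sum[OF U' AU n n] index_mat_adjoint[OF U(1) n] by (simp add: v_def w_def)
  qed
  then have "\<bar>Re (conj_op U A $$ (0, 0))\<bar> \<le> cmod (\<Sum>p<n. cnj (v p) * w p)" by (simp only: abs_Re_le_cmod)
  also have "\<dots> \<le> (\<Sum>p<n. \<bar>cmod (v p)\<bar> * \<bar>cmod (w p)\<bar>)"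
    by (intro order_trans[OF norm_sum] sum_mono) (simp add: norm_mult)
  also have "\<dots> \<le> L2_set (\<lambda>p. cmod (v p)) {..<n} * L2_set (\<lambda>p. cmod (w p)) {..<n}" by (rule L2_set_mult_ineq)
  also have "\<dots> = sqrt r" by (simp add: L2_set_def v w)
  also have "\<dots> \<le> 1" using r by simp
  finally show ?thesis .
qed

lemma f_local_bound:
  assumes Q: "valid_circuit Q" and k: "k \<in> {1..qubits Q}"
  shows "\<bar>f_local Q k \<theta> x\<bar> \<le> 1"
proof -
  have A: "observable Q k \<in> carrier_mat 2 2" "hermitian_mat (observable Q k)"
    "(\<Sum>i<2. observable Q k $$ (i, i)) = 0" "spectrum (observable Q k) \<subseteq> complex_of_real ` {- 1..1}"
    using Q k unfolding valid_circuit_def by blast+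
  obtain r where r: "observable Q k * observable Q k = complex_of_real r \<cdot>\<^sub>m 1\<^sub>m 2" "0 \<le> r" "r \<le> 1"
    using traceless_observable_square[OF A] by blast
  have ks: "distinct [k]" "set [k] \<subseteq> {1..qubits Q}" using k by auto
  have A': "observable Q k \<in> carrier_mat (2 ^ length [k]) (2 ^ length [k])" using A by simp
  have "embed_op (qubits Q) [k] (observable Q k) * embed_op (qubits Q) [k] (observable Q k) = complex_of_real r \<cdot>\<^sub>m 1\<^sub>m (2 ^ qubits Q)"
    using embed_op_mult[OF ks A' A'] embed_op_scalar[OF ks(2), of "complex_of_real r"] r by simp
  moreover have "mat_adjoint (embed_op (qubits Q) [k] (observable Q k)) = embed_op (qubits Q) [k] (observable Q k)"
    using embed_op_adjoint[OF A'] A(2) by (simp add: hermitian_mat_def)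
  ultimately show ?thesis
    unfolding f_local_eq circuit_def using r unitary_circuit_upto[OF Q order_refl]
    by (intro conj_op_one_bound[OF circuit_upto_carrier _ _ embed_op_carrier]) auto
qed

section \<open>The model function and its tangent kernel\<close>

lemma shift_diff_sum: "shift_diff i (\<lambda>\<theta>. a * (\<Sum>k\<in>S. f k \<theta>)) \<theta> = a * (\<Sum>k\<in>S. shift_diff i (f k) \<theta>)"
  by (simp add: shift_diff_def sum_subtractf right_diff_distrib)

lemma trig_poly_f_model: "valid_circuit Q \<Longrightarrow> trig_poly (param_indices Q) (\<lambda>\<theta>. f_model Q \<theta> x)"
  unfolding f_model_def by (intro trig_poly_cmult trig_poly_sum trig_poly_f_local)

lemma finite_param_indices [simp]: "finite (param_indices Q)"
  by (simp add: param_indices_def)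

lemma finite_past_cone: "valid_circuit Q \<Longrightarrow> k \<in> {1..qubits Q} \<Longrightarrow> finite (past_cone Q k)"
  by (rule finite_subset[OF past_cone_subset]) simp_all

lemma finite_future_cone: "finite (future_cone Q i)"
  by (simp add: future_cone_def)

lemma card_past_cone_le: "k \<in> {1..qubits Q} \<Longrightarrow> card (past_cone Q k) \<le> card_N Q"
  unfolding card_N_def by (intro Max_ge) auto

lemma card_future_cone_le: "i \<in> param_indices Q \<Longrightarrow> card (future_cone Q i) \<le> card_M Q"
  unfolding card_M_def by (intro Max_ge) auto

lemma cones_nonempty:
  assumes Q: "valid_circuit Q" shows "1 \<le> card_M Q" "1 \<le> card_N Q"
proof -
  have m: "1 \<in> {1..qubits Q}" and L: "layers Q \<in> {1..layers Q}" using Q by (auto simp: valid_circuit_def)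
  let ?i = "param_index Q (layers Q) 1"
  have "1 \<in> light_cone Q (layers Q) 1" by (simp add: light_cone_def interacting_def)
  then have i: "?i \<in> past_cone Q 1" using L unfolding past_cone_def by blast
  then have "1 \<le> card (past_cone Q 1)"
    using finite_past_cone[OF Q m] by (metis One_nat_def Suc_leI card_gt_0_iff empty_iff)
  then show "1 \<le> card_N Q" using card_past_cone_le[OF m] by linarith
  have "1 \<in> future_cone Q ?i" using i m by (simp add: future_cone_def)
  then have "1 \<le> card (future_cone Q ?i)"
    using finite_future_cone by (metis One_nat_def Suc_leI card_gt_0_iff empty_iff)
  then show "1 \<le> card_M Q" using card_future_cone_le[OF param_index_in[OF m L]] by linarith
qed

section \<open>Counting with past and future cones\<close>

lemma shift_diff_f_local_bound:
  assumes Q: "valid_circuit Q" and k: "k \<in> {1..qubits Q}"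
  shows "\<bar>shift_diff i (\<lambda>\<theta>. f_local Q k \<theta> x) \<theta>\<bar> \<le> 2"
  using f_local_bound[OF Q k, of "\<theta>(i := \<theta> i + pi / 4)" x] f_local_bound[OF Q k, of "\<theta>(i := \<theta> i - pi / 4)" x]
  unfolding shift_diff_def by linarith

lemma shift_diff_f_local_zero:
  assumes Q: "valid_circuit Q" and k: "k \<in> {1..qubits Q}" and i: "i \<notin> past_cone Q k"
  shows "shift_diff i (\<lambda>\<theta>. f_local Q k \<theta> x) \<theta> = 0"
proof -
  have "f_local Q k (\<theta>(i := \<theta> i + pi / 4)) x = f_local Q k (\<theta>(i := \<theta> i - pi / 4)) x"
    by (rule f_local_cong[OF Q k]) (use i in auto)
  then show ?thesis by (simp add: shift_diff_def)
qed

text \<open>Only the observables whose past cone contains \<open>i\<close> contribute, and there are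
  at most \<open>card_M Q\<close> of them. Every factor |M| in the gradient and kernel bounds comes
  from here.\<close>

lemma sum_future_cone_le:
  assumes i: "i \<in> param_indices Q" and b: "0 \<le> b"
    and a: "\<And>k. k \<in> {1..qubits Q} \<Longrightarrow> \<bar>a k\<bar> \<le> b" and z: "\<And>k. k \<in> {1..qubits Q} \<Longrightarrow> i \<notin> past_cone Q k \<Longrightarrow> a k = (0 :: real)"
  shows "(\<Sum>k = 1..qubits Q. \<bar>a k\<bar>) \<le> real (card_M Q) * b"
proof -
  have "(\<Sum>k = 1..qubits Q. \<bar>a k\<bar>) = (\<Sum>k\<in>future_cone Q i. \<bar>a k\<bar>)"
    by (rule sum.mono_neutral_right) (auto simp: future_cone_def z)
  also have "\<dots> \<le> (\<Sum>k\<in>future_cone Q i. b)"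
    by (rule sum_mono) (auto simp: future_cone_def intro!: a)
  also have "\<dots> = real (card (future_cone Q i)) * b" by simp
  also have "\<dots> \<le> real (card_M Q) * b" using card_future_cone_le[OF i] b by (intro mult_right_mono) auto
  finally show ?thesis .
qed

lemma shift_diff_f_model_bound:
  assumes Q: "valid_circuit Q" and i: "i \<in> param_indices Q" and N: "0 < normalization Q"
  shows "\<bar>shift_diff i (\<lambda>\<theta>. f_model Q \<theta> x) \<theta>\<bar> \<le> 2 * real (card_M Q) / normalization Q"
proof -
  have "\<bar>\<Sum>k = 1..qubits Q. shift_diff i (\<lambda>\<theta>. f_local Q k \<theta> x) \<theta>\<bar> \<le> (\<Sum>k = 1..qubits Q. \<bar>shift_diff i (\<lambda>\<theta>. f_local Q k \<theta> x) \<theta>\<bar>)"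
    by (rule sum_abs)
  also have "\<dots> \<le> real (card_M Q) * 2"
    by (rule sum_future_cone_le[OF i]) (simp_all add: shift_diff_f_local_bound[OF Q] shift_diff_f_local_zero[OF Q])
  finally show ?thesis unfolding f_model_def shift_diff_sum using N by (simp add: abs_mult divide_right_mono)
qed

lemma f_model_coord_diff:
  assumes Q: "valid_circuit Q" and i: "i \<in> param_indices Q" and N: "0 < normalization Q"
  shows "\<bar>f_model Q (\<theta>(i := s)) x - f_model Q \<theta> x\<bar> \<le> 2 * real (card_M Q) / normalization Q"
proof -
  let ?d = "\<lambda>k. f_local Q k (\<theta>(i := s)) x - f_local Q k \<theta> x"
  have "\<bar>\<Sum>k = 1..qubits Q. ?d k\<bar> \<le> (\<Sum>k = 1..qubits Q. \<bar>?d k\<bar>)" by (rule sum_abs)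
  also have "\<dots> \<le> real (card_M Q) * 2"
  proof (rule sum_future_cone_le[OF i])
    fix k assume k: "k \<in> {1..qubits Q}"
    show "\<bar>?d k\<bar> \<le> 2"
      using f_local_bound[OF Q k, of "\<theta>(i := s)" x] f_local_bound[OF Q k, of \<theta> x] by linarith
    show "?d k = 0" if "i \<notin> past_cone Q k"
    proof -
      have "f_local Q k (\<theta>(i := s)) x = f_local Q k \<theta> x"
        by (rule f_local_cong[OF Q k]) (use that in auto)
      then show ?thesis by (simp only: diff_self)
    qed
  qed simp
  finally show ?thesis
    using N by (simp add: f_model_def abs_mult divide_right_mono sum_subtractf flip: diff_divide_distrib)
qed

text \<open>For a fixed observable at most |N| parameters \<open>j\<close> contribute, each with a
  change of at most 2 * 2 by the second-order bound; only afterwards are the observables summed, of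
  which |M| see parameter \<open>i\<close>. In this order the total number of parameters does not
  enter.\<close>

lemma sum_shift_diff_coord_diff:
  assumes Q: "valid_circuit Q" and i: "i \<in> param_indices Q" and N: "0 < normalization Q"
  shows "(\<Sum>j\<in>param_indices Q. \<bar>shift_diff j (\<lambda>\<theta>. f_model Q \<theta> x) (\<theta>(i := s)) - shift_diff j (\<lambda>\<theta>. f_model Q \<theta> x) \<theta>\<bar>)
     \<le> 4 * real (card_M Q) * real (card_N Q) / normalization Q * min 1 \<bar>s - \<theta> i\<bar>"
proof -
  let ?D = "\<lambda>k j \<theta>. shift_diff j (\<lambda>\<theta>. f_local Q k \<theta> x) \<theta>"
  let ?\<tau> = "min 1 \<bar>s - \<theta> i\<bar>"
  define d where "d k j = ?D k j (\<theta>(i := s)) - ?D k j \<theta>" for k j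
  have d_le: "\<bar>d k j\<bar> \<le> 4 * ?\<tau>" if k: "k \<in> {1..qubits Q}" and j: "j \<in> param_indices Q" for k j
  proof -
    have triv: "\<theta>(i := \<theta> i) = \<theta>" by (rule fun_upd_triv)
    have "\<bar>?D k j (\<theta>(i := s)) - ?D k j (\<theta>(i := \<theta> i))\<bar> \<le> 2 * 2 * ?\<tau>"
      by (rule trig_poly_coord_lipschitz[OF trig_poly_shift_diff[OF trig_poly_f_local[OF Q k] j] i shift_diff_f_local_bound[OF Q k]])
    then have "\<bar>d k j\<bar> \<le> 2 * 2 * ?\<tau>" unfolding triv d_def .
    then show ?thesis by simp
  qed
  have d0: "d k j = 0" if k: "k \<in> {1..qubits Q}" and "j \<notin> past_cone Q k" for k j
    using shift_diff_f_local_zero[OF Q that] unfolding d_def by simp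
  have d0': "d k j = 0" if k: "k \<in> {1..qubits Q}" and n: "i \<notin> past_cone Q k" for k j
  proof (cases "j \<in> past_cone Q k")
    case True
    then have ne: "j \<noteq> i" using n by auto
    have "f_local Q k (\<theta>(i := s, j := q)) x = f_local Q k (\<theta>(j := q)) x" for q
      by (rule f_local_cong[OF Q k]) (use n in auto)
    then show ?thesis unfolding d_def shift_diff_def using ne by simp
  qed (rule d0[OF k])
  have row: "(\<Sum>j\<in>param_indices Q. \<bar>d k j\<bar>) \<le> real (card_N Q) * (4 * ?\<tau>)" if k: "k \<in> {1..qubits Q}" for k
  proof -
    have "(\<Sum>j\<in>param_indices Q. \<bar>d k j\<bar>) = (\<Sum>j\<in>past_cone Q k. \<bar>d k j\<bar>)"
      by (rule sum.mono_neutral_right) (use past_cone_subset[OF Q k] d0[OF k] in auto)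
    also have "\<dots> \<le> (\<Sum>j\<in>past_cone Q k. 4 * ?\<tau>)"
      by (rule sum_mono) (use d_le[OF k] past_cone_subset[OF Q k] in blast)
    also have "\<dots> = real (card (past_cone Q k)) * (4 * ?\<tau>)" by simp
    also have "\<dots> \<le> real (card_N Q) * (4 * ?\<tau>)"
      using card_past_cone_le[OF k] by (intro mult_right_mono) auto
    finally show ?thesis .
  qed
  have "(\<Sum>j\<in>param_indices Q. \<bar>\<Sum>k = 1..qubits Q. d k j\<bar>) \<le> (\<Sum>j\<in>param_indices Q. \<Sum>k = 1..qubits Q. \<bar>d k j\<bar>)"
    by (intro sum_mono sum_abs)
  also have "\<dots> = (\<Sum>k = 1..qubits Q. \<bar>\<Sum>j\<in>param_indices Q. \<bar>d k j\<bar>\<bar>)"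
    by (subst sum.swap) (simp add: sum_nonneg)
  also have "\<dots> \<le> real (card_M Q) * (real (card_N Q) * (4 * ?\<tau>))"
    by (rule sum_future_cone_le[OF i]) (use row d0' in \<open>auto simp: sum_nonneg\<close>)
  finally have "1 / normalization Q * (\<Sum>j\<in>param_indices Q. \<bar>\<Sum>k = 1..qubits Q. d k j\<bar>)
      \<le> 1 / normalization Q * (real (card_M Q) * (real (card_N Q) * (4 * ?\<tau>)))"
    using N by (intro mult_left_mono) auto
  moreover have "\<bar>shift_diff j (\<lambda>\<theta>. f_model Q \<theta> x) (\<theta>(i := s)) - shift_diff j (\<lambda>\<theta>. f_model Q \<theta> x) \<theta>\<bar>
     = 1 / normalization Q * \<bar>\<Sum>k = 1..qubits Q. d k j\<bar>" for j
    unfolding f_model_def shift_diff_sum right_diff_distrib[symmetric] abs_mult sum_subtractf[symmetric] d_def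
    using N by simp
  ultimately show ?thesis by (simp only: sum_distrib_left[symmetric]) (simp add: mult_ac)
qed

text \<open>In the difference of two products one factor is bounded by the gradient bound 2 |M| /
  N(m), while the change of the other is summed by the preceding estimate, 4 |M| |N| / N(m). Two
  such terms give the 16.\<close>

lemma tangent_kernel_coord_diff:
  assumes Q: "valid_circuit Q" and i: "i \<in> param_indices Q" and N: "0 < normalization Q"
  shows "\<bar>tangent_kernel (param_indices Q) (f_model Q) (\<theta>(i := s)) x x' - tangent_kernel (param_indices Q) (f_model Q) \<theta> x x'\<bar>
     \<le> 16 * real (card_M Q) ^ 2 * real (card_N Q) / normalization Q ^ 2 * min 1 \<bar>s - \<theta> i\<bar>"
proof -
  let ?D = "\<lambda>x j \<theta>. shift_diff j (\<lambda>\<theta>. f_model Q \<theta> x) \<theta>"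
  let ?p = "2 * real (card_M Q) / normalization Q"
  let ?\<tau> = "min 1 \<bar>s - \<theta> i\<bar>"
  define e where "e x j = \<bar>?D x j (\<theta>(i := s)) - ?D x j \<theta>\<bar>" for x j
  have "\<bar>?D x j (\<theta>(i := s)) * ?D x' j (\<theta>(i := s)) - ?D x j \<theta> * ?D x' j \<theta>\<bar> \<le> ?p * (e x j + e x' j)"
    if j: "j \<in> param_indices Q" for j
  proof -
    have split: "a * b - a' * b' = (a - a') * b + a' * (b - b')" for a b a' b' :: real
      by (simp add: algebra_simps)
    have "\<bar>?D x j (\<theta>(i := s)) * ?D x' j (\<theta>(i := s)) - ?D x j \<theta> * ?D x' j \<theta>\<bar>
       \<le> e x j * \<bar>?D x' j (\<theta>(i := s))\<bar> + \<bar>?D x j \<theta>\<bar> * e x' j"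
      unfolding e_def abs_mult[symmetric] split by (rule abs_triangle_ineq)
    also have "\<dots> \<le> e x j * ?p + ?p * e x' j"
      using shift_diff_f_model_bound[OF Q j N] by (intro add_mono mult_left_mono mult_right_mono) (auto simp: e_def)
    also have "\<dots> = ?p * (e x j + e x' j)" by (metis distrib_left mult.commute)
    finally show ?thesis .
  qed
  then have "\<bar>tangent_kernel (param_indices Q) (f_model Q) (\<theta>(i := s)) x x' - tangent_kernel (param_indices Q) (f_model Q) \<theta> x x'\<bar>
    \<le> (\<Sum>j\<in>param_indices Q. ?p * (e x j + e x' j))"
    unfolding tangent_kernel_def sum_subtractf[symmetric] by (intro order_trans[OF sum_abs] sum_mono)
  also have "\<dots> = ?p * ((\<Sum>j\<in>param_indices Q. e x j) + (\<Sum>j\<in>param_indices Q. e x' j))"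
    by (simp only: sum_distrib_left[symmetric] sum.distrib)
  also have "\<dots> \<le> ?p * (4 * real (card_M Q) * real (card_N Q) / normalization Q * ?\<tau> + 4 * real (card_M Q) * real (card_N Q) / normalization Q * ?\<tau>)"
    unfolding e_def using N by (intro mult_left_mono add_mono sum_shift_diff_coord_diff[OF Q i N]) auto
  also have "\<dots> = 16 * real (card_M Q) ^ 2 * real (card_N Q) / normalization Q ^ 2 * ?\<tau>"
    by (simp add: power2_eq_square)
  finally show ?thesis .
qed

lemma empirical_ntk_eq: "valid_circuit Q \<Longrightarrow> empirical_ntk Q \<theta> x x' = tangent_kernel (param_indices Q) (f_model Q) \<theta> x x'"
  unfolding empirical_ntk_def tangent_kernel_def
  by (intro sum.cong refl) (simp add: partial_deriv_trig_poly[OF trig_poly_f_model])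

lemma tangent_kernel_measurable:
  assumes "\<And>x. trig_poly I (\<lambda>\<theta>. f \<theta> x)" "finite I" "sets N = sets borel"
  shows "(\<lambda>\<theta>. tangent_kernel I f \<theta> x x') \<in> borel_measurable (Pi\<^sub>M I (\<lambda>_. N))"
  unfolding tangent_kernel_def
  by (intro borel_measurable_sum borel_measurable_times trig_poly_measurable[OF trig_poly_shift_diff] assms)

section \<open>The initial distribution\<close>

lemma prob_space_uniform_pi: "prob_space (uniform_measure lborel {0..pi})"
  by (rule prob_space_uniform_measure) (auto simp: emeasure_lborel_Icc_eq)

lemma prob_space_init_dist: "prob_space (init_dist Q)"
  unfolding init_dist_def by (intro prob_space_PiM prob_space_uniform_pi)

lemma f_model_measurable: "valid_circuit Q \<Longrightarrow> (\<lambda>\<theta>. f_model Q \<theta> x) \<in> borel_measurable (init_dist Q)"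
  unfolding init_dist_def by (rule trig_poly_measurable[OF trig_poly_f_model]) auto

lemma f_local_measurable: "valid_circuit Q \<Longrightarrow> k \<in> {1..qubits Q} \<Longrightarrow> (\<lambda>\<theta>. f_local Q k \<theta> x) \<in> borel_measurable (init_dist Q)"
  unfolding init_dist_def by (rule trig_poly_measurable[OF trig_poly_f_local]) auto

lemma empirical_ntk_measurable: "valid_circuit Q \<Longrightarrow> (\<lambda>\<theta>. empirical_ntk Q \<theta> x x') \<in> borel_measurable (init_dist Q)"
  unfolding init_dist_def by (simp add: empirical_ntk_eq tangent_kernel_measurable trig_poly_f_model)

lemma f_model_bound:
  assumes Q: "valid_circuit Q" and N: "0 < normalization Q"
  shows "\<bar>f_model Q \<theta> x\<bar> \<le> real (qubits Q) / normalization Q"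
proof -
  have "\<bar>\<Sum>k = 1..qubits Q. f_local Q k \<theta> x\<bar> \<le> (\<Sum>k = 1..qubits Q. 1)"
    by (intro order_trans[OF sum_abs] sum_mono f_local_bound[OF Q])
  then show ?thesis using N by (simp add: f_model_def divide_right_mono)
qed

lemma integrable_f_local:
  assumes Q: "valid_circuit Q" and k: "k \<in> {1..qubits Q}" shows "integrable (init_dist Q) (\<lambda>\<theta>. f_local Q k \<theta> x)"
proof -
  interpret prob_space "init_dist Q" by (rule prob_space_init_dist)
  show ?thesis using f_local_bound[OF Q k] by (intro integrable_const_bound[where B = 1] f_local_measurable[OF Q k]) auto
qed

lemma integrable_f_model_square:
  assumes Q: "valid_circuit Q" and N: "0 < normalization Q" shows "integrable (init_dist Q) (\<lambda>\<theta>. (f_model Q \<theta> x)\<^sup>2)"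
proof -
  interpret prob_space "init_dist Q" by (rule prob_space_init_dist)
  note [measurable] = f_model_measurable[OF Q]
  have "(f_model Q \<theta> x)\<^sup>2 \<le> (real (qubits Q) / normalization Q)\<^sup>2" for \<theta>
    using power_mono[OF f_model_bound[OF Q N, of \<theta> x] abs_ge_zero, of 2] by simp
  then show ?thesis by (intro integrable_const_bound[where B = "(real (qubits Q) / normalization Q)\<^sup>2"]) auto
qed

text \<open>Some input attains the maximal variance 1. There the model has mean zero and differences
  at most 2 |M| / N(m), so the second-moment bound reads 1 \<le> V / 3, with V the sum of the
  squared differences.\<close>

lemma normalization_bound:
  assumes fin: "finite X" "X \<noteq> {}" and Q: "valid_circuit Q" and init: "valid_init X Q"
  shows "3 * normalization Q ^ 2 \<le> 4 * real (layers Q * qubits Q) * real (card_M Q) ^ 2"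
proof -
  have N: "1 \<le> normalization Q" using init by (simp add: valid_init_def)
  then have N0: "0 < normalization Q" by simp
  have "Max ((\<lambda>x. cov0 Q x x) ` X) \<in> (\<lambda>x. cov0 Q x x) ` X" using fin by (intro Max_in) auto
  then obtain x where x: "x \<in> X" "cov0 Q x x = 1" using init by (auto simp: valid_init_def)
  define V where "V = (\<Sum>i\<in>param_indices Q. (2 * real (card_M Q) / normalization Q)\<^sup>2)"
  have V: "V = real (layers Q * qubits Q) * (4 * real (card_M Q) ^ 2 / normalization Q ^ 2)"
    by (simp add: V_def param_indices_def power_divide power_mult_distrib)
  have "1 \<le> qubits Q" "1 \<le> layers Q" using Q by (auto simp: valid_circuit_def)
  then have V0: "0 < V" unfolding V using cones_nonempty(1)[OF Q] N0 by simp
  have "(\<integral>\<theta>. (\<Sum>k = 1..qubits Q. f_local Q k \<theta> x) \<partial>init_dist Q) = (\<Sum>k = 1..qubits Q. \<integral>\<theta>. f_local Q k \<theta> x \<partial>init_dist Q)"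
    by (rule Bochner_Integration.integral_sum) (rule integrable_f_local[OF Q])
  also have "\<dots> = 0" using init x(1) by (simp add: valid_init_def)
  finally have "integral\<^sup>L (init_dist Q) (\<lambda>\<theta>. f_model Q \<theta> x) = 0"
    by (simp add: f_model_def)
  then have "(\<integral>\<theta>. (f_model Q \<theta> x)\<^sup>2 \<partial>init_dist Q) \<le> V / 3"
    unfolding init_dist_def
    by (intro bounded_differences_second_moment[where c = "\<lambda>_. 2 * real (card_M Q) / normalization Q"])
      (use prob_space_uniform_pi f_model_measurable[OF Q, of x] f_model_bound[OF Q N0] f_model_coord_diff[OF Q _ N0] V0 in
        \<open>auto simp: V_def init_dist_def\<close>)
  then have "3 \<le> V" using x(2) by (simp add: cov0_def power2_eq_square)
  then show ?thesis unfolding V using N0 by (simp add: field_simps)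
qed

section \<open>Concentration of the initialization\<close>

text \<open>One half of \<delta> goes to Markov's inequality for the sum of squared outputs, whose
  mean is at most n since each variance is at most 1. The other half goes to a union bound over the
  n^2 kernel entries.\<close>

lemma good_initialization:
  assumes Q: "valid_circuit Q" and init: "valid_init X Q" and fin: "finite X" and xs: "\<forall>i<n. xs i \<in> X"
    and n: "1 \<le> n" and \<delta>: "0 < \<delta>" "\<delta> < 1"
  obtains A where "A \<in> sets (init_dist Q)" "measure (init_dist Q) A \<ge> 1 - \<delta>"
    "\<And>\<theta>. \<theta> \<in> A \<Longrightarrow> L2_set (\<lambda>j. f_model Q \<theta> (xs j)) {..<n} \<le> sqrt (2 * real n / \<delta>)"
    "\<And>\<theta> i j. \<theta> \<in> A \<Longrightarrow> i < n \<Longrightarrow> j < n \<Longrightarrow>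
      real n * \<bar>tangent_kernel (param_indices Q) (f_model Q) \<theta> (xs i) (xs j) - ntk Q (xs i) (xs j)\<bar> \<le> g_const Q n \<delta>"
proof -
  let ?M = "init_dist Q"
  interpret prob_space ?M by (rule prob_space_init_dist)
  have N: "1 \<le> normalization Q" using init by (simp add: valid_init_def)
  then have N0: "0 < normalization Q" by simp
  define P where "P = real (layers Q * qubits Q)"
  define c where "c = 16 * real (card_M Q) ^ 2 * real (card_N Q) / normalization Q ^ 2"
  define lg where "lg = ln (2 * real n ^ 2 / \<delta>)"
  \<comment> \<open>The entrywise form of \<open>g_const\<close>. With
    \<open>V = P * c\<^sup>2\<close> the tail exponent becomes \<open>- 2 * lg\<close>.\<close>
  define \<epsilon> where "\<epsilon> = c * sqrt P * sqrt lg"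
  have P: "0 < P" using Q by (simp add: P_def valid_circuit_def)
  have c: "0 < c" using cones_nonempty[OF Q] N0 by (simp add: c_def)
  have arg: "1 < 2 * real n ^ 2 / \<delta>"
  proof -
    have "1 \<le> real n ^ 2" using n by simp
    then show ?thesis using \<delta> by (simp add: field_simps)
  qed
  have lg: "0 < lg" using arg by (simp add: lg_def)
  have \<epsilon>: "0 < \<epsilon>" using c P lg by (simp add: \<epsilon>_def)
  have g: "g_const Q n \<delta> = real n * \<epsilon>"
    by (simp add: g_const_def \<epsilon>_def c_def P_def lg_def)
  define S where "S \<theta> = (\<Sum>j<n. (f_model Q \<theta> (xs j))\<^sup>2)" for \<theta>
  define K where "K i j \<theta> = empirical_ntk Q \<theta> (xs i) (xs j)" for i j \<theta>
  define bad0 where "bad0 = {\<theta> \<in> space ?M. S \<theta> \<ge> 2 * real n / \<delta>}"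
  define bad where "bad i j = {\<theta> \<in> space ?M. \<bar>K i j \<theta> - integral\<^sup>L ?M (K i j)\<bar> > \<epsilon>}" for i j
  define A where "A = space ?M - (bad0 \<union> (\<Union>(i, j)\<in>{..<n} \<times> {..<n}. bad i j))"
  note [measurable] = f_model_measurable[OF Q] empirical_ntk_measurable[OF Q]
  have bad0_m: "bad0 \<in> sets ?M" unfolding bad0_def S_def by measurable
  have bad_m: "bad i j \<in> sets ?M" for i j unfolding bad_def K_def by measurable
  have "prob bad0 \<le> (\<integral>\<theta>. S \<theta> \<partial>?M) / (2 * real n / \<delta>)"
    unfolding bad0_def
    by (rule integral_Markov_inequality_measure[where A = "{}"])
       (use n \<delta> integrable_f_model_square[OF Q N0] in \<open>auto simp: S_def sum_nonneg\<close>)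
  also have "(\<integral>\<theta>. S \<theta> \<partial>?M) \<le> real n"
  proof -
    have "(\<integral>\<theta>. S \<theta> \<partial>?M) = (\<Sum>j<n. cov0 Q (xs j) (xs j))"
      unfolding S_def cov0_def power2_eq_square[symmetric]
      by (rule Bochner_Integration.integral_sum) (rule integrable_f_model_square[OF Q N0])
    also have "\<dots> \<le> (\<Sum>j<n. 1)"
    proof (rule sum_mono)
      fix j assume "j \<in> {..<n}"
      then have "xs j \<in> X" using xs by auto
      then have "cov0 Q (xs j) (xs j) \<le> Max ((\<lambda>x. cov0 Q x x) ` X)" using fin by (intro Max_ge) auto
      then show "cov0 Q (xs j) (xs j) \<le> 1" using init by (simp add: valid_init_def)
    qed
    finally show ?thesis by simp
  qed
  then have "(\<integral>\<theta>. S \<theta> \<partial>?M) / (2 * real n / \<delta>) \<le> real n / (2 * real n / \<delta>)"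
    using n \<delta> by (intro divide_right_mono) auto
  also have "real n / (2 * real n / \<delta>) = \<delta> / 2" using n \<delta> by simp
  finally have p0: "prob bad0 \<le> \<delta> / 2" .
  have p: "prob (bad i j) \<le> \<delta> / (2 * real n ^ 2)" for i j
  proof -
    define V where "V = (\<Sum>k\<in>param_indices Q. c\<^sup>2)"
    have V: "V = P * c\<^sup>2" by (simp add: V_def param_indices_def P_def)
    have Kd: "\<bar>K i j (\<theta>(k := s)) - K i j \<theta>\<bar> \<le> c" if "k \<in> param_indices Q" for \<theta> k s
    proof -
      have "\<bar>K i j (\<theta>(k := s)) - K i j \<theta>\<bar> \<le> c * min 1 \<bar>s - \<theta> k\<bar>"
        unfolding K_def empirical_ntk_eq[OF Q] c_def by (rule tangent_kernel_coord_diff[OF Q that N0])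
      also have "\<dots> \<le> c * 1" using c by (intro mult_left_mono) auto
      finally show ?thesis by simp
    qed
    have Kb: "\<bar>K i j \<theta>\<bar> \<le> real (card (param_indices Q)) * (2 * real (card_M Q) / normalization Q)\<^sup>2" for \<theta>
      unfolding K_def empirical_ntk_eq[OF Q]
      by (rule tangent_kernel_bound) (use shift_diff_f_model_bound[OF Q _ N0] N0 in auto)
    have "prob (bad i j) \<le> 2 * exp (- 2 * \<epsilon>\<^sup>2 / V)"
      unfolding bad_def init_dist_def
    proof (rule bounded_differences_two_sided[OF prob_space_uniform_pi finite_param_indices _ Kb Kd])
      show "K i j \<in> borel_measurable (Pi\<^sub>M (param_indices Q) (\<lambda>_. uniform_measure lborel {0..pi}))"
        unfolding K_def using empirical_ntk_measurable[OF Q] by (simp add: init_dist_def)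
    qed (use P c \<epsilon> V V_def in simp_all)
    also have "- 2 * \<epsilon>\<^sup>2 / V = - lg + - lg"
      unfolding V \<epsilon>_def using P c lg by (simp add: power_mult_distrib)
    also have "exp (- lg + - lg) = (\<delta> / (2 * real n ^ 2)) * (\<delta> / (2 * real n ^ 2))"
    proof -
      have "0 < 2 * real n ^ 2 / \<delta>" using arg by simp
      then have "exp (- lg) = \<delta> / (2 * real n ^ 2)" unfolding lg_def exp_minus by (subst exp_ln) simp_all
      then show ?thesis by (simp only: exp_add)
    qed
    \<comment> \<open>Each tail is 2 w^2 with w = \<delta> / (2 n^2); as w \<le> 1/2, this is at
      most w, and n^2 times w is \<delta> / 2.\<close>
    also have "2 * ((\<delta> / (2 * real n ^ 2)) * (\<delta> / (2 * real n ^ 2))) \<le> \<delta> / (2 * real n ^ 2)"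
    proof -
      define w where "w = \<delta> / (2 * real n ^ 2)"
      have "2 * w \<le> 1" "0 \<le> w" using n \<delta> arg by (simp_all add: w_def divide_le_eq_1 order_trans[of \<delta> 1])
      then have "2 * (w * w) \<le> w" using mult_right_mono[of "2 * w" 1 w] by simp
      then show ?thesis by (simp only: w_def)
    qed
    finally show ?thesis by simp
  qed
  have "prob (\<Union>ij\<in>{..<n} \<times> {..<n}. (\<lambda>(i, j). bad i j) ij) \<le> (\<Sum>ij\<in>{..<n} \<times> {..<n}. prob ((\<lambda>(i, j). bad i j) ij))"
    by (rule finite_measure_subadditive_finite) (auto simp: bad_m)
  also have "\<dots> \<le> (\<Sum>ij\<in>{..<n} \<times> {..<n}. \<delta> / (2 * real n ^ 2))"
    by (rule sum_mono) (auto intro: p)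
  also have "\<dots> = \<delta> / 2" using n by (simp add: power2_eq_square)
  finally have pu: "prob (\<Union>(i, j)\<in>{..<n} \<times> {..<n}. bad i j) \<le> \<delta> / 2" .
  have un_m: "(\<Union>(i, j)\<in>{..<n} \<times> {..<n}. bad i j) \<in> sets ?M"
    by (rule sets.finite_UN) (auto simp: bad_m)
  show ?thesis
  proof (rule that[of A])
    show "A \<in> sets ?M" unfolding A_def using bad0_m un_m by auto
    have "prob (bad0 \<union> (\<Union>(i, j)\<in>{..<n} \<times> {..<n}. bad i j)) \<le> prob bad0 + prob (\<Union>(i, j)\<in>{..<n} \<times> {..<n}. bad i j)"
      by (rule measure_Un_le[OF bad0_m un_m])
    also have "\<dots> \<le> \<delta>" using p0 pu by simp
    finally show "prob A \<ge> 1 - \<delta>" unfolding A_def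
      using bad0_m un_m by (subst prob_compl) auto
    fix \<theta> assume \<theta>: "\<theta> \<in> A"
    then have "S \<theta> \<le> 2 * real n / \<delta>" by (auto simp: A_def bad0_def)
    then show "L2_set (\<lambda>j. f_model Q \<theta> (xs j)) {..<n} \<le> sqrt (2 * real n / \<delta>)"
      by (simp add: L2_set_def S_def)
    fix i j assume "i < n" "j < n"
    then have "\<theta> \<notin> bad i j" "\<theta> \<in> space ?M" using \<theta> by (auto simp: A_def)
    then have "\<bar>K i j \<theta> - integral\<^sup>L ?M (K i j)\<bar> \<le> \<epsilon>" by (simp add: bad_def)
    then have "\<bar>tangent_kernel (param_indices Q) (f_model Q) \<theta> (xs i) (xs j) - ntk Q (xs i) (xs j)\<bar> \<le> \<epsilon>"
      by (simp add: K_def[abs_def] ntk_def empirical_ntk_eq[OF Q])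
    then show "real n * \<bar>tangent_kernel (param_indices Q) (f_model Q) \<theta> (xs i) (xs j) - ntk Q (xs i) (xs j)\<bar> \<le> g_const Q n \<delta>"
      unfolding g by (rule mult_left_mono) simp
  qed
qed

lemma lambda_min_le_quad_form:
  "lambda_min Q n xs * (\<Sum>j<n. (v j)\<^sup>2) \<le> quad_form n (\<lambda>j k. ntk Q (xs j) (xs k)) v"
  unfolding lambda_min_def ntk_mat_def
  by (rule Min_spectrum_le_quad_form) (simp add: ntk_def empirical_ntk_def mult.commute)

section \<open>Gradient flows\<close>

lemma partial_deriv_cost:
  assumes "\<And>j. j < n \<Longrightarrow> ((\<lambda>s. F (\<theta>(i := s)) (xs j)) has_real_derivative D j) (at (\<theta> i))"
  shows "partial_deriv i (cost n xs ys F) \<theta> = (\<Sum>j<n. (F \<theta> (xs j) - ys j) * D j)"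
proof -
  have triv: "\<theta>(i := \<theta> i) = \<theta>" by (rule fun_upd_triv)
  have "((\<lambda>s. \<Sum>j<n. (F (\<theta>(i := s)) (xs j) - ys j)\<^sup>2) has_real_derivative
      (\<Sum>j<n. 2 * (F (\<theta>(i := \<theta> i)) (xs j) - ys j) * D j)) (at (\<theta> i))"
  proof (rule DERIV_sum)
    fix j assume "j \<in> {..<n}"
    then have d: "((\<lambda>s. F (\<theta>(i := s)) (xs j)) has_real_derivative D j) (at (\<theta> i))" using assms by simp
    show "((\<lambda>s. (F (\<theta>(i := s)) (xs j) - ys j)\<^sup>2) has_real_derivative 2 * (F (\<theta>(i := \<theta> i)) (xs j) - ys j) * D j) (at (\<theta> i))"
      by (rule derivative_eq_intros d refl)+ simp
  qed
  moreover have half: "1 / 2 * (\<Sum>j<n. 2 * (F \<theta> (xs j) - ys j) * D j) = (\<Sum>j<n. (F \<theta> (xs j) - ys j) * D j)"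
    unfolding sum_distrib_left by (intro sum.cong refl) simp
  ultimately have "((\<lambda>s. cost n xs ys F (\<theta>(i := s))) has_real_derivative (\<Sum>j<n. (F \<theta> (xs j) - ys j) * D j)) (at (\<theta> i))"
    unfolding cost_def half[symmetric] triv by (intro DERIV_cmult)
  then show ?thesis unfolding partial_deriv_def by (rule DERIV_imp_deriv)
qed

lemma gradient_flow_f_model:
  assumes Q: "valid_circuit Q" and flow: "gradient_flow Q \<eta> (cost n xs ys (f_model Q)) \<theta>0 \<gamma>"
    and i: "i \<in> param_indices Q" and t: "0 \<le> t"
  shows "((\<lambda>t. \<gamma> t i) has_real_derivative
      - \<eta> * (\<Sum>j<n. (f_model Q (\<gamma> t) (xs j) - ys j) * shift_diff i (\<lambda>\<theta>. f_model Q \<theta> (xs j)) (\<gamma> t))) (at t within {0..})"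
proof -
  have triv: "(\<gamma> t)(i := \<gamma> t i) = \<gamma> t" by (rule fun_upd_triv)
  have "((\<lambda>s. f_model Q ((\<gamma> t)(i := s)) (xs j)) has_real_derivative shift_diff i (\<lambda>\<theta>. f_model Q \<theta> (xs j)) (\<gamma> t)) (at (\<gamma> t i))" for j
    using trig_poly_has_derivative[OF trig_poly_f_model[OF Q, where x = "xs j"] i,
        where \<theta> = "\<gamma> t" and s = "\<gamma> t i" and S = UNIV] unfolding triv .
  then have "partial_deriv i (cost n xs ys (f_model Q)) (\<gamma> t)
     = (\<Sum>j<n. (f_model Q (\<gamma> t) (xs j) - ys j) * shift_diff i (\<lambda>\<theta>. f_model Q \<theta> (xs j)) (\<gamma> t))"
    by (rule partial_deriv_cost)
  then show ?thesis using flow i t unfolding gradient_flow_def by metis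
qed

lemma f_lin_eq:
  "valid_circuit Q \<Longrightarrow> f_lin Q \<theta>0 \<theta> x = f_model Q \<theta>0 x + (\<Sum>i\<in>param_indices Q. shift_diff i (\<lambda>\<theta>. f_model Q \<theta> x) \<theta>0 * (\<theta> i - \<theta>0 i))"
  unfolding f_lin_def by (simp add: partial_deriv_trig_poly[OF trig_poly_f_model])

lemma gradient_flow_f_lin:
  assumes Q: "valid_circuit Q" and flow: "gradient_flow Q \<eta> (cost n xs ys (f_lin Q \<theta>0)) \<theta>0 \<gamma>"
    and i: "i \<in> param_indices Q" and t: "0 \<le> t"
  shows "((\<lambda>t. \<gamma> t i) has_real_derivative
      - \<eta> * (\<Sum>j<n. (f_model Q \<theta>0 (xs j) + (\<Sum>i\<in>param_indices Q. shift_diff i (\<lambda>\<theta>. f_model Q \<theta> (xs j)) \<theta>0 * (\<gamma> t i - \<theta>0 i)) - ys j)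
         * shift_diff i (\<lambda>\<theta>. f_model Q \<theta> (xs j)) \<theta>0)) (at t within {0..})"
proof -
  have d: "((\<lambda>s. f_lin Q \<theta>0 ((\<gamma> t)(i := s)) (xs j)) has_real_derivative shift_diff i (\<lambda>\<theta>. f_model Q \<theta> (xs j)) \<theta>0) (at (\<gamma> t i))" for j
  proof -
    let ?D = "\<lambda>i. shift_diff i (\<lambda>\<theta>. f_model Q \<theta> (xs j)) \<theta>0"
    have "f_lin Q \<theta>0 ((\<gamma> t)(i := s)) (xs j) = f_model Q \<theta>0 (xs j) + (?D i * (s - \<theta>0 i)
       + (\<Sum>i'\<in>param_indices Q - {i}. ?D i' * (\<gamma> t i' - \<theta>0 i')))" for s
      unfolding f_lin_eq[OF Q] by (subst sum.remove[OF finite_param_indices i]) (auto intro!: sum.cong)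
    then show ?thesis by (simp only:) (auto intro!: derivative_eq_intros)
  qed
  have "partial_deriv i (cost n xs ys (f_lin Q \<theta>0)) (\<gamma> t)
     = (\<Sum>j<n. (f_lin Q \<theta>0 (\<gamma> t) (xs j) - ys j) * shift_diff i (\<lambda>\<theta>. f_model Q \<theta> (xs j)) \<theta>0)"
    by (rule partial_deriv_cost) (rule d)
  then show ?thesis using flow i t unfolding gradient_flow_def f_lin_eq[OF Q, symmetric] by metis
qed

section \<open>Constants\<close>

text \<open>The claim amounts to u^3 - 16/3 u^2 + 33 \<ge> 0. On the nonnegative axis the left side
  is minimal at u = 32/9, which explains the double root of the certificate, and the constant
  16384/729 is below 33.\<close>

lemma square_le_cube_bound:
  fixes u :: real assumes "0 \<le> u" shows "64 / 3 * u\<^sup>2 + 128 * u ^ 3 \<le> 132 * (1 + u ^ 3)"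
proof -
  have "0 \<le> (u - 32 / 9)\<^sup>2 * (u + 16 / 9)" using assms by simp
  also have "\<dots> = u ^ 3 - 16 / 3 * u\<^sup>2 + 16384 / 729"
    by (simp add: power2_eq_square power3_eq_cube field_simps)
  finally show ?thesis by simp
qed

text \<open>Here r is the smaller root of r * (a - B * r) = C, so the radius r equals C divided by
  the rate that it leaves. Nonnegativity of \<open>q\<close> makes the root real, and being the
  smaller one it uses up at most half of \<open>a\<close>.\<close>

lemma quadratic_root_identity:
  fixes a B C q :: real
  assumes a: "0 < a" and B: "0 < B" and q: "q = 1 - 4 * B * C / a\<^sup>2" "0 \<le> q"
    and r: "r = 1 / 2 * (1 / B) * a * (1 - sqrt q)"
  shows "a / 2 \<le> a - B * r" and "r = C / (a - B * r)"
proof -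
  define s where "s = sqrt q"
  have s: "0 \<le> s" "s * s = q" using q(2) by (simp_all add: s_def)
  have r': "r = a * (1 - s) / (2 * B)" by (simp add: r s_def)
  have e: "a - B * r = a * (1 + s) / 2" using B by (simp add: r' field_simps)
  show 1: "a / 2 \<le> a - B * r" unfolding e using a s(1) by simp
  have "r * (a - B * r) = a * (1 - s) / (2 * B) * (a * (1 + s) / 2)" by (simp only: e r'[symmetric])
  also have "\<dots> = a\<^sup>2 * (1 - s * s) / (4 * B)" by (simp add: field_simps power2_eq_square)
  also have "\<dots> = C" unfolding s(2) using a B by (simp add: q(1) field_simps)
  finally show "r = C / (a - B * r)" using 1 a by (simp add: eq_divide_eq)
qed

text \<open>The terms carry different powers of the normalization. Trading Nm^2 for 4/3 P M^2 in the
  first one turns 16 into 64/3 and equalizes the orders; the rest uses n \<le> n^2, N \<le> N^2 and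
  ln Nm \<ge> 0. The variable u stands for 1 / \<Lambda>.\<close>

lemma final_constant_bound:
  fixes n P M N Nm R u :: real
  assumes "1 \<le> n" "1 \<le> M" "1 \<le> N" "1 \<le> Nm" "0 < P" "0 \<le> u" and Nm: "3 * Nm\<^sup>2 \<le> 4 * P * M\<^sup>2"
  shows "16 * n * R\<^sup>2 * P * M ^ 3 * N / Nm ^ 3 * u\<^sup>2 + 128 * n\<^sup>2 * R\<^sup>2 * P\<^sup>2 * M ^ 5 * N / Nm ^ 5 * u ^ 3
    \<le> 132 * n\<^sup>2 * R\<^sup>2 * (1 + u ^ 3) * (P\<^sup>2 * M ^ 5 * N\<^sup>2 / Nm ^ 5) * (1 + ln Nm)"
proof -
  define Y where "Y = n\<^sup>2 * R\<^sup>2 * P\<^sup>2 * M ^ 5 * N\<^sup>2 / Nm ^ 5"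
  have Y0: "0 \<le> Y" using assms by (simp add: Y_def)
  have n2: "n \<le> n\<^sup>2" "N \<le> N\<^sup>2" using assms by (simp_all add: power2_eq_square)
  have "16 * n * R\<^sup>2 * P * M ^ 3 * N / Nm ^ 3 * u\<^sup>2 = (16 / 3) * n * R\<^sup>2 * P * M ^ 3 * N / Nm ^ 5 * u\<^sup>2 * (3 * Nm\<^sup>2)"
    using assms(4) by (simp add: field_simps eval_nat_numeral)
  also have "\<dots> \<le> (16 / 3) * n * R\<^sup>2 * P * M ^ 3 * N / Nm ^ 5 * u\<^sup>2 * (4 * P * M\<^sup>2)"
    using assms by (intro mult_left_mono[OF Nm]) simp
  also have "\<dots> = 64 / 3 * u\<^sup>2 * ((n * N) * (R\<^sup>2 * P\<^sup>2 * M ^ 5 / Nm ^ 5))"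
    by (simp add: field_simps eval_nat_numeral)
  also have "\<dots> \<le> 64 / 3 * u\<^sup>2 * ((n\<^sup>2 * N\<^sup>2) * (R\<^sup>2 * P\<^sup>2 * M ^ 5 / Nm ^ 5))"
    using assms n2 by (intro mult_left_mono mult_right_mono mult_mono) auto
  also have "\<dots> = 64 / 3 * u\<^sup>2 * Y" by (simp add: Y_def field_simps)
  finally have 1: "16 * n * R\<^sup>2 * P * M ^ 3 * N / Nm ^ 3 * u\<^sup>2 \<le> 64 / 3 * u\<^sup>2 * Y" .
  have "128 * n\<^sup>2 * R\<^sup>2 * P\<^sup>2 * M ^ 5 * N / Nm ^ 5 * u ^ 3 = 128 * u ^ 3 * (N * (n\<^sup>2 * R\<^sup>2 * P\<^sup>2 * M ^ 5 / Nm ^ 5))"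
    by (simp add: field_simps)
  also have "\<dots> \<le> 128 * u ^ 3 * (N\<^sup>2 * (n\<^sup>2 * R\<^sup>2 * P\<^sup>2 * M ^ 5 / Nm ^ 5))"
    using assms n2 by (intro mult_left_mono mult_right_mono) auto
  also have "\<dots> = 128 * u ^ 3 * Y" by (simp add: Y_def field_simps)
  finally have "16 * n * R\<^sup>2 * P * M ^ 3 * N / Nm ^ 3 * u\<^sup>2 + 128 * n\<^sup>2 * R\<^sup>2 * P\<^sup>2 * M ^ 5 * N / Nm ^ 5 * u ^ 3
     \<le> (64 / 3 * u\<^sup>2 + 128 * u ^ 3) * Y"
    using 1 by (simp add: distrib_right)
  also have "\<dots> \<le> (132 * (1 + u ^ 3)) * Y"
    using square_le_cube_bound[OF assms(6)] Y0 by (rule mult_right_mono)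
  also have "\<dots> \<le> (132 * (1 + u ^ 3)) * Y * (1 + ln Nm)"
    using mult_left_mono[of 1 "1 + ln Nm" "(132 * (1 + u ^ 3)) * Y"] Y0 assms by simp
  also have "\<dots> = 132 * n\<^sup>2 * R\<^sup>2 * (1 + u ^ 3) * (P\<^sup>2 * M ^ 5 * N\<^sup>2 / Nm ^ 5) * (1 + ln Nm)"
    by (simp add: Y_def field_simps)
  finally show ?thesis .
qed

theorem theorem7p1:
  fixes \<X> :: "(real ^ 'd) set" and Q :: "(real ^ 'd) qnn"
    and n :: nat and xs :: "nat \<Rightarrow> real ^ 'd" and ys :: "nat \<Rightarrow> real" and \<eta> \<delta> :: real
  assumes "finite \<X>" and "valid_circuit Q" and "valid_init \<X> Q"
    and "1 \<le> n" and "\<forall>i<n. xs i \<in> \<X>"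
    and "0 < \<eta>"
    and "invertible_mat (ntk_mat Q n xs)"
    and "0 < \<delta>" and "\<delta> < 1"
    and "lambda_min Q n xs \<ge>
           96 * real n * sqrt (real (layers Q * qubits Q)) * real (card_M Q) ^ 2 * real (card_N Q)
             / normalization Q ^ 2 * sqrt (ln (2 * real n ^ 2 / \<delta>))"
    and rho_real: "rho_radicand Q n xs ys \<delta> \<ge> 0"
  shows "\<exists>\<Lambda>>0.
    \<Lambda> = lambda_min Q n xs - g_const Q n \<delta> - h_const Q n xs ys \<delta> \<and>
    \<Lambda> \<ge> 1 / 3 * lambda_min Q n xs \<and>
    (\<exists>A\<in>sets (init_dist Q). measure (init_dist Q) A \<ge> 1 - \<delta> \<and>
      (\<forall>\<Theta>0\<in>A. \<forall>\<Theta> \<Theta>lin.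
        gradient_flow Q \<eta> (cost n xs ys (f_model Q)) \<Theta>0 \<Theta> \<longrightarrow>
        gradient_flow Q \<eta> (cost n xs ys (f_lin Q \<Theta>0)) \<Theta>0 \<Theta>lin \<longrightarrow>
          (\<forall>t\<ge>0. cost n xs ys (f_model Q) (\<Theta> t) \<le>
             R_const n ys \<delta> ^ 2 / 2 * exp (- 2 * \<eta> * \<Lambda> * t)) \<and>
          (\<forall>t\<ge>0. params_dist_inf Q (\<Theta> t) \<Theta>0 \<le>
             2 * sqrt (real n) * R_const n ys \<delta> * real (card_M Q) / normalization Q
               * (1 / \<Lambda>) * (1 - exp (- \<eta> * \<Lambda> * t))) \<and>
          (SUP (x, t) \<in> \<X> \<times> {0..}. ereal \<bar>f_model Q (\<Theta> t) x - f_lin Q \<Theta>0 (\<Theta>lin t) x\<bar>) \<le>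
             ereal (132 * real n ^ 2 * R_const n ys \<delta> ^ 2 * (1 + 1 / \<Lambda> ^ 3)
               * (real (layers Q) ^ 2 * real (qubits Q) ^ 2 * real (card_M Q) ^ 5
                    * real (card_N Q) ^ 2 / normalization Q ^ 5)
               * (1 + ln (normalization Q)))))"
proof -
  note Q = assms(2) and vinit = assms(3) and n = assms(4) and \<delta> = assms(8,9)
  have xs: "\<And>j. j < n \<Longrightarrow> xs j \<in> \<X>" using assms(5) by blast
  have ne: "\<X> \<noteq> {}" using xs[of 0] n by auto
  define Nm where "Nm = normalization Q"
  define M where "M = real (card_M Q)"
  define N where "N = real (card_N Q)"
  define P where "P = real (layers Q * qubits Q)"
  define R where "R = R_const n ys \<delta>"
  define g where "g = g_const Q n \<delta>"
  define lm where "lm = lambda_min Q n xs"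
  define a where "a = lm - g"
  \<comment> \<open>The bounds fed to the lazy regime: c for the change of the kernel per
    coordinate, p for the gradient. B converts a displacement of all P coordinates into a loss of
    the quadratic form, the factor n accounting for the matrix size.\<close>
  define c where "c = 16 * M ^ 2 * N / Nm ^ 2"
  define p where "p = 2 * M / Nm"
  define B where "B = real n * (c * P)"
  define \<Lambda> where "\<Lambda> = a - h_const Q n xs ys \<delta>"
  have Nm: "1 \<le> Nm" "0 < Nm" using vinit by (auto simp: valid_init_def Nm_def)
  have N0: "0 < normalization Q" using Nm by (simp add: Nm_def)
  have M: "1 \<le> M" and N: "1 \<le> N" using cones_nonempty[OF Q] by (simp_all add: M_def N_def)
  have P: "0 < P" using Q by (simp add: P_def valid_circuit_def)
  have PI: "real (card (param_indices Q)) = P" by (simp add: P_def param_indices_def)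
  have c: "0 < c" using M N Nm by (simp add: c_def)
  have p: "0 < p" using M Nm by (simp add: p_def)
  have R: "0 < R" using n \<delta> by (simp add: R_def R_const_def L2_set_nonneg add_nonneg_pos)
  have B: "0 < B" using n c P by (simp add: B_def)
  have "1 < 2 * real n ^ 2 / \<delta>"
  proof -
    have "1 \<le> real n ^ 2" using n by simp
    then show ?thesis using \<delta> by (simp add: field_simps)
  qed
  then have "0 < g" unfolding g_def g_const_def using n Q M N Nm
    by (simp add: valid_circuit_def M_def N_def Nm_def)
  \<comment> \<open>The assumed threshold 96 is six times the 16 in \<open>g_const\<close>.\<close>
  moreover have "6 * g \<le> lm" using assms(10) by (simp add: g_def g_const_def lm_def)
  ultimately have lm: "0 < lm" "5 / 6 * lm \<le> a" by (simp_all add: a_def)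
  then have a: "0 < a" by simp
  \<comment> \<open>The constant 128 factors as 4 * 16 * 2: the 4 of the discriminant, the 16 of
    \<open>c\<close> and the 2 of \<open>p\<close>.\<close>
  have rad: "rho_radicand Q n xs ys \<delta> = 1 - 4 * B * (p * sqrt (real n) * R) / a\<^sup>2"
    unfolding rho_radicand_def B_def c_def p_def
    by (simp add: Nm_def M_def N_def P_def R_def a_def lm_def g_def power2_eq_square power3_eq_cube mult_ac)
  have rho: "rho Q n xs ys \<delta> = 1 / 2 * (1 / B) * a * (1 - sqrt (rho_radicand Q n xs ys \<delta>))"
    unfolding rho_def B_def c_def by (simp add: Nm_def M_def N_def P_def a_def lm_def g_def)
  have h: "h_const Q n xs ys \<delta> = B * rho Q n xs ys \<delta>"
    unfolding h_const_def B_def c_def by (simp add: Nm_def M_def N_def P_def)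
  have \<Lambda>a: "a / 2 \<le> \<Lambda>" and \<rho>: "rho Q n xs ys \<delta> = p * sqrt (real n) * R / \<Lambda>"
    using quadratic_root_identity[OF a B rad rho_real rho] by (simp_all add: \<Lambda>_def h)
  have \<Lambda>: "0 < \<Lambda>" using \<Lambda>a a by simp
  have \<Lambda>3: "1 / 3 * lm \<le> \<Lambda>" using \<Lambda>a lm by simp
  obtain A where A: "A \<in> sets (init_dist Q)" "measure (init_dist Q) A \<ge> 1 - \<delta>"
    "\<And>\<theta>. \<theta> \<in> A \<Longrightarrow> L2_set (\<lambda>j. f_model Q \<theta> (xs j)) {..<n} \<le> sqrt (2 * real n / \<delta>)"
    "\<And>\<theta> i j. \<theta> \<in> A \<Longrightarrow> i < n \<Longrightarrow> j < n \<Longrightarrow>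
      real n * \<bar>tangent_kernel (param_indices Q) (f_model Q) \<theta> (xs i) (xs j) - ntk Q (xs i) (xs j)\<bar> \<le> g_const Q n \<delta>"
    using good_initialization[OF Q vinit assms(1,5) n \<delta>] by blast
  have main: "(\<forall>t\<ge>0. cost n xs ys (f_model Q) (\<gamma> t) \<le> R ^ 2 / 2 * exp (- 2 * \<eta> * \<Lambda> * t)) \<and>
          (\<forall>t\<ge>0. params_dist_inf Q (\<gamma> t) \<theta>0 \<le>
             2 * sqrt (real n) * R * M / Nm * (1 / \<Lambda>) * (1 - exp (- \<eta> * \<Lambda> * t))) \<and>
          (\<forall>x\<in>\<X>. \<forall>t\<ge>0. \<bar>f_model Q (\<gamma> t) x - f_lin Q \<theta>0 (\<gamma>l t) x\<bar> \<le>
             132 * real n ^ 2 * R ^ 2 * (1 + (1 / \<Lambda>) ^ 3) * (P\<^sup>2 * M ^ 5 * N ^ 2 / Nm ^ 5) * (1 + ln Nm))"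
    if \<theta>0: "\<theta>0 \<in> A" and flow: "gradient_flow Q \<eta> (cost n xs ys (f_model Q)) \<theta>0 \<gamma>"
      and flow_lin: "gradient_flow Q \<eta> (cost n xs ys (f_lin Q \<theta>0)) \<theta>0 \<gamma>l" for \<theta>0 \<gamma> \<gamma>l
  proof -
    let ?K = "tangent_kernel (param_indices Q) (f_model Q)"
    have lip: "\<bar>?K (\<theta>(i := s)) x x' - ?K \<theta> x x'\<bar> \<le> c * \<bar>s - \<theta> i\<bar>" if "i \<in> param_indices Q" for x x' i \<theta> s
    proof -
      have "\<bar>?K (\<theta>(i := s)) x x' - ?K \<theta> x x'\<bar> \<le> c * min 1 \<bar>s - \<theta> i\<bar>"
        unfolding c_def M_def N_def Nm_def by (rule tangent_kernel_coord_diff[OF Q that N0])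
      also have "\<dots> \<le> c * \<bar>s - \<theta> i\<bar>" using c by (intro mult_left_mono) auto
      finally show ?thesis .
    qed
    \<comment> \<open>Two entrywise errors separate the current kernel from its mean: g / n from the
      random initialization and c * P * \<rho> from the motion inside the ball. As quadratic forms
      they cost \<open>g_const\<close> and \<open>h_const\<close>, and \<Lambda> is what is left of
      \<open>lambda_min\<close>.\<close>
    have psd: "\<Lambda> * (\<Sum>j<n. (v j)\<^sup>2) \<le> quad_form n (\<lambda>j k. ?K \<theta> (xs j) (xs k)) v"
      if near: "\<And>i. i \<in> param_indices Q \<Longrightarrow> \<bar>\<theta> i - \<theta>0 i\<bar> \<le> p * sqrt (real n) * R / \<Lambda>" for \<theta> v
    proof -
      define e where "e j k = ?K \<theta> (xs j) (xs k) - ntk Q (xs j) (xs k)" for j k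
      have e: "\<bar>e j k\<bar> \<le> g / real n + c * P * rho Q n xs ys \<delta>" if jk: "j < n" "k < n" for j k
      proof -
        have "\<bar>?K \<theta> (xs j) (xs k) - ?K \<theta>0 (xs j) (xs k)\<bar> \<le> c * (\<Sum>i\<in>param_indices Q. \<bar>\<theta> i - \<theta>0 i\<bar>)"
        proof (rule coordwise_lipschitz[OF finite_param_indices])
          show "?K \<theta> (xs j) (xs k) = ?K \<theta>' (xs j) (xs k)" if "\<And>i. i \<in> param_indices Q \<Longrightarrow> \<theta> i = \<theta>' i" for \<theta> \<theta>'
            by (rule tangent_kernel_cong[where f = "f_model Q", OF trig_poly_f_model[OF Q] trig_poly_f_model[OF Q]]) (rule that)
        qed (rule lip)
        also have "\<dots> \<le> c * (\<Sum>i\<in>param_indices Q. rho Q n xs ys \<delta>)"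
          using c near unfolding \<rho> by (intro mult_left_mono sum_mono) auto
        also have "\<dots> = c * P * rho Q n xs ys \<delta>" by (simp add: PI)
        finally have 1: "\<bar>?K \<theta> (xs j) (xs k) - ?K \<theta>0 (xs j) (xs k)\<bar> \<le> c * P * rho Q n xs ys \<delta>" .
        have 2: "\<bar>?K \<theta>0 (xs j) (xs k) - ntk Q (xs j) (xs k)\<bar> \<le> g / real n"
          using A(4)[OF \<theta>0 jk] n by (simp add: g_def pos_le_divide_eq mult.commute)
        show ?thesis using 1 2 unfolding e_def by linarith
      qed
      have "0 \<le> g / real n + c * P * rho Q n xs ys \<delta>" using e[of 0 0] n by simp
      from abs_bilinear_le[of n e, OF e this]
      have "\<bar>\<Sum>i<n. \<Sum>j<n. v i * e i j * v j\<bar> \<le> real n * (g / real n + c * P * rho Q n xs ys \<delta>) * L2_set v {..<n} * L2_set v {..<n}" .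
      also have "\<dots> = (g + h_const Q n xs ys \<delta>) * (\<Sum>j<n. (v j)\<^sup>2)"
      proof -
        have "L2_set v {..<n} * L2_set v {..<n} = (\<Sum>j<n. (v j)\<^sup>2)" by (simp add: L2_set_def sum_nonneg)
        moreover have "real n * (g / real n + c * P * rho Q n xs ys \<delta>) = g + h_const Q n xs ys \<delta>"
          using n by (simp add: h B_def distrib_left)
        ultimately show ?thesis by (simp only: mult.assoc)
      qed
      finally have "- ((g + h_const Q n xs ys \<delta>) * (\<Sum>j<n. (v j)\<^sup>2)) \<le> (\<Sum>i<n. \<Sum>j<n. v i * e i j * v j)" by linarith
      moreover have "quad_form n (\<lambda>j k. ?K \<theta> (xs j) (xs k)) v = quad_form n (\<lambda>j k. ntk Q (xs j) (xs k)) v + (\<Sum>i<n. \<Sum>j<n. v i * e i j * v j)"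
        unfolding quad_form_def sum.distrib[symmetric] by (intro sum.cong refl) (simp add: e_def algebra_simps)
      moreover have "lm * (\<Sum>j<n. (v j)\<^sup>2) \<le> quad_form n (\<lambda>j k. ntk Q (xs j) (xs k)) v"
        unfolding lm_def by (rule lambda_min_le_quad_form)
      moreover have "\<Lambda> * (\<Sum>j<n. (v j)\<^sup>2) = lm * (\<Sum>j<n. (v j)\<^sup>2) - (g + h_const Q n xs ys \<delta>) * (\<Sum>j<n. (v j)\<^sup>2)"
        by (simp add: \<Lambda>_def a_def left_diff_distrib distrib_right)
      ultimately show ?thesis by linarith
    qed
    have init_R: "L2_set (\<lambda>j. f_model Q \<theta>0 (xs j) - ys j) {..<n} \<le> R"
    proof -
      have "L2_set (\<lambda>j. f_model Q \<theta>0 (xs j) + - ys j) {..<n} \<le> L2_set (\<lambda>j. f_model Q \<theta>0 (xs j)) {..<n} + L2_set (\<lambda>j. - ys j) {..<n}"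
        by (rule L2_set_triangle_ineq)
      also have "L2_set (\<lambda>j. - ys j) {..<n} = L2_set ys {..<n}" by (simp add: L2_set_def)
      finally show ?thesis using A(3)[OF \<theta>0] by (simp add: R_def R_const_def)
    qed
    interpret lazy_training "param_indices Q" "f_model Q" \<X> n xs ys \<eta> p c \<Lambda> R \<theta>0 \<gamma> \<gamma>l
    proof
      show "\<bar>shift_diff i (\<lambda>\<theta>. f_model Q \<theta> x) \<theta>\<bar> \<le> p" if "i \<in> param_indices Q" for x i \<theta>
        unfolding p_def M_def Nm_def by (rule shift_diff_f_model_bound[OF Q that N0])
      show "\<gamma> 0 i = \<theta>0 i" "\<gamma>l 0 i = \<theta>0 i" if "i \<in> param_indices Q" for i
        using flow flow_lin that by (simp_all add: gradient_flow_def)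
    qed (use trig_poly_f_model[OF Q] n xs assms(6) p c \<Lambda> R lip psd init_R
           gradient_flow_f_model[OF Q flow] gradient_flow_f_lin[OF Q flow_lin] in auto)
    have cost: "cost n xs ys (f_model Q) (\<gamma> t) \<le> R ^ 2 / 2 * exp (- 2 * \<eta> * \<Lambda> * t)" if t: "0 \<le> t" for t
    proof -
      have "cost n xs ys (f_model Q) (\<gamma> t) = 1 / 2 * (L2_set (r t) {..<n})\<^sup>2"
        by (simp add: cost_def r_def L2_set_def sum_nonneg)
      also have "\<dots> \<le> 1 / 2 * (R * exp (- \<eta> * \<Lambda> * t))\<^sup>2"
        by (intro mult_left_mono power_mono residual_bound[OF t] L2_set_nonneg) simp
      also have "\<dots> = R ^ 2 / 2 * exp (- 2 * \<eta> * \<Lambda> * t)"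
        by (simp add: power_mult_distrib mult.assoc flip: exp_double)
      finally show ?thesis .
    qed
    have dist: "params_dist_inf Q (\<gamma> t) \<theta>0 \<le> 2 * sqrt (real n) * R * M / Nm * (1 / \<Lambda>) * (1 - exp (- \<eta> * \<Lambda> * t))"
      if t: "0 \<le> t" for t
    proof -
      have "param_indices Q \<noteq> {}" using P PI by auto
      then have "params_dist_inf Q (\<gamma> t) \<theta>0 \<le> \<rho> * (1 - exp (- \<eta> * \<Lambda> * t))"
        unfolding params_dist_inf_def using displacement_bound[OF t] by (subst Max_le_iff) auto
      also have "\<rho> = 2 * sqrt (real n) * R * M / Nm * (1 / \<Lambda>)"
        unfolding \<rho>_def unfolding p_def by simp
      finally show ?thesis .
    qed
    have lin: "\<bar>f_model Q (\<gamma> t) x - f_lin Q \<theta>0 (\<gamma>l t) x\<bar> \<le>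
             132 * real n ^ 2 * R ^ 2 * (1 + (1 / \<Lambda>) ^ 3) * (P\<^sup>2 * M ^ 5 * N ^ 2 / Nm ^ 5) * (1 + ln Nm)"
      if t: "0 \<le> t" and x: "x \<in> \<X>" for t x
    proof -
      have sq: "sqrt (real n) * sqrt (real n) = real n" by simp
      have "\<bar>f_model Q (\<gamma> t) x - f_lin Q \<theta>0 (\<gamma>l t) x\<bar> = \<bar>dev t x\<bar>"
        by (simp add: dev_def fl_def f_lin_eq[OF Q])
      also have "\<dots> \<le> sqrt (real n) * c * P * \<rho> * R / (2 * \<Lambda>) + P * p\<^sup>2 * sqrt (real n) * real n * c * P * \<rho> * R / \<Lambda>\<^sup>2"
        using dev_bound[OF t x] unfolding nparams_def PI .
      \<comment> \<open>One sqrt n comes from the sum over the samples, the other from \<rho>;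
        together they give n.\<close>
      also have "\<dots> = (sqrt (real n) * sqrt (real n)) * (c * P * p * R\<^sup>2 / (2 * \<Lambda>\<^sup>2))
           + (sqrt (real n) * sqrt (real n)) * (real n * (P * P * p\<^sup>2 * c * p * R\<^sup>2 / \<Lambda> ^ 3))"
        using \<Lambda> by (simp add: \<rho>_def field_simps eval_nat_numeral)
      also have "\<dots> = 16 * real n * R\<^sup>2 * P * M ^ 3 * N / Nm ^ 3 * (1 / \<Lambda>)\<^sup>2 + 128 * (real n)\<^sup>2 * R\<^sup>2 * P\<^sup>2 * M ^ 5 * N / Nm ^ 5 * (1 / \<Lambda>) ^ 3"
        unfolding sq c_def p_def using \<Lambda> Nm by (simp add: field_simps eval_nat_numeral)
      also have "\<dots> \<le> 132 * real n ^ 2 * R ^ 2 * (1 + (1 / \<Lambda>) ^ 3) * (P\<^sup>2 * M ^ 5 * N ^ 2 / Nm ^ 5) * (1 + ln Nm)"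
        using n M N Nm P \<Lambda> normalization_bound[OF assms(1) ne Q vinit]
        by (intro final_constant_bound) (simp_all add: Nm_def P_def M_def)
      finally show ?thesis .
    qed
    show ?thesis using cost dist lin by blast
  qed
  have P2: "P\<^sup>2 * M ^ 5 * N ^ 2 / Nm ^ 5 = real (layers Q) ^ 2 * real (qubits Q) ^ 2 * real (card_M Q) ^ 5 * real (card_N Q) ^ 2 / normalization Q ^ 5"
    by (simp add: P_def M_def N_def Nm_def power_mult_distrib)
  show ?thesis
  proof (intro exI[of _ \<Lambda>] conjI bexI[of _ A] ballI allI impI)
    show "0 < \<Lambda>" by (rule \<Lambda>)
    show "\<Lambda> = lambda_min Q n xs - g_const Q n \<delta> - h_const Q n xs ys \<delta>" by (simp add: \<Lambda>_def a_def lm_def g_def)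
    show "1 / 3 * lambda_min Q n xs \<le> \<Lambda>" using \<Lambda>3 by (simp add: lm_def)
    show "1 - \<delta> \<le> measure (init_dist Q) A" "A \<in> sets (init_dist Q)" by (rule A)+
    fix \<theta>0 \<gamma> \<gamma>l
    assume asm: "\<theta>0 \<in> A" "gradient_flow Q \<eta> (cost n xs ys (f_model Q)) \<theta>0 \<gamma>" "gradient_flow Q \<eta> (cost n xs ys (f_lin Q \<theta>0)) \<theta>0 \<gamma>l"
    note main = main[OF asm]
    show "cost n xs ys (f_model Q) (\<gamma> t) \<le> R_const n ys \<delta> ^ 2 / 2 * exp (- 2 * \<eta> * \<Lambda> * t)" if "0 \<le> t" for t
      using main that by (simp add: R_def)
    show "params_dist_inf Q (\<gamma> t) \<theta>0 \<le> 2 * sqrt (real n) * R_const n ys \<delta> * real (card_M Q) / normalization Q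
         * (1 / \<Lambda>) * (1 - exp (- \<eta> * \<Lambda> * t))" if "0 \<le> t" for t
      using main that by (simp add: R_def M_def Nm_def)
    show "(SUP (x, t) \<in> \<X> \<times> {0..}. ereal \<bar>f_model Q (\<gamma> t) x - f_lin Q \<theta>0 (\<gamma>l t) x\<bar>) \<le>
       ereal (132 * real n ^ 2 * R_const n ys \<delta> ^ 2 * (1 + 1 / \<Lambda> ^ 3)
         * (real (layers Q) ^ 2 * real (qubits Q) ^ 2 * real (card_M Q) ^ 5 * real (card_N Q) ^ 2 / normalization Q ^ 5)
         * (1 + ln (normalization Q)))" (is "_ \<le> ereal ?b")
    proof (rule SUP_least)
      have lin: "\<bar>f_model Q (\<gamma> t) x - f_lin Q \<theta>0 (\<gamma>l t) x\<bar> \<le> ?b" if "x \<in> \<X>" "0 \<le> t" for x t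
        using main that unfolding P2[symmetric] by (simp add: R_def Nm_def power_one_over)
      fix z assume "z \<in> \<X> \<times> {0 :: real..}"
      then show "(case z of (x, t) \<Rightarrow> ereal \<bar>f_model Q (\<gamma> t) x - f_lin Q \<theta>0 (\<gamma>l t) x\<bar>) \<le> ereal ?b"
        using lin by (cases z) simp
    qed
  qed
qed

end
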